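(* Let $\Omega$ be a bounded Lipschitz domain in $\mathbf{R}^d$, $d\geq 2$. Then there exists a constant $C=C(\Omega)>0$ such that for every Steklov eigenvalue $\lambda\neq 0$ of $\Omega$ and every corresponding Steklov eigenfunction $u_\lambda$, writing $\mathcal{Z}_{u_\lambda}=\{x\in\Omega : u_\lambda(x)=0\}$, one has $$\mathcal{Z}_{u_\lambda}\cap B\neq\emptyset$$ for any ball $B$ in $\mathbf{R}^d$ of radius $C/\lambda$ centered at a point of $\partial\Omega$.
   Context: A domain is a connected open set. A bounded domain $\Omega\subset\mathbf{R}^d$ is Lipschitz if for every $p\in\partial\Omega$ there is a hyperplane $H$ through $p$ such that locally $\partial\Omega$ is the graph of a Lipschitz function on $H$ and $\Omega$ is the set of points below that graph. The Steklov problem on $\Omega$ is $\Delta u=0$ in $\Omega$, $\partial_\nu u=\lambda u$ on $\partial\Omega$ ($\nu$ the outward unit normal), understood weakly: $u\in H^1(\Omega)=W^{1,2}(\Omega)$ satisfies $$\int_\Omega \nabla u\cdot\nabla v=\lambda\int_{\partial\Omega}uv\quad\text{for all } v\in H^1(\Omega),$$ with boundary values taken in the sense of Sobolev traces. A number $\lambda$ for which there is a nontrivial solution is a Steklov eigenvalue, and a nontrivial solution $u=u_\lambda$ is a Steklov eigenfunction. The Steklov eigenvalues form a discrete sequence $0=\lambda_0<\lambda_1\le\lambda_2\le\dots\to\infty$. Steklov eigenfunctions are harmonic in $\Omega$ and continuous on $\overline{\Omega}$ (taking the continuous representative). *)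

theory Defs
  imports "HOL-Analysis.Analysis"
begin

text \<open>
  For a unit vector \<open>n\<close>, the hyperplane through \<open>p\<close> orthogonal to \<open>n\<close> is
  \<open>{y. (y - p) \<bullet> n = 0}\<close>, the orthogonal projection of \<open>x\<close> onto it is
  \<open>x - ((x - p) \<bullet> n) *\<^sub>R n\<close>, and \<open>(x - p) \<bullet> n\<close> is the height of \<open>x\<close> above it.
\<close>

definition lipschitz_graph_at :: "'a::euclidean_space set \<Rightarrow> 'a \<Rightarrow> bool" where
  "lipschitz_graph_at \<Omega> p \<longleftrightarrow>
    (\<exists>n U f L. norm n = 1 \<and> open U \<and> p \<in> U \<and>
      L-lipschitz_on {y. (y - p) \<bullet> n = 0} f \<and>
      frontier \<Omega> \<inter> U = {x \<in> U. (x - p) \<bullet> n = f (x - ((x - p) \<bullet> n) *\<^sub>R n)} \<and>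
      \<Omega> \<inter> U = {x \<in> U. (x - p) \<bullet> n < f (x - ((x - p) \<bullet> n) *\<^sub>R n)})"

definition bounded_lipschitz_domain :: "'a::euclidean_space set \<Rightarrow> bool" where
  "bounded_lipschitz_domain \<Omega> \<longleftrightarrow>
    open \<Omega> \<and> connected \<Omega> \<and> bounded \<Omega> \<and> (\<forall>p \<in> frontier \<Omega>. lipschitz_graph_at \<Omega> p)"

text \<open>
  Hausdorff measure of integer dimension \<open>n \<ge> 1\<close>, normalised so that in an \<open>n\<close>-dimensional
  space it is Lebesgue measure. For \<open>n = 0\<close> the formula is not the counting measure, because
  the empty set would contribute \<open>0 ^ 0 = 1\<close> to a covering sum.
\<close>

definition hausdorff_premeasure :: "real \<Rightarrow> nat \<Rightarrow> 'a::metric_space set \<Rightarrow> ennreal" where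
  "hausdorff_premeasure \<delta> n A =
    (INF U \<in> {U :: nat \<Rightarrow> 'a set. A \<subseteq> (\<Union>i. U i) \<and> (\<forall>i. bounded (U i) \<and> diameter (U i) \<le> \<delta>)}.
      \<Sum>i. ennreal (unit_ball_vol (real n) * (diameter (U i) / 2) ^ n))"

definition hausdorff_outer_measure :: "nat \<Rightarrow> 'a::metric_space set \<Rightarrow> ennreal" where
  "hausdorff_outer_measure n A = (SUP \<delta> \<in> {0<..}. hausdorff_premeasure \<delta> n A)"

text \<open>
  The outer measure is additive on sets at positive distance from each other, hence
  countably additive on Borel sets by Caratheodory's criterion, so that \<open>measure_of\<close>
  does not fall back to the zero measure.
\<close>

definition hausdorff_measure :: "nat \<Rightarrow> 'a::metric_space measure" where
  "hausdorff_measure n = measure_of UNIV (sets borel) (hausdorff_outer_measure n)"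

definition surface_measure :: "'a::euclidean_space set \<Rightarrow> 'a measure" where
  "surface_measure \<Omega> = restrict_space (hausdorff_measure (DIM('a) - 1)) (frontier \<Omega>)"

fun Ck :: "nat \<Rightarrow> ('a::euclidean_space \<Rightarrow> real) \<Rightarrow> bool" where
  "Ck 0 f \<longleftrightarrow> continuous_on UNIV f"
| "Ck (Suc k) f \<longleftrightarrow> (\<forall>x. f differentiable (at x)) \<and>
     (\<forall>b\<in>Basis. Ck k (\<lambda>x. frechet_derivative f (at x) b))"

definition grad :: "('a::euclidean_space \<Rightarrow> real) \<Rightarrow> 'a \<Rightarrow> 'a" where
  "grad f x = (\<Sum>b\<in>Basis. frechet_derivative f (at x) b *\<^sub>R b)"

definition test_function :: "'a::euclidean_space set \<Rightarrow> ('a \<Rightarrow> real) \<Rightarrow> bool" where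
  "test_function \<Omega> \<phi> \<longleftrightarrow> (\<forall>k. Ck k \<phi>) \<and> (\<exists>K. compact K \<and> K \<subseteq> \<Omega> \<and> (\<forall>x. x \<notin> K \<longrightarrow> \<phi> x = 0))"

definition square_integrable :: "'a measure \<Rightarrow> ('a \<Rightarrow> 'b::euclidean_space) \<Rightarrow> bool" where
  "square_integrable M f \<longleftrightarrow> f \<in> borel_measurable M \<and> integrable M (\<lambda>x. (norm (f x))\<^sup>2)"

definition L2_tendsto ::
  "'a measure \<Rightarrow> (nat \<Rightarrow> 'a \<Rightarrow> 'b::euclidean_space) \<Rightarrow> ('a \<Rightarrow> 'b) \<Rightarrow> bool" where
  "L2_tendsto M f g \<longleftrightarrow> (\<lambda>k. \<integral>\<^sup>+x. ennreal ((norm (f k x - g x))\<^sup>2) \<partial>M) \<longlonglongrightarrow> 0"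

text \<open>\<open>has_H1_gradient \<Omega> u G\<close>: \<open>u\<close> belongs to \<open>W\<^sup>1\<^sup>,\<^sup>2(\<Omega>)\<close> and has weak gradient \<open>G\<close>.\<close>

definition has_H1_gradient ::
  "'a::euclidean_space set \<Rightarrow> ('a \<Rightarrow> real) \<Rightarrow> ('a \<Rightarrow> 'a) \<Rightarrow> bool" where
  "has_H1_gradient \<Omega> u G \<longleftrightarrow>
    square_integrable (lebesgue_on \<Omega>) u \<and> square_integrable (lebesgue_on \<Omega>) G \<and>
    (\<forall>\<phi>. test_function \<Omega> \<phi> \<longrightarrow>
      (LINT x|lebesgue_on \<Omega>. u x *\<^sub>R grad \<phi> x) = - (LINT x|lebesgue_on \<Omega>. \<phi> x *\<^sub>R G x))"

text \<open>
  The trace operator is the continuous extension to \<open>H\<^sup>1(\<Omega>)\<close> of the restriction of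
  \<open>C\<^sup>1\<close> functions to the boundary; \<open>has_trace \<Omega> u G g\<close> is its graph, where \<open>G\<close> is
  the weak gradient of \<open>u\<close>. On a bounded Lipschitz domain every \<open>u\<close> in \<open>H\<^sup>1(\<Omega>)\<close> has a
  trace \<open>g\<close>, unique up to null sets.
\<close>

definition has_trace ::
  "'a::euclidean_space set \<Rightarrow> ('a \<Rightarrow> real) \<Rightarrow> ('a \<Rightarrow> 'a) \<Rightarrow> ('a \<Rightarrow> real) \<Rightarrow> bool" where
  "has_trace \<Omega> u G g \<longleftrightarrow>
    square_integrable (surface_measure \<Omega>) g \<and>
    (\<exists>\<phi>. (\<forall>k. Ck 1 (\<phi> k)) \<and>
      L2_tendsto (lebesgue_on \<Omega>) \<phi> u \<and>
      L2_tendsto (lebesgue_on \<Omega>) (\<lambda>k. grad (\<phi> k)) G \<and>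
      L2_tendsto (surface_measure \<Omega>) \<phi> g)"

text \<open>
  On a bounded Lipschitz domain weak gradients and traces exist and are unique up to null sets,
  so quantifying over \<open>v\<close>, \<open>V\<close>, \<open>h\<close> below amounts to quantifying over all \<open>v\<close> in \<open>H\<^sup>1(\<Omega>)\<close>.
\<close>

definition steklov_eigenfunction ::
  "'a::euclidean_space set \<Rightarrow> real \<Rightarrow> ('a \<Rightarrow> real) \<Rightarrow> bool" where
  "steklov_eigenfunction \<Omega> \<sigma> u \<longleftrightarrow>
    \<not> (AE x in lebesgue_on \<Omega>. u x = 0) \<and>
    (\<exists>G g. has_H1_gradient \<Omega> u G \<and> has_trace \<Omega> u G g \<and>
      (\<forall>v V h. has_H1_gradient \<Omega> v V \<longrightarrow> has_trace \<Omega> v V h \<longrightarrow>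
        (LINT x|lebesgue_on \<Omega>. G x \<bullet> V x) = \<sigma> * (LINT x|surface_measure \<Omega>. g x * h x)))"

definition steklov_eigenvalue :: "'a::euclidean_space set \<Rightarrow> real \<Rightarrow> bool" where
  "steklov_eigenvalue \<Omega> \<sigma> \<longleftrightarrow> (\<exists>u. steklov_eigenfunction \<Omega> \<sigma> u)"

definition nodal_set :: "'a set \<Rightarrow> ('a \<Rightarrow> real) \<Rightarrow> 'a set" where
  "nodal_set \<Omega> u = {x \<in> \<Omega>. u x = 0}"

end

theory Submission
  imports Defs
begin

text \<open>
  Why the theorem holds. Suppose that a Steklov solution \<open>u\<close> with eigenvalue \<open>\<sigma> > 0\<close> is positive on
  \<open>\<Omega> \<inter> B\<close>, where \<open>B\<close> is a ball of radius \<open>r\<close> about a boundary point, and let \<open>\<psi> \<ge> 0\<close> be a cutoff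
  supported in \<open>B\<close> with \<open>|\<nabla>\<psi>|\<^sup>2 \<le> a \<psi>\<close>. Testing the weak equation with \<open>\<psi> / u\<close> and absorbing the mixed
  term by Young's inequality gives \<open>\<sigma> \<integral>\<^bsub>\<partial>\<Omega>\<^esub> \<psi> \<le> a / 2 |\<Omega> \<inter> B|\<close>. For a bump of radius \<open>r\<close> one may take
  \<open>a = 16 / r\<^sup>2\<close>, so the right-hand side is of order \<open>r ^ (d - 2)\<close>, whereas the left-hand side is at
  least of order \<open>\<sigma> r ^ (d - 1)\<close> because the boundary is a Lipschitz graph. Hence \<open>\<sigma> \<le> K / r\<close>, and a
  ball of radius larger than \<open>K / \<sigma>\<close> must meet the nodal set. This works as long as \<open>B\<close> lies in a
  chart; otherwise \<open>\<sigma>\<close> is bounded, the constant can be chosen such that the ball contains \<open>\<Omega>\<close>, and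
  the cutoff \<open>\<psi> = 1\<close> (with \<open>a = 0\<close>) shows that \<open>u\<close> cannot be positive on all of \<open>\<Omega>\<close>.

  Two points need care. The function \<open>\<psi> / u\<close> need not belong to \<open>H\<^sup>1\<close>, and nothing is known beforehand
  about the sign of the trace \<open>g\<close> of \<open>u\<close>. Therefore \<open>1 / u\<close> is replaced by a regularised reciprocal
  \<open>reg_inverse e u\<close>, which equals \<open>1 / (e + u)\<close> for \<open>u \<ge> 0\<close> and is such that \<open>t * reg_inverse e t\<close>
  tends to the indicator of \<open>t > 0\<close> as \<open>e \<rightarrow> 0\<close>. In the limit the boundary term only sees the part
  of the boundary on which \<open>g > 0\<close> (\<open>steklov_energy_estimate\<close>, \<open>steklov_boundary_estimate\<close>), and a
  lower bound for the size of this part is required. The same energy estimate bounds the gradient of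
  \<open>ln (u + e)\<close> in \<open>L\<^sup>2\<close> uniformly in \<open>e\<close>. Moving along the fibres of a chart from a compact set
  inside \<open>\<Omega>\<close>, on which \<open>u\<close> is bounded below, to the boundary (\<open>trace_fibre_estimate\<close>), one finds that
  \<open>ln (g + e)\<close> stays bounded in the mean, so that \<open>g > 0\<close> at the end of almost every fibre
  (\<open>trace_positive_on_lens\<close>).

  Surface measure enters only through two facts: a Lipschitz graph over a bounded set has finite
  Hausdorff measure (\<open>hausdorff_outer_measure_graph_finite\<close>, by a packing argument), and the points
  of depth at most \<open>T\<close> whose fibre ends in a set \<open>S\<close> have Lebesgue measure at most a multiple of \<open>T\<close>
  times the Hausdorff measure of \<open>S\<close> (\<open>emeasure_shadow_le_hausdorff\<close>, by covering tubes with balls).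
  Both are proved in the ambient space, without coordinates on the hyperplane of the chart.

  A negative eigenvalue would force the gradient and the trace of \<open>u\<close> to vanish, hence \<open>u = 0\<close>
  (\<open>steklov_solution_negative_eigenvalue\<close>).
\<close>

section \<open>Hausdorff measure is a Borel measure\<close>

lemma suminf_tail_tendsto_0_ennreal:
  fixes a :: "nat \<Rightarrow> ennreal"
  assumes "suminf a < \<infinity>"
  shows "(\<lambda>k. \<Sum>j. a (j + k)) \<longlonglongrightarrow> 0"
proof -
  have fin: "a i \<noteq> \<infinity>" for i
    using ennreal_suminf_lessD[of a \<infinity> i] assms by auto
  define b where "b i = enn2real (a i)" for i
  have ab: "a = (\<lambda>i. ennreal (b i))"
    using fin by (auto simp: b_def ennreal_enn2real_if)
  have b0: "0 \<le> b i" for i by (simp add: b_def)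
  have sb: "summable b"
    by (rule summable_suminf_not_top) (use b0 assms in \<open>simp_all add: ab\<close>)
  have "(\<Sum>j. a (j + k)) = ennreal (\<Sum>j. b (j + k))" for k
    unfolding ab using b0 sb by (intro suminf_ennreal2) (auto simp: summable_ignore_initial_segment)
  moreover have "(\<lambda>k. \<Sum>j. b (j + k)) \<longlonglongrightarrow> 0"
    using suminf_exist_split2[OF sb] .
  ultimately show ?thesis by (simp add: tendsto_ennrealI flip: ennreal_0)
qed

text \<open>
  Caratheodory's criterion for one closed set \<open>C\<close>. The part of \<open>X\<close> outside \<open>C\<close> is exhausted by the
  sets \<open>B k\<close> at distance at least \<open>1 / (k + 1)\<close> from \<open>C\<close>, to each of which, together with \<open>X \<inter> C\<close>,
  the assumption on separated sets applies. The error is controlled by the shells \<open>R k = B (k + 1) - B k\<close>: two shells whose indices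
  differ by at least two are separated, so the shells of even index and those of odd index each have
  total measure at most \<open>f X\<close>, and the tail of the series of all shells tends to 0.
\<close>

lemma metric_outer_measure_Diff_closed:
  fixes f :: "'a::metric_space set \<Rightarrow> ennreal"
  assumes mono: "\<And>A B. A \<subseteq> B \<Longrightarrow> f A \<le> f B"
    and csub: "\<And>A :: nat \<Rightarrow> 'a set. f (\<Union>i. A i) \<le> (\<Sum>i. f (A i))"
    and zero: "f {} = 0"
    and sep: "\<And>A B d. d > 0 \<Longrightarrow> (\<And>x y. x \<in> A \<Longrightarrow> y \<in> B \<Longrightarrow> d \<le> dist x y) \<Longrightarrow> f A + f B \<le> f (A \<union> B)"
    and cl: "closed C" "C \<noteq> {}" and fin: "f X < \<infinity>"
  shows "f (X \<inter> C) + f (X - C) \<le> f X"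
proof -
  have sub2: "f (A \<union> B) \<le> f A + f B" for A B
  proof -
    have "f (A \<union> B) \<le> (\<Sum>i. f (binaryset A B i))"
      using csub[of "binaryset A B"] by (simp add: UN_binaryset_eq)
    also have "\<dots> = f A + f B"
      by (rule suminf_binaryset_eq) (rule zero)
    finally show ?thesis .
  qed
  define B where "B k = {x \<in> X. infdist x C \<ge> 1 / real (Suc k)}" for k
  define R where "R k = B (Suc k) - B k" for k
  have Bmono: "B i \<subseteq> B j" if "i \<le> j" for i j
  proof -
    have "1 / real (Suc j) \<le> 1 / real (Suc i)" using that by (simp add: frac_le)
    then show ?thesis by (auto simp: B_def simp del: of_nat_Suc)
  qed
  have XB: "X - C = (\<Union>k. B k)"
  proof (intro equalityI subsetI)
    fix x assume x: "x \<in> X - C"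
    then have "infdist x C > 0" using cl infdist_pos_not_in_closed by blast
    then obtain k where "1 / real (Suc k) < infdist x C" using nat_approx_posE by metis
    then show "x \<in> (\<Union>k. B k)" using x by (auto simp: B_def intro!: exI[of _ k] simp del: of_nat_Suc)
  next
    fix x assume "x \<in> (\<Union>k. B k)"
    then obtain k where k: "x \<in> X" "1 / real (Suc k) \<le> infdist x C" by (auto simp: B_def)
    have "(0::real) < 1 / real (Suc k)" by simp
    then have "infdist x C > 0" using k by linarith
    then show "x \<in> X - C" using k by auto
  qed
  have step: "1 / real (Suc i) - 1 / real (Suc j) > 0" if "i < j" for i j
    using that by (simp add: frac_less2)
  have near: "infdist x C < 1 / real (Suc k)" if "x \<in> R k" for x k
    using that by (auto simp: R_def B_def)
  have far: "infdist x C \<ge> 1 / real (Suc k)" if "x \<in> B k" for x k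
    using that by (auto simp: B_def)
  have sepB: "f (B k) + f A \<le> f (B k \<union> A)" if "\<And>x. x \<in> A \<Longrightarrow> infdist x C \<le> 1 / real (Suc j)" "k < j" for A k j
  proof (rule sep[OF step[OF \<open>k < j\<close>]])
    fix x y assume "x \<in> B k" "y \<in> A"
    then show "1 / real (Suc k) - 1 / real (Suc j) \<le> dist x y"
      using far[of x k] that(1)[of y] infdist_triangle[of x C y] by linarith
  qed
  have alternate: "(\<Sum>i<m. f (R (2 * i + c + 1))) \<le> f (B (2 * m + c))" for m c
  proof (induction m)
    case (Suc m)
    have "f (B (2 * m + c)) + f (R (2 * m + c + 1)) \<le> f (B (2 * m + c) \<union> R (2 * m + c + 1))"
      by (rule sepB[of _ "2 * m + c + 1"]) (auto dest!: near intro: less_imp_le)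
    also have "\<dots> \<le> f (B (2 * Suc m + c))"
      using Bmono[of "2 * m + c" "2 * Suc m + c"] by (intro mono) (auto simp: R_def)
    finally have "f (B (2 * m + c)) + f (R (2 * m + c + 1)) \<le> f (B (2 * Suc m + c))" .
    moreover have "(\<Sum>i<Suc m. f (R (2 * i + c + 1))) \<le> f (B (2 * m + c)) + f (R (2 * m + c + 1))"
      using add_right_mono[OF Suc.IH] by simp
    ultimately show ?case by (rule order_trans[rotated])
  qed auto
  have BX: "f (B k) \<le> f X" for k
    by (intro mono) (auto simp: B_def)
  have "(\<Sum>i<m. f (R (i + 1))) \<le> 2 * f X" for m
  proof -
    have "(\<Sum>i<m. f (R (i + 1))) \<le> (\<Sum>i<2 * m. f (R (i + 1)))"
      by (intro sum_mono2) auto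
    also have "\<dots> = (\<Sum>i<m. f (R (2 * i + 0 + 1))) + (\<Sum>i<m. f (R (2 * i + 1 + 1)))"
      by (induction m) (auto simp: algebra_simps)
    also have "\<dots> \<le> f X + f X"
      by (intro add_mono order_trans[OF alternate BX])
    finally show ?thesis by (simp add: mult_2)
  qed
  then have "(\<Sum>i. f (R (i + 1))) \<le> 2 * f X"
    by (intro suminf_le_const) auto
  then have fin': "(\<Sum>i. f (R (i + 1))) < \<infinity>"
    by (rule le_less_trans) (use fin in \<open>simp add: ennreal_mult_less_top\<close>)
  have bound: "f (X \<inter> C) + f (X - C) \<le> f X + (\<Sum>j. f (R (j + k + 1)))" for k
  proof -
    have "x \<in> B (k + 1) \<union> (\<Union>j. R (j + k + 1))" if "x \<in> B i" for x i
      using that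
    proof (induction i)
      case 0
      then show ?case using Bmono[of 0 "k + 1"] by auto
    next
      case (Suc i)
      show ?case
      proof (cases "x \<in> B i \<or> Suc i \<le> k + 1")
        case True
        then show ?thesis using Suc Bmono[of "Suc i" "k + 1"] by auto
      next
        case False
        then have "x \<in> R ((i - (k + 1)) + k + 1)" using Suc.prems by (auto simp: R_def)
        then show ?thesis by blast
      qed
    qed
    then have "X - C \<subseteq> B (k + 1) \<union> (\<Union>j. R (j + k + 1))"
      unfolding XB by blast
    then have "f (X - C) \<le> f (B (k + 1)) + (\<Sum>j. f (R (j + k + 1)))"
      by (rule order_trans[OF mono order_trans[OF sub2 add_left_mono[OF csub]]])
    moreover have "f (X \<inter> C) + f (B (k + 1)) \<le> f X"
    proof -
      have "f (B (k + 1)) + f (X \<inter> C) \<le> f (B (k + 1) \<union> (X \<inter> C))"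
        by (rule sepB[of _ "k + 2"]) auto
      also have "\<dots> \<le> f X" by (intro mono) (auto simp: B_def)
      finally show ?thesis by (simp add: add.commute)
    qed
    ultimately have "f (X \<inter> C) + f (X - C) \<le> f (X \<inter> C) + (f (B (k + 1)) + (\<Sum>j. f (R (j + k + 1))))"
      and "f (X \<inter> C) + f (B (k + 1)) + (\<Sum>j. f (R (j + k + 1))) \<le> f X + (\<Sum>j. f (R (j + k + 1)))"
      by (auto intro: add_left_mono add_right_mono)
    then show ?thesis unfolding add.assoc by (rule order_trans)
  qed
  have "(\<lambda>k. f X + (\<Sum>j. f (R (j + k + 1)))) \<longlonglongrightarrow> f X + 0"
    using suminf_tail_tendsto_0_ennreal[OF fin'] by (intro tendsto_add tendsto_const) auto
  then show ?thesis
    using bound by (intro LIMSEQ_le_const[of _ "f X"]) auto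
qed

lemma hausdorff_premeasure_le:
  assumes "A \<subseteq> (\<Union>i::nat. U i)" "\<And>i. bounded (U i)" "\<And>i. diameter (U i) \<le> \<delta>"
  shows "hausdorff_premeasure \<delta> n A \<le> (\<Sum>i. ennreal (unit_ball_vol (real n) * (diameter (U i) / 2) ^ n))"
  unfolding hausdorff_premeasure_def by (rule INF_lower) (use assms in auto)

lemma hausdorff_premeasure_mono:
  assumes "A \<subseteq> B" shows "hausdorff_premeasure \<delta> n A \<le> hausdorff_premeasure \<delta> n B"
  unfolding hausdorff_premeasure_def by (rule INF_superset_mono) (use assms in auto)

lemma hausdorff_premeasure_antimono:
  assumes "\<delta> \<le> \<delta>'" shows "hausdorff_premeasure \<delta>' n (A :: 'a::metric_space set) \<le> hausdorff_premeasure \<delta> n A"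
proof -
  have "diameter S \<le> \<delta> \<Longrightarrow> diameter S \<le> \<delta>'" for S :: "'a set"
    using assms by linarith
  then show ?thesis
    unfolding hausdorff_premeasure_def by (intro INF_superset_mono) auto
qed

lemma hausdorff_premeasure_approx:
  fixes A :: "'a::metric_space set"
  assumes "hausdorff_premeasure \<delta> n A < c"
  obtains U :: "nat \<Rightarrow> 'a set" where "A \<subseteq> (\<Union>i. U i)" "\<And>i. bounded (U i)" "\<And>i. diameter (U i) \<le> \<delta>"
    "(\<Sum>i. ennreal (unit_ball_vol (real n) * (diameter (U i) / 2) ^ n)) < c"
  using assms unfolding hausdorff_premeasure_def INF_less_iff by auto

lemma hausdorff_premeasure_empty:
  assumes "n > 0" "\<delta> \<ge> 0"
  shows "hausdorff_premeasure \<delta> n ({} :: 'a::metric_space set) = 0"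
proof -
  have "hausdorff_premeasure \<delta> n ({} :: 'a set)
      \<le> (\<Sum>i::nat. ennreal (unit_ball_vol (real n) * (diameter ({} :: 'a set) / 2) ^ n))"
    by (rule hausdorff_premeasure_le) (use assms in auto)
  also have "\<dots> = 0" using assms by (simp add: zero_power)
  finally show ?thesis by simp
qed

lemma hausdorff_premeasure_countably_subadditive:
  fixes A :: "nat \<Rightarrow> 'a::metric_space set"
  shows "hausdorff_premeasure \<delta> n (\<Union>i. A i) \<le> (\<Sum>i. hausdorff_premeasure \<delta> n (A i))"
proof (rule ennreal_le_epsilon)
  fix e :: real assume e: "e > 0" and fin: "(\<Sum>i. hausdorff_premeasure \<delta> n (A i)) < top"
  let ?h = "\<lambda>S::'a set. ennreal (unit_ball_vol (real n) * (diameter S / 2) ^ n)"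
  have "\<exists>U. A i \<subseteq> (\<Union>j::nat. U j) \<and> (\<forall>j. bounded (U j) \<and> diameter (U j) \<le> \<delta>) \<and>
      (\<Sum>j. ?h (U j)) \<le> hausdorff_premeasure \<delta> n (A i) + ennreal e * ennreal ((1/2) ^ Suc i)" for i
  proof -
    have "hausdorff_premeasure \<delta> n (A i) < hausdorff_premeasure \<delta> n (A i) + ennreal (e * (1/2) ^ Suc i)"
      using ennreal_suminf_lessD[OF fin, of i] e ennreal_add_left_cancel_less[of "hausdorff_premeasure \<delta> n (A i)" 0]
      by (simp add: less_top[symmetric])
    then obtain U :: "nat \<Rightarrow> 'a set" where "A i \<subseteq> (\<Union>j. U j)" "\<And>j. bounded (U j)" "\<And>j. diameter (U j) \<le> \<delta>"
      "(\<Sum>j. ?h (U j)) < hausdorff_premeasure \<delta> n (A i) + ennreal (e * (1/2) ^ Suc i)"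
      by (rule hausdorff_premeasure_approx) blast
    moreover have "ennreal (e * (1/2) ^ Suc i) = ennreal e * ennreal ((1/2) ^ Suc i)"
      using e by (intro ennreal_mult) auto
    ultimately show ?thesis by (auto intro!: exI[of _ U])
  qed
  then obtain U where U: "\<And>i. A i \<subseteq> (\<Union>j::nat. U i j)" "\<And>i j. bounded (U i j)" "\<And>i j. diameter (U i j) \<le> \<delta>"
    "\<And>i. (\<Sum>j. ?h (U i j)) \<le> hausdorff_premeasure \<delta> n (A i) + ennreal e * ennreal ((1/2) ^ Suc i)"
    by metis
  define V where "V k = (case prod_decode k of (i, j) \<Rightarrow> U i j)" for k
  have "(\<Union>i. A i) \<subseteq> (\<Union>k. V k)"
  proof
    fix x assume "x \<in> (\<Union>i. A i)"
    then obtain i j where "x \<in> U i j" using U(1) by fast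
    then show "x \<in> (\<Union>k. V k)" by (auto simp: V_def intro!: exI[of _ "prod_encode (i, j)"])
  qed
  then have "hausdorff_premeasure \<delta> n (\<Union>i. A i) \<le> (\<Sum>k. ?h (V k))"
    by (rule hausdorff_premeasure_le) (auto simp: V_def U split: prod.split)
  also have "\<dots> = (\<Sum>k. (\<lambda>(i, j). ?h (U i j)) (prod_decode k))"
    by (intro suminf_cong) (auto simp: V_def split: prod.split)
  also have "\<dots> = (\<Sum>i. \<Sum>j. ?h (U i j))"
    by (rule suminf_ennreal_2dimen) simp
  also have "\<dots> \<le> (\<Sum>i. hausdorff_premeasure \<delta> n (A i) + ennreal e * ennreal ((1/2) ^ Suc i))"
    by (intro suminf_le U) auto
  also have "\<dots> = (\<Sum>i. hausdorff_premeasure \<delta> n (A i)) + (\<Sum>i. ennreal e * ennreal ((1/2) ^ Suc i))"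
    by (intro suminf_add[symmetric]) auto
  also have "(\<Sum>i. ennreal e * ennreal ((1/2) ^ Suc i)) = ennreal e"
  proof -
    have "(\<Sum>i. ennreal ((1/2) ^ Suc i)) = ennreal 1"
      by (rule suminf_ennreal_eq[OF _ power_half_series]) auto
    then show ?thesis by (simp only: ennreal_suminf_cmult ennreal_1 mult_1_right)
  qed
  finally show "hausdorff_premeasure \<delta> n (\<Union>i. A i) \<le> (\<Sum>i. hausdorff_premeasure \<delta> n (A i)) + ennreal e" .
qed

text \<open>
  A covering set of diameter less than \<open>d\<close> cannot meet both \<open>A\<close> and \<open>B\<close>, so every covering of the
  union splits into a covering of \<open>A\<close> and one of \<open>B\<close>. Unused sets are replaced by the empty set, which
  costs nothing because \<open>0 ^ n = 0\<close> for \<open>n > 0\<close>.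
\<close>

lemma hausdorff_premeasure_separated:
  fixes A B :: "'a::metric_space set"
  assumes "n > 0" and \<delta>: "\<delta> \<ge> 0" "\<delta> < d" and d: "\<And>x y. x \<in> A \<Longrightarrow> y \<in> B \<Longrightarrow> d \<le> dist x y"
  shows "hausdorff_premeasure \<delta> n A + hausdorff_premeasure \<delta> n B \<le> hausdorff_premeasure \<delta> n (A \<union> B)"
  unfolding hausdorff_premeasure_def[of \<delta> n "A \<union> B"]
proof (rule INF_greatest, clarify)
  fix U :: "nat \<Rightarrow> 'a set" assume U: "A \<union> B \<subseteq> (\<Union>i. U i)" "\<forall>i. bounded (U i) \<and> diameter (U i) \<le> \<delta>"
  let ?h = "\<lambda>S::'a set. ennreal (unit_ball_vol (real n) * (diameter S / 2) ^ n)"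
  define V where "V C i = (if U i \<inter> C = {} then {} else U i)" for C i
  have V: "hausdorff_premeasure \<delta> n C \<le> (\<Sum>i. ?h (V C i))" if "C \<subseteq> A \<union> B" for C
  proof (rule hausdorff_premeasure_le)
    show "C \<subseteq> (\<Union>i. V C i)"
    proof
      fix x assume "x \<in> C"
      with that U(1) have "x \<in> (\<Union>i. U i)" by (meson subsetD)
      then obtain i where "x \<in> U i" by blast
      then have "x \<in> V C i" using \<open>x \<in> C\<close> by (auto simp: V_def)
      then show "x \<in> (\<Union>i. V C i)" by blast
    qed
  qed (use U \<delta> in \<open>auto simp: V_def\<close>)
  have "U i \<inter> A = {} \<or> U i \<inter> B = {}" for i
  proof (rule ccontr)
    assume "\<not> ?thesis"
    then obtain x y where "x \<in> U i" "x \<in> A" "y \<in> U i" "y \<in> B" by auto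
    moreover then have "dist x y \<le> \<delta>"
      using diameter_bounded_bound[of "U i" x y] U(2) order_trans by blast
    ultimately show False using d[of x y] \<delta> by linarith
  qed
  then have "?h (V A i) + ?h (V B i) \<le> ?h (U i)" for i
    using \<open>n > 0\<close> by (cases "U i \<inter> A = {}") (auto simp: V_def zero_power)
  then have "(\<Sum>i. ?h (V A i) + ?h (V B i)) \<le> (\<Sum>i. ?h (U i))"
    by (intro suminf_le) auto
  moreover have "(\<Sum>i. ?h (V A i)) + (\<Sum>i. ?h (V B i)) = (\<Sum>i. ?h (V A i) + ?h (V B i))"
    by (intro suminf_add) auto
  ultimately show "hausdorff_premeasure \<delta> n A + hausdorff_premeasure \<delta> n B \<le> (\<Sum>i. ?h (U i))"
    using add_mono[OF V[of A] V[of B]] by simp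
qed

lemma hausdorff_outer_measure_mono:
  "A \<subseteq> B \<Longrightarrow> hausdorff_outer_measure n A \<le> hausdorff_outer_measure n B"
  unfolding hausdorff_outer_measure_def by (intro SUP_mono) (blast intro: hausdorff_premeasure_mono)

lemma hausdorff_outer_measure_empty:
  "n > 0 \<Longrightarrow> hausdorff_outer_measure n {} = 0"
  unfolding hausdorff_outer_measure_def by (simp add: hausdorff_premeasure_empty)

lemma hausdorff_premeasure_le_outer:
  "\<delta> > 0 \<Longrightarrow> hausdorff_premeasure \<delta> n A \<le> hausdorff_outer_measure n A"
  unfolding hausdorff_outer_measure_def by (rule SUP_upper) auto

lemma hausdorff_outer_measure_countably_subadditive:
  fixes A :: "nat \<Rightarrow> 'a::metric_space set"
  shows "hausdorff_outer_measure n (\<Union>i. A i) \<le> (\<Sum>i. hausdorff_outer_measure n (A i))"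
  unfolding hausdorff_outer_measure_def[of n "\<Union>i. A i"]
proof (rule SUP_least)
  fix \<delta> :: real assume "\<delta> \<in> {0<..}"
  then have "(\<Sum>i. hausdorff_premeasure \<delta> n (A i)) \<le> (\<Sum>i. hausdorff_outer_measure n (A i))"
    by (intro suminf_le hausdorff_premeasure_le_outer) auto
  with hausdorff_premeasure_countably_subadditive[of \<delta> n A]
  show "hausdorff_premeasure \<delta> n (\<Union>i. A i) \<le> (\<Sum>i. hausdorff_outer_measure n (A i))"
    by (rule order_trans)
qed

lemma hausdorff_outer_measure_separated:
  fixes A B :: "'a::metric_space set"
  assumes "n > 0" "d > 0" and d: "\<And>x y. x \<in> A \<Longrightarrow> y \<in> B \<Longrightarrow> d \<le> dist x y"
  shows "hausdorff_outer_measure n A + hausdorff_outer_measure n B \<le> hausdorff_outer_measure n (A \<union> B)"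
proof -
  have "hausdorff_premeasure \<delta> n A + hausdorff_premeasure \<delta>' n B \<le> hausdorff_outer_measure n (A \<union> B)"
    if "\<delta> > 0" "\<delta>' > 0" for \<delta> \<delta>'
  proof -
    define \<eta> where "\<eta> = min (d / 2) (min \<delta> \<delta>')"
    have \<eta>: "\<eta> > 0" "\<eta> < d" "\<eta> \<le> \<delta>" "\<eta> \<le> \<delta>'" using that \<open>d > 0\<close> by (auto simp: \<eta>_def)
    have "hausdorff_premeasure \<delta> n A + hausdorff_premeasure \<delta>' n B
        \<le> hausdorff_premeasure \<eta> n A + hausdorff_premeasure \<eta> n B"
      by (intro add_mono hausdorff_premeasure_antimono \<eta>)
    also have "\<dots> \<le> hausdorff_premeasure \<eta> n (A \<union> B)"
      using \<eta> by (intro hausdorff_premeasure_separated[of n \<eta> d] \<open>n > 0\<close> d) auto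
    also have "\<dots> \<le> hausdorff_outer_measure n (A \<union> B)"
      by (rule hausdorff_premeasure_le_outer[OF \<eta>(1)])
    finally show ?thesis .
  qed
  then have "hausdorff_outer_measure n A + hausdorff_premeasure \<delta>' n B \<le> hausdorff_outer_measure n (A \<union> B)"
    if "\<delta>' > 0" for \<delta>'
    unfolding hausdorff_outer_measure_def[of n A] using that
    by (subst ennreal_SUP_add_left[symmetric]) (auto intro!: SUP_least)
  then show ?thesis
    unfolding hausdorff_outer_measure_def[of n B] add.commute[of "hausdorff_outer_measure n A"]
    by (subst ennreal_SUP_add_left[symmetric]) (auto intro!: SUP_least simp: add.commute)
qed

lemma measure_space_hausdorff:
  assumes "n > 0"
  shows "measure_space (UNIV :: 'a::metric_space set) (sets borel) (hausdorff_outer_measure n)"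
proof -
  let ?f = "hausdorff_outer_measure n :: 'a set \<Rightarrow> ennreal"
  let ?L = "lambda_system (UNIV :: 'a set) UNIV ?f"
  have "outer_measure_space UNIV ?f"
    unfolding outer_measure_space_def positive_def increasing_def countably_subadditive_def
    using hausdorff_outer_measure_empty[OF assms] hausdorff_outer_measure_mono
      hausdorff_outer_measure_countably_subadditive by auto
  then have L: "measure_space UNIV ?L ?f"
    using sigma_algebra.caratheodory_lemma[OF sigma_algebra_Pow, of UNIV ?f] by simp
  then interpret L: sigma_algebra UNIV ?L by (simp add: measure_space_def)
  have sub2: "?f (A \<union> B) \<le> ?f A + ?f B" for A B
  proof -
    have "?f (A \<union> B) \<le> (\<Sum>i. ?f (binaryset A B i))"
      using hausdorff_outer_measure_countably_subadditive[of n "binaryset A B"] by (simp add: UN_binaryset_eq)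
    also have "\<dots> = ?f A + ?f B"
      by (rule suminf_binaryset_eq) (rule hausdorff_outer_measure_empty[OF assms])
    finally show ?thesis .
  qed
  have "C \<in> ?L" if "closed C" for C
  proof (cases "C = {}")
    case False
    have "?f (C \<inter> X) + ?f (X - C) = ?f X" for X
    proof (rule antisym)
      show "?f (C \<inter> X) + ?f (X - C) \<le> ?f X"
      proof (cases "?f X < \<infinity>")
        case True
        then show ?thesis
          unfolding Int_commute[of C]
          by (intro metric_outer_measure_Diff_closed[OF hausdorff_outer_measure_mono
                hausdorff_outer_measure_countably_subadditive hausdorff_outer_measure_empty[OF assms]
                hausdorff_outer_measure_separated[OF assms] that False])
      qed (simp add: less_top[symmetric])
      show "?f X \<le> ?f (C \<inter> X) + ?f (X - C)"
        using sub2[of "C \<inter> X" "X - C"] by (simp add: Int_commute[of C] Int_Diff_Un)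
    qed
    then show ?thesis by (auto simp: lambda_system_def Diff_eq Int_commute)
  qed auto
  then have "sigma_sets UNIV (Collect closed) \<subseteq> ?L"
    by (intro L.sigma_sets_subset) auto
  then show ?thesis
    by (intro measure_down[OF L]) (simp_all add: borel_eq_closed sigma_algebra_sigma_sets)
qed

lemma sets_hausdorff_measure [measurable_cong, simp]: "sets (hausdorff_measure n) = sets borel"
  unfolding hausdorff_measure_def using sets.sigma_sets_eq[of borel] by simp

lemma space_hausdorff_measure [simp]: "space (hausdorff_measure n) = UNIV"
  unfolding hausdorff_measure_def by simp

lemma emeasure_hausdorff_measure:
  assumes "n > 0" "A \<in> sets borel"
  shows "emeasure (hausdorff_measure n) A = hausdorff_outer_measure n A"
  using assms measure_space_hausdorff[OF assms(1)]
  by (intro emeasure_measure_of[OF hausdorff_measure_def]) (auto simp: measure_space_def)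

section \<open>Lipschitz graph charts\<close>

text \<open>
  The number of balls of radius \<open>2 \<rho>\<close> needed to cover a tube of length \<open>T \<ge> \<rho>\<close> around a segment is at
  most \<open>3 T / \<rho>\<close>. Their total volume is compared with the term that a set of diameter \<open>\<rho>\<close> contributes
  to the Hausdorff measure of dimension \<open>d - 1\<close>.
\<close>

definition shadow_const :: "nat \<Rightarrow> real" where
  "shadow_const d = 3 * 2 ^ d * unit_ball_vol d * 2 ^ (d - 1) / unit_ball_vol (real (d - 1))"

lemma shadow_const_pos: "0 < shadow_const d"
  by (simp add: shadow_const_def)

text \<open>
  A Lipschitz graph transversal to the unit vector \<open>n\<close> is described by the signed distance \<open>\<tau>\<close> to the
  graph in direction \<open>n\<close>, defined on the whole space. This avoids any reference to the hyperplane
  orthogonal to \<open>n\<close>, which carries no type of its own: the graph is the zero set of \<open>\<tau>\<close>, and \<open>foot\<close>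
  is the projection onto it along the fibres \<open>x + t *\<^sub>R n\<close>.
\<close>

locale depth_function =
  fixes n :: "'a::euclidean_space" and \<tau> :: "'a \<Rightarrow> real" and M :: real
  assumes norm_n: "norm n = 1" and M_ge_1: "1 \<le> M"
    and lipschitz_depth: "M-lipschitz_on UNIV \<tau>"
    and depth_shift: "\<tau> (x + t *\<^sub>R n) = \<tau> x - t"
begin

definition foot :: "'a \<Rightarrow> 'a" where
  "foot x = x + \<tau> x *\<^sub>R n"

lemma depth_diff_le: "\<bar>\<tau> x - \<tau> y\<bar> \<le> M * dist x y"
  using lipschitz_onD[OF lipschitz_depth, of x y] by (simp add: dist_real_def)

lemma continuous_on_depth [continuous_intros]: "continuous_on A \<tau>"
  using lipschitz_depth lipschitz_on_continuous_on continuous_on_subset by blast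

lemma continuous_on_foot [continuous_intros]: "continuous_on A foot"
  unfolding foot_def by (intro continuous_intros)

lemma borel_measurable_depth [measurable]: "\<tau> \<in> borel_measurable borel"
  by (intro borel_measurable_continuous_onI continuous_intros)

lemma borel_measurable_foot [measurable]: "foot \<in> borel_measurable borel"
  by (intro borel_measurable_continuous_onI continuous_intros)

lemma depth_shift_minus: "\<tau> (x - t *\<^sub>R n) = \<tau> x + t"
  using depth_shift[of x "- t"] by simp

definition shadow :: "real \<Rightarrow> 'a set \<Rightarrow> 'a set" where
  "shadow T S = {x. 0 \<le> \<tau> x \<and> \<tau> x \<le> T \<and> foot x \<in> S}"

lemma shadow_measurable:
  assumes [measurable]: "S \<in> sets borel"
  shows "shadow T S \<in> sets borel"
  unfolding shadow_def by measurable

text \<open>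
  All fibres that end in a set of diameter \<open>\<rho>\<close> stay within distance \<open>\<rho>\<close> of one of them, and points
  at intervals \<open>\<rho>\<close> on the latter are centres of balls of radius \<open>2 \<rho>\<close> that cover the shadow.
\<close>

lemma emeasure_shadow_le_diameter:
  assumes S: "S \<in> sets borel" "\<And>x y. x \<in> S \<Longrightarrow> y \<in> S \<Longrightarrow> dist x y \<le> \<rho>" and \<rho>: "0 < \<rho>" "\<rho> \<le> T"
  shows "emeasure lborel (shadow T S)
    \<le> ennreal (3 * 2 ^ DIM('a) * unit_ball_vol (DIM('a)) * T * \<rho> ^ (DIM('a) - 1))"
proof (cases "S = {}")
  case False
  then obtain c where c: "c \<in> S" by blast
  define N where "N = nat \<lceil>T / \<rho>\<rceil>"
  define B where "B j = ball (c - (real j * \<rho>) *\<^sub>R n) (2 * \<rho>)" for j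
  have "shadow T S \<subseteq> (\<Union>j\<le>N. B j)"
  proof
    fix x assume "x \<in> shadow T S"
    then have x: "0 \<le> \<tau> x" "\<tau> x \<le> T" "foot x \<in> S" by (auto simp: shadow_def)
    define j where "j = nat \<lfloor>\<tau> x / \<rho>\<rfloor>"
    have "real j = of_int \<lfloor>\<tau> x / \<rho>\<rfloor>" using x \<rho> by (simp add: j_def)
    then have j: "real j \<le> \<tau> x / \<rho>" "\<tau> x / \<rho> < real j + 1" by linarith+
    have "\<tau> x / \<rho> \<le> T / \<rho>" using x \<rho> by (simp add: divide_right_mono)
    then have "real j \<le> real N" using j(1) unfolding N_def by linarith
    then have "j \<le> N" by simp
    moreover have "x \<in> B j"
    proof -
      have "\<bar>real j * \<rho> - \<tau> x\<bar> < \<rho>"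
        using j \<rho> by (simp add: field_simps abs_less_iff)
      moreover have "dist (c - (real j * \<rho>) *\<^sub>R n) x \<le> dist c (foot x) + \<bar>real j * \<rho> - \<tau> x\<bar>"
      proof -
        have eq: "(c - (real j * \<rho>) *\<^sub>R n) - x = (c - foot x) - (real j * \<rho> - \<tau> x) *\<^sub>R n"
          unfolding foot_def by (simp add: algebra_simps)
        from norm_triangle_ineq4[of "c - foot x" "(real j * \<rho> - \<tau> x) *\<^sub>R n"] norm_n
        show ?thesis unfolding dist_norm eq by simp
      qed
      ultimately show ?thesis using S(2)[OF c x(3)] by (simp add: B_def)
    qed
    ultimately show "x \<in> (\<Union>j\<le>N. B j)" by blast
  qed
  then have "emeasure lborel (shadow T S) \<le> emeasure lborel (\<Union>j\<le>N. B j)"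
    by (intro emeasure_mono) (auto simp: B_def)
  also have "\<dots> \<le> (\<Sum>j\<le>N. emeasure lborel (B j))"
    by (intro emeasure_subadditive_finite) (auto simp: B_def)
  also have "\<dots> = (\<Sum>j\<le>N. ennreal (unit_ball_vol DIM('a) * (2 * \<rho>) ^ DIM('a)))"
    using \<rho> by (intro sum.cong refl) (simp add: B_def emeasure_ball)
  also have "\<dots> = ennreal ((real N + 1) * (unit_ball_vol DIM('a) * (2 * \<rho>) ^ DIM('a)))"
    using \<rho> by (simp add: ennreal_mult ennreal_of_nat_eq_real_of_nat algebra_simps ennreal_plus)
  also have "\<dots> \<le> ennreal (3 * 2 ^ DIM('a) * unit_ball_vol (DIM('a)) * T * \<rho> ^ (DIM('a) - 1))"
  proof (rule ennreal_leI)
    have "0 \<le> T / \<rho>" using \<rho> by simp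
    then have "real N \<le> T / \<rho> + 1" unfolding N_def by linarith
    moreover have "1 \<le> T / \<rho>" using \<rho> by simp
    ultimately have "real N + 1 \<le> 3 * T / \<rho>" by simp
    then have "(real N + 1) * (unit_ball_vol DIM('a) * (2 * \<rho>) ^ DIM('a))
        \<le> 3 * T / \<rho> * (unit_ball_vol DIM('a) * (2 * \<rho>) ^ DIM('a))"
      using \<rho> by (intro mult_right_mono) auto
    also have "\<dots> = 3 * 2 ^ DIM('a) * unit_ball_vol (DIM('a)) * T * (\<rho> ^ DIM('a) / \<rho>)"
      by (simp add: power_mult_distrib)
    also have "\<rho> ^ DIM('a) / \<rho> = \<rho> ^ (DIM('a) - 1)"
      using \<rho> DIM_positive[where 'a='a] by (simp add: power_diff)
    finally show "(real N + 1) * (unit_ball_vol DIM('a) * (2 * \<rho>) ^ DIM('a))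
        \<le> 3 * 2 ^ DIM('a) * unit_ball_vol (DIM('a)) * T * \<rho> ^ (DIM('a) - 1)" .
  qed
  finally show ?thesis .
qed (auto simp: shadow_def)

text \<open>
  The shadow of a covering is covered by the shadows of its members. Closures are taken to have Borel
  sets, which does not change diameters; a member of diameter 0 has a null shadow, being contained in
  tubes of arbitrarily small radius.
\<close>

lemma emeasure_shadow_le_hausdorff:
  assumes dim: "DIM('a) \<ge> 2" and S: "S \<in> sets borel" and T: "0 < T"
  shows "emeasure lborel (shadow T S) \<le> ennreal (shadow_const DIM('a) * T) * hausdorff_outer_measure (DIM('a) - 1) S"
proof -
  define m where "m = DIM('a) - 1"
  define K where "K = 3 * 2 ^ DIM('a) * unit_ball_vol (DIM('a)) * T"
  define c where "c = 3 * 2 ^ DIM('a) * unit_ball_vol (DIM('a)) * 2 ^ m / unit_ball_vol (real m) * T"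
  have m: "m > 0" using dim by (simp add: m_def)
  have K: "K \<ge> 0" using T by (simp add: K_def)
  have c: "c > 0" using T by (simp add: c_def)
  let ?h = "\<lambda>S::'a set. unit_ball_vol (real m) * (diameter S / 2) ^ m"
  have piece: "emeasure lborel (shadow T (closure U)) \<le> ennreal c * ennreal (?h U)"
    if U: "bounded U" "diameter U \<le> T" for U
  proof -
    have d0: "diameter U \<ge> 0" using U(1) by (rule diameter_ge_0)
    have bound: "emeasure lborel (shadow T (closure U)) \<le> ennreal (K * \<rho> ^ m)" if "0 < \<rho>" "diameter U \<le> \<rho>" "\<rho> \<le> T" for \<rho>
      unfolding K_def m_def
    proof (rule emeasure_shadow_le_diameter)
      fix x y assume "x \<in> closure U" "y \<in> closure U"
      then show "dist x y \<le> \<rho>"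
        using diameter_bounded_bound[of "closure U" x y] U that by (simp add: diameter_closure bounded_closure)
    qed (use that in auto)
    have "emeasure lborel (shadow T (closure U)) \<le> ennreal (K * diameter U ^ m)"
    proof (cases "diameter U = 0")
      case True
      \<comment> \<open>the bound holds for every \<open>\<rho> > 0\<close> here, and \<open>K * \<rho> ^ m\<close> tends to 0 as \<open>m > 0\<close>\<close>
      have "((\<lambda>\<rho>. ennreal (K * \<rho> ^ m)) \<longlongrightarrow> ennreal (K * 0 ^ m)) (at_right 0)"
        by (intro tendsto_intros)
      moreover have "\<forall>\<^sub>F \<rho> in at_right 0. emeasure lborel (shadow T (closure U)) \<le> ennreal (K * \<rho> ^ m)"
        using eventually_at_right_less[of 0] eventually_at_rightI[of 0 T "\<lambda>\<rho>. \<rho> \<le> T", OF _ T]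
        by (rule eventually_elim2) (use bound True in auto)
      ultimately show ?thesis
        using True by (metis tendsto_lowerbound trivial_limit_at_right_real)
    next
      case False
      then show ?thesis using bound[of "diameter U"] d0 U by auto
    qed
    also have "K * diameter U ^ m = c * ?h U"
    proof -
      have "unit_ball_vol (real m) \<noteq> 0" using unit_ball_vol_pos[of "real m"] by linarith
      then show ?thesis by (simp add: K_def c_def power_divide field_simps)
    qed
    also have "ennreal \<dots> = ennreal c * ennreal (?h U)"
      using c d0 by (intro ennreal_mult) auto
    finally show ?thesis .
  qed
  have "emeasure lborel (shadow T S) / ennreal c \<le> hausdorff_premeasure T m S"
    unfolding hausdorff_premeasure_def
  proof (rule INF_greatest, clarify)
    fix U :: "nat \<Rightarrow> 'a set" assume U: "S \<subseteq> (\<Union>i. U i)" "\<forall>i. bounded (U i) \<and> diameter (U i) \<le> T"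
    have "shadow T S \<subseteq> (\<Union>i. shadow T (closure (U i)))"
      using U(1) closure_subset unfolding shadow_def by blast
    then have "emeasure lborel (shadow T S) \<le> emeasure lborel (\<Union>i. shadow T (closure (U i)))"
      by (intro emeasure_mono) (auto intro!: shadow_measurable sets.countable_UN)
    also have "\<dots> \<le> (\<Sum>i. emeasure lborel (shadow T (closure (U i))))"
      by (intro emeasure_subadditive_countably) (auto intro!: shadow_measurable)
    also have "\<dots> \<le> (\<Sum>i. ennreal c * ennreal (?h (U i)))"
      using U(2) by (intro suminf_le piece) auto
    also have "\<dots> = (\<Sum>i. ennreal (?h (U i))) * ennreal c"
      by (simp only: ennreal_suminf_cmult mult.commute)
    finally show "emeasure lborel (shadow T S) / ennreal c \<le> (\<Sum>i. ennreal (?h (U i)))"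
      using c by (intro divide_le_posI_ennreal) (auto simp: mult.commute)
  qed
  also have "\<dots> \<le> hausdorff_outer_measure m S"
    by (rule hausdorff_premeasure_le_outer[OF T])
  finally have "ennreal c * (emeasure lborel (shadow T S) / ennreal c) \<le> ennreal c * hausdorff_outer_measure m S"
    by (rule mult_left_mono) simp
  also have "ennreal c * (emeasure lborel (shadow T S) / ennreal c) = emeasure lborel (shadow T S)"
    using c by (simp add: ennreal_times_divide mult_divide_eq_ennreal mult.commute[of "ennreal c"])
  finally show ?thesis by (simp add: c_def m_def shadow_const_def)
qed

text \<open>
  Packing bound. Translating \<open>\<eta>\<close>-separated points of the graph down their fibres in steps of
  \<open>\<theta> = \<eta> / (2 M)\<close> gives points that are \<open>\<theta>\<close>-separated: if two of them are at distance \<open>D\<close>, their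
  depths differ by at most \<open>M * D\<close>, so that their feet are at distance at most \<open>(1 + M) * D\<close>. The
  balls of radius \<open>\<theta> / 2\<close> about them are thus disjoint and lie in a ball of radius \<open>4 R\<close>; comparing
  volumes bounds the number of points.
\<close>

lemma card_separated_le:
  assumes P: "finite P" "P \<subseteq> {x \<in> ball p R. \<tau> x = 0}"
    and sep: "\<And>x y. x \<in> P \<Longrightarrow> y \<in> P \<Longrightarrow> x \<noteq> y \<Longrightarrow> \<eta> \<le> dist x y"
    and \<eta>: "0 < \<eta>" "\<eta> \<le> R"
  shows "real (card P) * \<eta> ^ (DIM('a) - 1) \<le> (8 * R) ^ DIM('a) / R * (2 * M) ^ (DIM('a) - 1)"
proof -
  define \<theta> where "\<theta> = \<eta> / (2 * M)"
  have \<theta>: "0 < \<theta>" "2 * \<theta> \<le> \<eta>" using \<eta> M_ge_1 by (auto simp: \<theta>_def field_simps mult_le_cancel_left1)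
  have R: "0 < R" "2 * \<theta> \<le> R" using \<eta> \<theta> by linarith+
  define N where "N = nat \<lceil>R / \<theta>\<rceil>"
  have N: "R / \<theta> \<le> real N" "real N \<le> R / \<theta> + 1" using divide_nonneg_pos[of R \<theta>] R \<theta> unfolding N_def by linarith+
  define z where "z = (\<lambda>(x, j::nat). x - (real j * \<theta>) *\<^sub>R n)"
  have far: "\<theta> \<le> dist (z (x, i)) (z (y, j))" if "x \<in> P" "y \<in> P" "(x, i) \<noteq> (y, j)" for x y i j
  proof (cases "x = y")
    case True
    then have "i \<noteq> j" using that by auto
    then have "1 \<le> \<bar>real j - real i\<bar>" by linarith
    then have "\<theta> \<le> \<bar>real j - real i\<bar> * \<theta>" using \<theta> by (simp add: mult_le_cancel_right1)
    also have "\<dots> = \<bar>(real j - real i) * \<theta>\<bar>" using \<theta> by (simp add: abs_mult)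
    also have "\<dots> = norm (((real j - real i) * \<theta>) *\<^sub>R n)" using norm_n by simp
    also have "((real j - real i) * \<theta>) *\<^sub>R n = z (x, i) - z (y, j)"
      using True by (simp add: z_def algebra_simps)
    finally show ?thesis by (simp add: dist_norm)
  next
    case False
    define D where "D = dist (z (x, i)) (z (y, j))"
    have *: "\<tau> (z (x, i)) = real i * \<theta>" "\<tau> (z (y, j)) = real j * \<theta>"
      using that P(2) by (auto simp: z_def depth_shift_minus)
    then have **: "\<bar>real i * \<theta> - real j * \<theta>\<bar> \<le> M * D"
      using depth_diff_le[of "z (x, i)" "z (y, j)"] by (simp add: D_def)
    have eq: "x - y = (z (x, i) - z (y, j)) + (real i * \<theta> - real j * \<theta>) *\<^sub>R n"
      by (simp add: z_def algebra_simps)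
    have "dist x y \<le> D + \<bar>real i * \<theta> - real j * \<theta>\<bar>"
      unfolding dist_norm eq D_def
      using norm_triangle_ineq[of "z (x, i) - z (y, j)" "(real i * \<theta> - real j * \<theta>) *\<^sub>R n"] norm_n by simp
    then have "\<eta> \<le> D + M * D" using sep[of x y] that False ** by linarith
    also have "\<dots> \<le> 2 * M * D"
      using M_ge_1 mult_right_mono[of 1 M D] by (simp add: D_def)
    finally show ?thesis using M_ge_1 by (simp add: \<theta>_def D_def field_simps)
  qed
  have disj: "disjoint_family_on (\<lambda>a. ball (z a) (\<theta> / 2)) (P \<times> {..<N})"
    unfolding disjoint_family_on_def
  proof (intro ballI impI)
    fix a b assume "a \<in> P \<times> {..<N}" "b \<in> P \<times> {..<N}" "a \<noteq> b"
    then have "\<theta> \<le> dist (z a) (z b)"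
      using far by (cases a; cases b) auto
    then show "ball (z a) (\<theta> / 2) \<inter> ball (z b) (\<theta> / 2) = {}"
      by (auto simp: disjoint_iff) (smt (verit) dist_commute dist_triangle field_sum_of_halves)
  qed
  have sub: "(\<Union>a \<in> P \<times> {..<N}. ball (z a) (\<theta> / 2)) \<subseteq> ball p (4 * R)"
  proof
    fix w assume "w \<in> (\<Union>a \<in> P \<times> {..<N}. ball (z a) (\<theta> / 2))"
    then obtain x j where a: "x \<in> P" "j \<in> {..<N}" "w \<in> ball (z (x, j)) (\<theta> / 2)" by blast
    have "real j * \<theta> \<le> real N * \<theta>" using a \<theta> by (intro mult_right_mono) auto
    also have "\<dots> \<le> (R / \<theta> + 1) * \<theta>" using N \<theta> by (intro mult_right_mono) auto
    also have "\<dots> = R + \<theta>" using \<theta> by (simp add: field_simps)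
    finally have "dist (z (x, j)) x \<le> R + \<theta>"
      using norm_n \<theta> by (simp add: z_def dist_norm)
    moreover have "dist p x < R" using a(1) P(2) by auto
    moreover have "dist p w \<le> dist p x + dist (z (x, j)) x + dist (z (x, j)) w"
      by (metis dist_commute dist_triangle add_right_mono dist_triangle2 order_trans add.assoc add_left_mono)
    ultimately show "w \<in> ball p (4 * R)" using a(3) R by simp
  qed
  let ?\<omega> = "unit_ball_vol (real DIM('a))"
  have "ennreal (real (card P * N) * (?\<omega> * (\<theta> / 2) ^ DIM('a))) = (\<Sum>a \<in> P \<times> {..<N}. emeasure lborel (ball (z a) (\<theta> / 2)))"
    using \<theta> by (simp add: emeasure_ball card_cartesian_product ennreal_mult ennreal_of_nat_eq_real_of_nat)
  also have "\<dots> = emeasure lborel (\<Union>a \<in> P \<times> {..<N}. ball (z a) (\<theta> / 2))"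
    using disj P(1) by (intro sum_emeasure) auto
  also have "\<dots> \<le> emeasure lborel (ball p (4 * R))"
    using sub by (intro emeasure_mono) auto
  also have "\<dots> = ennreal (?\<omega> * (4 * R) ^ DIM('a))"
    using R by (simp add: emeasure_ball)
  finally have "real (card P * N) * (?\<omega> * (\<theta> / 2) ^ DIM('a)) \<le> ?\<omega> * (4 * R) ^ DIM('a)"
    using R by (subst (asm) ennreal_le_iff) auto
  then have "?\<omega> * (real (card P) * (real N * (\<theta> / 2) ^ DIM('a))) \<le> ?\<omega> * (4 * R) ^ DIM('a)"
    by (simp add: algebra_simps)
  then have 1: "real (card P) * (real N * (\<theta> / 2) ^ DIM('a)) \<le> (4 * R) ^ DIM('a)"
    by (subst (asm) mult_le_cancel_left_pos) auto
  have "real (card P) * (R / \<theta> * (\<theta> / 2) ^ DIM('a)) \<le> real (card P) * (real N * (\<theta> / 2) ^ DIM('a))"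
    using N \<theta> by (intro mult_left_mono mult_right_mono) auto
  with 1 have "real (card P) * (R / \<theta> * (\<theta> / 2) ^ DIM('a)) \<le> (4 * R) ^ DIM('a)"
    by linarith
  moreover have "R / \<theta> * (\<theta> / 2) ^ DIM('a) = R * \<theta> ^ (DIM('a) - 1) / 2 ^ DIM('a)"
    using \<theta> power_diff[of \<theta> 1 "DIM('a)"] DIM_positive[where 'a='a] by (simp add: power_divide)
  ultimately have 2: "real (card P) * (R * \<theta> ^ (DIM('a) - 1) / 2 ^ DIM('a)) \<le> (4 * R) ^ DIM('a)"
    by (simp only:)
  have "R * (real (card P) * \<theta> ^ (DIM('a) - 1)) = 2 ^ DIM('a) * (real (card P) * (R * \<theta> ^ (DIM('a) - 1) / 2 ^ DIM('a)))"
    by simp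
  also have "\<dots> \<le> 2 ^ DIM('a) * (4 * R) ^ DIM('a)"
    by (rule mult_left_mono[OF 2]) simp
  also have "\<dots> = (2 * (4 * R)) ^ DIM('a)" by (simp only: power_mult_distrib)
  also have "2 * (4 * R) = 8 * R" by simp
  finally have "real (card P) * \<theta> ^ (DIM('a) - 1) \<le> (8 * R) ^ DIM('a) / R"
    using R(1) by (simp only: pos_le_divide_eq mult.commute[of _ R])
  then have "real (card P) * \<eta> ^ (DIM('a) - 1) / (2 * M) ^ (DIM('a) - 1) \<le> (8 * R) ^ DIM('a) / R"
    by (simp only: \<theta>_def power_divide times_divide_eq_right)
  moreover have "0 < (2 * M) ^ (DIM('a) - 1)" using M_ge_1 by simp
  ultimately show ?thesis by (simp only: pos_divide_le_eq)
qed

text \<open>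
  The balls of radius \<open>\<eta>\<close> about a maximal \<open>\<eta>\<close>-separated set cover the graph, and by the packing bound
  their total contribution is bounded independently of \<open>\<eta>\<close>.
\<close>

lemma hausdorff_outer_measure_graph_finite:
  assumes dim: "DIM('a) \<ge> 2" and R: "0 < R"
  shows "hausdorff_outer_measure (DIM('a) - 1) {x \<in> ball p R. \<tau> x = 0} < \<infinity>"
proof -
  define F where "F = {x \<in> ball p R. \<tau> x = 0}"
  define m where "m = DIM('a) - 1"
  define b where "b = (8 * R) ^ DIM('a) / R * (2 * M) ^ m"
  have m: "m > 0" using dim by (simp add: m_def)
  have "hausdorff_premeasure \<delta> m F \<le> ennreal (unit_ball_vol (real m) * b)" if "\<delta> > 0" for \<delta>
  proof -
    define \<eta> where "\<eta> = min (\<delta> / 2) R"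
    have \<eta>: "0 < \<eta>" "\<eta> \<le> R" "2 * \<eta> \<le> \<delta>" using that R by (auto simp: \<eta>_def)
    define Q where "Q P \<longleftrightarrow> finite P \<and> P \<subseteq> F \<and> (\<forall>x\<in>P. \<forall>y\<in>P. x \<noteq> y \<longrightarrow> \<eta> \<le> dist x y)" for P
    have Qb: "real (card P) * \<eta> ^ m \<le> b" if "Q P" for P
      unfolding m_def b_def using that \<eta> by (intro card_separated_le[of P p R \<eta>]) (auto simp: Q_def F_def)
    have "card P < nat \<lceil>b / \<eta> ^ m\<rceil> + 1" if "Q P" for P
    proof -
      have "real (card P) \<le> b / \<eta> ^ m" using Qb[OF that] \<eta> by (simp add: field_simps)
      then show ?thesis by linarith
    qed
    moreover have "Q {}" by (simp add: Q_def)
    ultimately obtain P where P: "Q P" "\<And>P'. Q P' \<Longrightarrow> card P' \<le> card P"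
      using ex_has_greatest_nat[of Q "{}" card "nat \<lceil>b / \<eta> ^ m\<rceil> + 1"] by blast
    then have fP: "finite P" by (simp add: Q_def)
    have cover: "\<exists>x\<in>P. dist x y < \<eta>" if "y \<in> F" for y
    proof (rule ccontr)
      assume *: "\<not> ?thesis"
      then have "y \<notin> P" using \<eta> by auto
      moreover have "Q (insert y P)"
        using P(1) that * by (auto simp: Q_def dist_commute not_less)
      ultimately show False using P(2)[of "insert y P"] fP by simp
    qed
    obtain e where e: "bij_betw e {0..<card P} P" using ex_bij_betw_nat_finite[OF fP] by blast
    define U where "U i = (if i < card P then ball (e i) \<eta> else {})" for i
    have "F \<subseteq> (\<Union>i. U i)"
    proof
      fix y assume "y \<in> F"
      then obtain x where x: "x \<in> P" "dist x y < \<eta>" using cover by blast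
      then have "x \<in> e ` {0..<card P}" using bij_betw_imp_surj_on[OF e] by simp
      then obtain i where "i < card P" "e i = x" by auto
      then have "y \<in> U i" using x by (simp add: U_def)
      then show "y \<in> (\<Union>i. U i)" by blast
    qed
    then have "hausdorff_premeasure \<delta> m F \<le> (\<Sum>i. ennreal (unit_ball_vol (real m) * (diameter (U i) / 2) ^ m))"
      by (rule hausdorff_premeasure_le) (use \<eta> in \<open>auto simp: U_def\<close>)
    also have "\<dots> = (\<Sum>i<card P. ennreal (unit_ball_vol (real m) * (diameter (U i) / 2) ^ m))"
      by (rule suminf_finite) (use m in \<open>auto simp: U_def zero_power\<close>)
    also have "\<dots> = (\<Sum>i<card P. ennreal (unit_ball_vol (real m) * \<eta> ^ m))"
      using \<eta> by (intro sum.cong) (auto simp: U_def)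
    also have "\<dots> = ennreal (real (card P) * (unit_ball_vol (real m) * \<eta> ^ m))"
      using \<eta> by (simp add: ennreal_mult ennreal_of_nat_eq_real_of_nat)
    also have "\<dots> \<le> ennreal (unit_ball_vol (real m) * b)"
    proof (rule ennreal_leI)
      show "real (card P) * (unit_ball_vol (real m) * \<eta> ^ m) \<le> unit_ball_vol (real m) * b"
        using mult_left_mono[OF Qb[OF P(1)], of "unit_ball_vol (real m)"] by (simp add: algebra_simps)
    qed
    finally show ?thesis .
  qed
  then have "hausdorff_outer_measure m F \<le> ennreal (unit_ball_vol (real m) * b)"
    unfolding hausdorff_outer_measure_def by (intro SUP_least) auto
  then show ?thesis unfolding F_def m_def by (rule le_less_trans) simp
qed

end

text \<open>
  The centre \<open>p\<close> of the ball need not be the base point of the hyperplane over which the graph is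
  given. This is what allows the same radius and constant to be used at all boundary points.
\<close>

definition boundary_chart :: "'a::euclidean_space set \<Rightarrow> 'a \<Rightarrow> real \<Rightarrow> real \<Rightarrow> 'a \<Rightarrow> ('a \<Rightarrow> real) \<Rightarrow> bool" where
  "boundary_chart \<Omega> p R M n \<tau> \<longleftrightarrow> depth_function n \<tau> M \<and> 0 < R \<and>
    (\<forall>x\<in>ball p R. (x \<in> frontier \<Omega> \<longleftrightarrow> \<tau> x = 0) \<and> (x \<in> \<Omega> \<longleftrightarrow> 0 < \<tau> x))"

lemma lipschitz_graph_chart:
  fixes \<Omega> :: "'a::euclidean_space set"
  assumes "lipschitz_graph_at \<Omega> q"
  shows "\<exists>R M n \<tau>. boundary_chart \<Omega> q R M n \<tau>"
proof -
  obtain n U f L where n: "norm n = 1" and U: "open U" "q \<in> U"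
    and f: "L-lipschitz_on {y. (y - q) \<bullet> n = 0} f"
    and fr: "frontier \<Omega> \<inter> U = {x \<in> U. (x - q) \<bullet> n = f (x - ((x - q) \<bullet> n) *\<^sub>R n)}"
    and Om: "\<Omega> \<inter> U = {x \<in> U. (x - q) \<bullet> n < f (x - ((x - q) \<bullet> n) *\<^sub>R n)}"
    using assms unfolding lipschitz_graph_at_def by blast
  define proj where "proj x = x - ((x - q) \<bullet> n) *\<^sub>R n" for x
  define \<tau> where "\<tau> x = f (proj x) - (x - q) \<bullet> n" for x
  have nn: "n \<bullet> n = 1" using n by (simp add: dot_square_norm)
  have projH: "(proj x - q) \<bullet> n = 0" for x
    by (simp add: proj_def inner_diff_left nn)
  have proj_le: "dist (proj x) (proj y) \<le> dist x y" for x y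
  proof -
    have eq: "proj x - proj y = (x - y) - ((x - y) \<bullet> n) *\<^sub>R n"
      by (simp add: proj_def inner_diff_left algebra_simps)
    have "(norm (proj x - proj y))\<^sup>2 = (norm (x - y))\<^sup>2 - ((x - y) \<bullet> n)\<^sup>2"
      unfolding eq power2_norm_eq_inner by (simp add: inner_diff_left inner_diff_right nn inner_commute power2_eq_square)
    then have "(norm (proj x - proj y))\<^sup>2 \<le> (norm (x - y))\<^sup>2"
      using zero_le_power2[of "(x - y) \<bullet> n"] by linarith
    then show ?thesis
      unfolding dist_norm by (rule power2_le_imp_le) (rule norm_ge_zero)
  qed
  have L: "0 \<le> L" using f by (rule lipschitz_on_nonneg)
  have "depth_function n \<tau> (L + 1)"
  proof
    show "(L + 1)-lipschitz_on UNIV \<tau>"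
    proof (rule lipschitz_onI)
      fix x y
      have "dist (f (proj x)) (f (proj y)) \<le> L * dist (proj x) (proj y)"
        using lipschitz_onD[OF f, of "proj x" "proj y"] projH by simp
      also have "\<dots> \<le> L * dist x y" using L proj_le by (intro mult_left_mono)
      finally have "\<bar>f (proj x) - f (proj y)\<bar> \<le> L * dist x y" by (simp add: dist_real_def)
      moreover have "\<bar>(x - y) \<bullet> n\<bar> \<le> dist x y"
        using Cauchy_Schwarz_ineq2[of "x - y" n] n by (simp add: dist_norm)
      moreover have "(x - q) \<bullet> n - (y - q) \<bullet> n = (x - y) \<bullet> n" by (simp add: inner_diff_left)
      ultimately show "dist (\<tau> x) (\<tau> y) \<le> (L + 1) * dist x y"
        unfolding \<tau>_def dist_real_def distrib_right by linarith
    qed (use L in simp)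
    fix x t
    have "proj (x + t *\<^sub>R n) = proj x"
      by (simp add: proj_def inner_diff_left inner_add_left nn algebra_simps)
    then show "\<tau> (x + t *\<^sub>R n) = \<tau> x - t"
      by (simp add: \<tau>_def inner_diff_left inner_add_left nn)
  qed (use n L in auto)
  moreover obtain R where R: "R > 0" "ball q R \<subseteq> U" using U openE by blast
  moreover have "(x \<in> frontier \<Omega> \<longleftrightarrow> \<tau> x = 0) \<and> (x \<in> \<Omega> \<longleftrightarrow> 0 < \<tau> x)" if "x \<in> ball q R" for x
  proof -
    have "x \<in> U" using that R by blast
    then have "x \<in> frontier \<Omega> \<longleftrightarrow> x \<in> frontier \<Omega> \<inter> U" "x \<in> \<Omega> \<longleftrightarrow> x \<in> \<Omega> \<inter> U" by auto
    then show ?thesis unfolding fr Om using \<open>x \<in> U\<close> by (auto simp: \<tau>_def proj_def)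
  qed
  ultimately show ?thesis unfolding boundary_chart_def by blast
qed

lemma boundary_chart_mono:
  assumes "boundary_chart \<Omega> q R M n \<tau>" "0 < R'" "ball p R' \<subseteq> ball q R" "M \<le> M'"
  shows "boundary_chart \<Omega> p R' M' n \<tau>"
proof -
  have "depth_function n \<tau> M" using assms(1) by (simp add: boundary_chart_def)
  then have "depth_function n \<tau> M'"
    using assms(4) unfolding depth_function_def by (auto intro: lipschitz_on_mono)
  then show ?thesis using assms unfolding boundary_chart_def by blast
qed

text \<open>
  By compactness of the boundary, finitely many charts suffice. Halving the radii makes the chart at
  \<open>q\<close> available on a ball about every boundary point near \<open>q\<close>.
\<close>

lemma bounded_lipschitz_domain_charts:
  fixes \<Omega> :: "'a::euclidean_space set"
  assumes "bounded_lipschitz_domain \<Omega>"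
  obtains R M where "0 < R" "1 \<le> M" "\<And>p. p \<in> frontier \<Omega> \<Longrightarrow> \<exists>n \<tau>. boundary_chart \<Omega> p R M n \<tau>"
    "\<exists>D. finite D \<and> D \<subseteq> frontier \<Omega> \<and> frontier \<Omega> \<subseteq> (\<Union>q\<in>D. ball q R)"
proof -
  have "compact (frontier \<Omega>)" using assms by (simp add: bounded_lipschitz_domain_def compact_frontier_bounded)
  have "\<forall>q\<in>frontier \<Omega>. \<exists>R M n \<tau>. boundary_chart \<Omega> q R M n \<tau>"
    using assms lipschitz_graph_chart unfolding bounded_lipschitz_domain_def by blast
  then obtain R M n \<tau> where ch: "\<And>q. q \<in> frontier \<Omega> \<Longrightarrow> boundary_chart \<Omega> q (R q) (M q) (n q) (\<tau> q)"
    by metis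
  have Rpos: "0 < R q" and M1: "1 \<le> M q" if "q \<in> frontier \<Omega>" for q
    using ch[OF that] by (auto simp: boundary_chart_def depth_function_def)
  obtain D where D: "D \<subseteq> frontier \<Omega>" "finite D" "frontier \<Omega> \<subseteq> (\<Union>q\<in>D. ball q (R q / 2))"
    using \<open>compact (frontier \<Omega>)\<close> Rpos
    by (rule_tac compactE_image[of "frontier \<Omega>" "frontier \<Omega>" "\<lambda>q. ball q (R q / 2)"]) (auto intro!: bexI)
  define R0 where "R0 = Min (insert 1 ((\<lambda>q. R q / 2) ` D))"
  define M0 where "M0 = Max (insert 1 (M ` D))"
  have R0: "0 < R0" using D Rpos by (auto simp: R0_def)
  have R0_le: "R0 \<le> R q / 2" if "q \<in> D" for q
    unfolding R0_def by (rule Min_le) (use D that in auto)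
  have M0: "1 \<le> M0" unfolding M0_def by (rule Max_ge) (use D in auto)
  have M0_ge: "M q \<le> M0" if "q \<in> D" for q
    unfolding M0_def by (rule Max_ge) (use D that in auto)
  have "\<exists>n \<tau>. boundary_chart \<Omega> p R0 M0 n \<tau>" if "p \<in> frontier \<Omega>" for p
  proof -
    obtain q where q: "q \<in> D" "dist q p < R q / 2" using D(3) \<open>p \<in> frontier \<Omega>\<close> by auto
    have "ball p R0 \<subseteq> ball q (R q)"
    proof
      fix x assume "x \<in> ball p R0"
      then show "x \<in> ball q (R q)" using q R0_le[OF q(1)] dist_triangle[of q x p] by simp
    qed
    then show ?thesis
      using boundary_chart_mono[OF ch R0 _ M0_ge] q D by blast
  qed
  moreover obtain D' where "D' \<subseteq> frontier \<Omega>" "finite D'" "frontier \<Omega> \<subseteq> (\<Union>q\<in>D'. ball q R0)"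
    using \<open>compact (frontier \<Omega>)\<close> R0
    by (rule_tac compactE_image[of "frontier \<Omega>" "frontier \<Omega>" "\<lambda>q. ball q R0"]) (auto intro!: bexI)
  ultimately show ?thesis using that R0 M0 by blast
qed

lemma space_surface_measure [simp]: "space (surface_measure \<Omega>) = frontier \<Omega>"
  by (simp add: surface_measure_def space_restrict_space)

lemma sets_surface_measure [measurable_cong]: "sets (surface_measure \<Omega>) = sets (restrict_space borel (frontier \<Omega>))"
  unfolding surface_measure_def by (intro sets_restrict_space_cong) simp

lemma emeasure_surface_measure:
  fixes \<Omega> :: "'a::euclidean_space set"
  assumes "DIM('a) \<ge> 2" "A \<in> sets borel" "A \<subseteq> frontier \<Omega>"
  shows "emeasure (surface_measure \<Omega>) A = hausdorff_outer_measure (DIM('a) - 1) A"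
  unfolding surface_measure_def
  using assms by (simp add: emeasure_restrict_space emeasure_hausdorff_measure)

lemma finite_surface_measure:
  fixes \<Omega> :: "'a::euclidean_space set"
  assumes dim: "DIM('a) \<ge> 2" and "bounded_lipschitz_domain \<Omega>"
  shows "finite_measure (surface_measure \<Omega>)"
proof (rule finite_measureI)
  obtain R M D where ch: "0 < R" "\<And>p. p \<in> frontier \<Omega> \<Longrightarrow> \<exists>n \<tau>. boundary_chart \<Omega> p R M n \<tau>"
    and D: "finite D" "D \<subseteq> frontier \<Omega>" "frontier \<Omega> \<subseteq> (\<Union>q\<in>D. ball q R)"
    using bounded_lipschitz_domain_charts[OF assms(2)] by metis
  have fin: "emeasure (surface_measure \<Omega>) (frontier \<Omega> \<inter> ball q R) < \<infinity>" if q: "q \<in> D" for q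
  proof -
    obtain n \<tau> where c: "boundary_chart \<Omega> q R M n \<tau>" using ch(2) q D by blast
    then have "frontier \<Omega> \<inter> ball q R = {x \<in> ball q R. \<tau> x = 0}" by (auto simp: boundary_chart_def)
    moreover have "depth_function n \<tau> M" using c by (simp add: boundary_chart_def)
    ultimately have "hausdorff_outer_measure (DIM('a) - 1) (frontier \<Omega> \<inter> ball q R) < \<infinity>"
      using depth_function.hausdorff_outer_measure_graph_finite[OF _ dim ch(1)] by simp
    then show ?thesis
      by (subst emeasure_surface_measure[OF dim]) auto
  qed
  have "emeasure (surface_measure \<Omega>) (frontier \<Omega>) = emeasure (surface_measure \<Omega>) (\<Union>q\<in>D. frontier \<Omega> \<inter> ball q R)"
    using D by (intro arg_cong2[where f=emeasure]) auto
  also have "\<dots> \<le> (\<Sum>q\<in>D. emeasure (surface_measure \<Omega>) (frontier \<Omega> \<inter> ball q R))"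
    using D by (intro emeasure_subadditive_finite) (auto simp: sets_surface_measure sets_restrict_space)
  also have "\<dots> < \<infinity>" using fin D by (simp add: ennreal_sum_less_top)
  finally show "emeasure (surface_measure \<Omega>) (space (surface_measure \<Omega>)) \<noteq> \<infinity>" by simp
qed

section \<open>Calculus of C1 functions\<close>

lemma has_derivative_grad:
  fixes f :: "'a::euclidean_space \<Rightarrow> real"
  assumes "f differentiable (at x)"
  shows "(f has_derivative (\<lambda>h. grad f x \<bullet> h)) (at x)"
proof -
  let ?D = "frechet_derivative f (at x)"
  have D: "(f has_derivative ?D) (at x)" using assms by (simp add: frechet_derivative_works)
  then have lin: "linear ?D" by (rule has_derivative_linear)
  have "?D h = grad f x \<bullet> h" for h
  proof -
    have "?D h = ?D (\<Sum>b\<in>Basis. (h \<bullet> b) *\<^sub>R b)" by (simp add: euclidean_representation)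
    also have "\<dots> = (\<Sum>b\<in>Basis. (h \<bullet> b) * ?D b)" by (simp add: linear_sum[OF lin] linear_cmul[OF lin])
    also have "\<dots> = grad f x \<bullet> h" 
      unfolding grad_def inner_sum_left by (intro sum.cong) (auto simp: inner_commute mult.commute)
    finally show ?thesis .
  qed
  then have "?D = (\<lambda>h. grad f x \<bullet> h)" by blast
  with D show ?thesis by simp
qed

lemma grad_eqI:
  assumes "(f has_derivative (\<lambda>h. g \<bullet> h)) (at x)"
  shows "grad f x = g"
  unfolding grad_def frechet_derivative_at[OF assms, symmetric] by (rule euclidean_representation)

lemma Ck_1I:
  fixes f :: "'a::euclidean_space \<Rightarrow> real"
  assumes "\<And>x. (f has_derivative (\<lambda>h. g x \<bullet> h)) (at x)" "continuous_on UNIV g"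
  shows "Ck 1 f"
proof -
  have "frechet_derivative f (at x) = (\<lambda>h. g x \<bullet> h)" for x
    using frechet_derivative_at[OF assms(1)] by metis
  then show ?thesis
    using assms by (auto simp: differentiable_def intro!: continuous_intros)
qed

lemma Ck_1_differentiable: "Ck 1 f \<Longrightarrow> f differentiable (at x)"
  by simp

lemma Ck_1_has_derivative: "Ck 1 f \<Longrightarrow> (f has_derivative (\<lambda>h. grad f x \<bullet> h)) (at x)"
  by (intro has_derivative_grad Ck_1_differentiable)

lemma Ck_1_continuous_on: "Ck 1 f \<Longrightarrow> continuous_on A f"
  by (meson Ck_1_differentiable continuous_at_imp_continuous_on differentiable_imp_continuous_within)

lemma Ck_1_continuous_on_grad:
  fixes f :: "'a::euclidean_space \<Rightarrow> real"
  assumes "Ck 1 f"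
  shows "continuous_on A (grad f)"
proof -
  have "continuous_on UNIV (\<lambda>x. frechet_derivative f (at x) b)" if "b \<in> Basis" for b
    using assms that by simp
  then have "continuous_on UNIV (grad f)"
    unfolding grad_def by (intro continuous_intros) auto
  then show ?thesis by (rule continuous_on_subset) simp
qed

lemma Ck_1_const: "Ck 1 (\<lambda>x::'a::euclidean_space. c)" and grad_const: "grad (\<lambda>x::'a. c) x = 0"
proof -
  have *: "((\<lambda>x::'a. c) has_derivative (\<lambda>h. 0 \<bullet> h)) (at x)" for x by simp
  show "Ck 1 (\<lambda>x::'a. c)" by (rule Ck_1I[OF *]) simp
  show "grad (\<lambda>x::'a. c) x = 0" by (rule grad_eqI[OF *])
qed

lemma Ck_1_mult:
  fixes f g :: "'a::euclidean_space \<Rightarrow> real"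
  assumes "Ck 1 f" "Ck 1 g"
  shows "Ck 1 (\<lambda>x. f x * g x)" and "grad (\<lambda>x. f x * g x) x = g x *\<^sub>R grad f x + f x *\<^sub>R grad g x"
proof -
  have *: "((\<lambda>x. f x * g x) has_derivative (\<lambda>h. (g x *\<^sub>R grad f x + f x *\<^sub>R grad g x) \<bullet> h)) (at x)" for x
    by (rule has_derivative_eq_rhs[OF has_derivative_mult[OF Ck_1_has_derivative Ck_1_has_derivative]])
      (use assms in \<open>auto simp: inner_add_left\<close>)
  show "Ck 1 (\<lambda>x. f x * g x)"
    by (rule Ck_1I[OF *]) (intro continuous_intros Ck_1_continuous_on Ck_1_continuous_on_grad assms)
  show "grad (\<lambda>x. f x * g x) x = g x *\<^sub>R grad f x + f x *\<^sub>R grad g x"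
    by (rule grad_eqI[OF *])
qed

lemma Ck_1_compose:
  fixes f :: "'a::euclidean_space \<Rightarrow> real"
  assumes f: "Ck 1 f" and \<Lambda>: "\<And>t. (\<Lambda> has_real_derivative \<Lambda>' t) (at t)" "continuous_on UNIV \<Lambda>'"
  shows "Ck 1 (\<lambda>x. \<Lambda> (f x))" and "grad (\<lambda>x. \<Lambda> (f x)) x = \<Lambda>' (f x) *\<^sub>R grad f x"
proof -
  have *: "((\<lambda>x. \<Lambda> (f x)) has_derivative (\<lambda>h. (\<Lambda>' (f x) *\<^sub>R grad f x) \<bullet> h)) (at x)" for x
    by (rule has_derivative_eq_rhs[OF has_derivative_compose[OF Ck_1_has_derivative[OF f]
          \<Lambda>(1)[unfolded has_field_derivative_def]]]) auto
  show "Ck 1 (\<lambda>x. \<Lambda> (f x))"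
    by (rule Ck_1I[OF *])
      (intro continuous_intros continuous_on_compose2[OF \<Lambda>(2)] Ck_1_continuous_on Ck_1_continuous_on_grad f, auto)
  show "grad (\<lambda>x. \<Lambda> (f x)) x = \<Lambda>' (f x) *\<^sub>R grad f x"
    by (rule grad_eqI[OF *])
qed

section \<open>Convergence in L2\<close>

lemma square_integrableD:
  assumes "square_integrable M f"
  shows "f \<in> borel_measurable M" "(\<integral>\<^sup>+x. ennreal ((norm (f x))\<^sup>2) \<partial>M) < \<infinity>"
proof -
  show "f \<in> borel_measurable M" using assms by (simp add: square_integrable_def)
  have "(\<integral>\<^sup>+x. ennreal (norm ((norm (f x))\<^sup>2)) \<partial>M) < \<infinity>"
    using assms by (simp only: square_integrable_def integrable_iff_bounded)
  then show "(\<integral>\<^sup>+x. ennreal ((norm (f x))\<^sup>2) \<partial>M) < \<infinity>" by simp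
qed

lemma square_integrableI:
  assumes "f \<in> borel_measurable M" "(\<integral>\<^sup>+x. ennreal ((norm (f x))\<^sup>2) \<partial>M) < \<infinity>"
  shows "square_integrable M f"
  unfolding square_integrable_def integrable_iff_bounded using assms by simp

lemma square_integrableI_bound:
  fixes f :: "'a \<Rightarrow> 'b::euclidean_space" and g :: "'a \<Rightarrow> 'c::euclidean_space"
  assumes M: "finite_measure M" and f: "f \<in> borel_measurable M" and g: "square_integrable M g"
    and le: "\<And>x. x \<in> space M \<Longrightarrow> norm (f x) \<le> a + b * norm (g x)"
  shows "square_integrable M f"
proof (rule square_integrableI[OF f])
  interpret finite_measure M by fact
  have [measurable]: "g \<in> borel_measurable M" using g by (rule square_integrableD)
  have "(norm (f x))\<^sup>2 \<le> 2 * a\<^sup>2 + 2 * b\<^sup>2 * (norm (g x))\<^sup>2" if "x \<in> space M" for x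
  proof -
    have "(norm (f x))\<^sup>2 \<le> (a + b * norm (g x))\<^sup>2" using le[OF that] by (intro power_mono) auto
    also have "\<dots> \<le> 2 * a\<^sup>2 + 2 * (b * norm (g x))\<^sup>2"
      using zero_le_power2[of "a - b * norm (g x)"] by (simp add: power2_eq_square algebra_simps)
    finally show ?thesis by (simp add: power_mult_distrib)
  qed
  then have "(\<integral>\<^sup>+x. ennreal ((norm (f x))\<^sup>2) \<partial>M) \<le> (\<integral>\<^sup>+x. ennreal (2 * a\<^sup>2) + ennreal (2 * b\<^sup>2) * ennreal ((norm (g x))\<^sup>2) \<partial>M)"
    by (intro nn_integral_mono) (simp flip: ennreal_mult ennreal_plus)
  also have "\<dots> = ennreal (2 * a\<^sup>2) * emeasure M (space M) + ennreal (2 * b\<^sup>2) * (\<integral>\<^sup>+x. ennreal ((norm (g x))\<^sup>2) \<partial>M)"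
    by (simp add: nn_integral_add nn_integral_cmult)
  also have "\<dots> < \<infinity>"
    using square_integrableD(2)[OF g] by (simp add: ennreal_mult_eq_top_iff less_top[symmetric])
  finally show "(\<integral>\<^sup>+x. ennreal ((norm (f x))\<^sup>2) \<partial>M) < \<infinity>" .
qed

lemma L2_tendsto_subseq:
  assumes "L2_tendsto M f g" "strict_mono r"
  shows "L2_tendsto M (\<lambda>k. f (r k)) g"
  using LIMSEQ_subseq_LIMSEQ[OF assms(1)[unfolded L2_tendsto_def] assms(2)]
  by (simp add: L2_tendsto_def o_def)

lemma L2_tendsto_bound:
  assumes f: "L2_tendsto M f g" and [measurable]: "\<And>k. f k \<in> borel_measurable M" "g \<in> borel_measurable M"
    and le: "\<And>k x. x \<in> space M \<Longrightarrow> norm (f' k x - g' x) \<le> K * norm (f k x - g x)"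
  shows "L2_tendsto M f' g'"
  unfolding L2_tendsto_def
proof (rule tendsto_sandwich[OF _ _ tendsto_const])
  have "(norm (f' k x - g' x))\<^sup>2 \<le> K\<^sup>2 * (norm (f k x - g x))\<^sup>2" if "x \<in> space M" for k x
    unfolding power_mult_distrib[symmetric] using le[OF that] by (intro power_mono) auto
  then have "(\<integral>\<^sup>+x. ennreal ((norm (f' k x - g' x))\<^sup>2) \<partial>M) \<le> (\<integral>\<^sup>+x. ennreal (K\<^sup>2) * ennreal ((norm (f k x - g x))\<^sup>2) \<partial>M)" for k
    by (intro nn_integral_mono) (simp flip: ennreal_mult)
  also have "\<dots> k = ennreal (K\<^sup>2) * (\<integral>\<^sup>+x. ennreal ((norm (f k x - g x))\<^sup>2) \<partial>M)" for k
    by (rule nn_integral_cmult) measurable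
  finally show "\<forall>\<^sub>F k in sequentially. (\<integral>\<^sup>+x. ennreal ((norm (f' k x - g' x))\<^sup>2) \<partial>M)
      \<le> ennreal (K\<^sup>2) * (\<integral>\<^sup>+x. ennreal ((norm (f k x - g x))\<^sup>2) \<partial>M)" by simp
  show "(\<lambda>k. ennreal (K\<^sup>2) * (\<integral>\<^sup>+x. ennreal ((norm (f k x - g x))\<^sup>2) \<partial>M)) \<longlonglongrightarrow> 0"
    using ennreal_tendsto_cmult[OF _ f[unfolded L2_tendsto_def], of "ennreal (K\<^sup>2)"] by simp
qed simp

lemma norm_add_power2_le: "(norm (x + y))\<^sup>2 \<le> 2 * (norm x)\<^sup>2 + 2 * (norm (y::'a::real_inner))\<^sup>2"
proof -
  have "(norm (x + y))\<^sup>2 \<le> (norm x + norm y)\<^sup>2" by (intro power_mono norm_triangle_ineq) simp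
  also have "\<dots> \<le> 2 * (norm x)\<^sup>2 + 2 * (norm y)\<^sup>2"
    using zero_le_power2[of "norm x - norm y"] by (simp add: power2_eq_square algebra_simps)
  finally show ?thesis .
qed

lemma nn_integral_norm_add_power2_le:
  fixes f g :: "'a \<Rightarrow> 'b::euclidean_space"
  assumes [measurable]: "f \<in> borel_measurable M" "g \<in> borel_measurable M"
  shows "(\<integral>\<^sup>+x. ennreal ((norm (f x + g x))\<^sup>2) \<partial>M)
    \<le> 2 * (\<integral>\<^sup>+x. ennreal ((norm (f x))\<^sup>2) \<partial>M) + 2 * (\<integral>\<^sup>+x. ennreal ((norm (g x))\<^sup>2) \<partial>M)"
proof -
  have "(\<integral>\<^sup>+x. ennreal ((norm (f x + g x))\<^sup>2) \<partial>M)
    \<le> (\<integral>\<^sup>+x. ennreal 2 * ennreal ((norm (f x))\<^sup>2) + ennreal 2 * ennreal ((norm (g x))\<^sup>2) \<partial>M)"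
    by (intro nn_integral_mono) (simp add: norm_add_power2_le flip: ennreal_mult ennreal_plus del: ennreal_numeral)
  also have "\<dots> = 2 * (\<integral>\<^sup>+x. ennreal ((norm (f x))\<^sup>2) \<partial>M) + 2 * (\<integral>\<^sup>+x. ennreal ((norm (g x))\<^sup>2) \<partial>M)"
    by (simp add: nn_integral_add nn_integral_cmult)
  finally show ?thesis .
qed

lemma L2_tendsto_add:
  assumes f: "L2_tendsto M f g" and f': "L2_tendsto M f' g'"
    and [measurable]: "\<And>k. f k \<in> borel_measurable M" "g \<in> borel_measurable M"
      "\<And>k. f' k \<in> borel_measurable M" "g' \<in> borel_measurable M"
  shows "L2_tendsto M (\<lambda>k x. f k x + f' k x) (\<lambda>x. g x + g' x)"
  unfolding L2_tendsto_def
proof (rule tendsto_sandwich[OF _ _ tendsto_const])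
  let ?I = "\<lambda>f g k. \<integral>\<^sup>+x. ennreal ((norm (f k x - g x))\<^sup>2) \<partial>M"
  have "(\<lambda>k. 2 * ?I f g k + 2 * ?I f' g' k) \<longlonglongrightarrow> 2 * 0 + 2 * 0"
    using f f' unfolding L2_tendsto_def by (intro tendsto_add ennreal_tendsto_cmult) auto
  then show "(\<lambda>k. 2 * ?I f g k + 2 * ?I f' g' k) \<longlonglongrightarrow> 0" by simp
  show "\<forall>\<^sub>F k in sequentially. (\<integral>\<^sup>+x. ennreal ((norm (f k x + f' k x - (g x + g' x)))\<^sup>2) \<partial>M) \<le> 2 * ?I f g k + 2 * ?I f' g' k"
  proof (rule always_eventually, rule allI)
    fix k
    have "(\<integral>\<^sup>+x. ennreal ((norm ((f k x - g x) + (f' k x - g' x)))\<^sup>2) \<partial>M) \<le> 2 * ?I f g k + 2 * ?I f' g' k"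
      by (rule nn_integral_norm_add_power2_le) measurable
    then show "(\<integral>\<^sup>+x. ennreal ((norm (f k x + f' k x - (g x + g' x)))\<^sup>2) \<partial>M) \<le> 2 * ?I f g k + 2 * ?I f' g' k"
      by (simp only: add_diff_add)
  qed
qed simp

lemma L2_tendsto_dominated:
  assumes [measurable]: "\<And>k. f k \<in> borel_measurable M" "g \<in> borel_measurable M"
    and lim: "AE x in M. (\<lambda>k. f k x) \<longlonglongrightarrow> g x"
    and w: "square_integrable M w" and le: "\<And>k x. x \<in> space M \<Longrightarrow> norm (f k x - g x) \<le> norm (w x)"
  shows "L2_tendsto M f g"
proof -
  have [measurable]: "w \<in> borel_measurable M" using w by (rule square_integrableD)
  have "(\<lambda>k. \<integral>\<^sup>+x. ennreal ((norm (f k x - g x))\<^sup>2) \<partial>M) \<longlonglongrightarrow> (\<integral>\<^sup>+x. 0 \<partial>M)"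
  proof (rule nn_integral_dominated_convergence[where w="\<lambda>x. ennreal ((norm (w x))\<^sup>2)"])
    show "AE x in M. ennreal ((norm (f k x - g x))\<^sup>2) \<le> ennreal ((norm (w x))\<^sup>2)" for k
      using le by (auto intro!: ennreal_leI power_mono)
    show "(\<integral>\<^sup>+x. ennreal ((norm (w x))\<^sup>2) \<partial>M) < \<infinity>" using w by (rule square_integrableD)
    show "AE x in M. (\<lambda>k. ennreal ((norm (f k x - g x))\<^sup>2)) \<longlonglongrightarrow> 0"
      using lim
    proof eventually_elim
      case (elim x)
      then have "(\<lambda>k. (norm (f k x - g x))\<^sup>2) \<longlonglongrightarrow> (norm (g x - g x))\<^sup>2" by (intro tendsto_intros)
      then show ?case by (simp add: tendsto_ennrealI flip: ennreal_0)
    qed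
  qed measurable
  then show ?thesis by (simp add: L2_tendsto_def)
qed

text \<open>
  Only finitely many of the differences can fail to be square integrable; they are dropped by the
  shift \<open>N\<close> before passing to a subsequence.
\<close>

lemma L2_tendsto_AE_subseq:
  assumes [measurable]: "\<And>k. f k \<in> borel_measurable M" "g \<in> borel_measurable M"
    and f: "L2_tendsto M f g"
  shows "\<exists>r. strict_mono r \<and> (AE x in M. (\<lambda>k. f (r k) x) \<longlonglongrightarrow> g x)"
proof -
  let ?I = "\<lambda>k. \<integral>\<^sup>+x. ennreal ((norm (f k x - g x))\<^sup>2) \<partial>M"
  have I: "?I \<longlonglongrightarrow> 0" using f by (simp add: L2_tendsto_def)
  then have "\<forall>\<^sub>F k in sequentially. ?I k < 1" by (rule order_tendstoD) simp
  then obtain N where N: "\<And>k. k \<ge> N \<Longrightarrow> ?I k < 1" by (auto simp: eventually_sequentially)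
  define v where "v k x = (norm (f (k + N) x - g x))\<^sup>2" for k x
  have [measurable]: "v k \<in> borel_measurable M" for k unfolding v_def by measurable
  have fin: "?I (k + N) < \<infinity>" for k using N[of "k + N"] by (auto intro: less_trans)
  have int: "integrable M (v k)" for k
    by (rule integrableI_nonneg) (use fin[of k] in \<open>auto simp: v_def\<close>)
  have "(\<integral>x. norm (v k x) \<partial>M) = enn2real (?I (k + N))" for k
    by (subst integral_eq_nn_integral) (auto simp: v_def)
  moreover have "(\<lambda>k. enn2real (?I (k + N))) \<longlonglongrightarrow> enn2real 0"
    using LIMSEQ_ignore_initial_segment[OF I, of N] by (intro tendsto_enn2real) auto
  ultimately have "(\<lambda>k. \<integral>x. norm (v k x) \<partial>M) \<longlonglongrightarrow> 0" by simp
  from tendsto_L1_AE_subseq[OF int this]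
  obtain r where r: "strict_mono r" "AE x in M. (\<lambda>k. v (r k) x) \<longlonglongrightarrow> 0" by blast
  have "strict_mono (\<lambda>k. r k + N)" using r(1) by (auto simp: strict_mono_def)
  moreover have "AE x in M. (\<lambda>k. f (r k + N) x) \<longlonglongrightarrow> g x"
    using r(2)
  proof eventually_elim
    case (elim x)
    then have "(\<lambda>k. sqrt (v (r k) x)) \<longlonglongrightarrow> sqrt 0" by (rule tendsto_real_sqrt)
    then have "(\<lambda>k. norm (f (r k + N) x - g x)) \<longlonglongrightarrow> 0" by (simp add: v_def)
    then show ?case by (simp add: tendsto_norm_zero_iff LIM_zero_iff)
  qed
  ultimately show ?thesis by blast
qed

text \<open>
  On a finite measure space this follows from \<open>t \<le> e + t\<^sup>2 / e\<close>, with \<open>e\<close> small compared to the total mass.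
\<close>

lemma L2_tendsto_imp_L1:
  fixes f :: "nat \<Rightarrow> 'a \<Rightarrow> 'b::euclidean_space"
  assumes M: "finite_measure M" and [measurable]: "\<And>k. f k \<in> borel_measurable M" "g \<in> borel_measurable M"
    and f: "L2_tendsto M f g"
  shows "(\<lambda>k. \<integral>\<^sup>+x. ennreal (norm (f k x - g x)) \<partial>M) \<longlonglongrightarrow> 0"
proof (rule order_tendstoI)
  interpret finite_measure M by fact
  let ?I = "\<lambda>k. \<integral>\<^sup>+x. ennreal ((norm (f k x - g x))\<^sup>2) \<partial>M"
  fix a :: ennreal assume "0 < a"
  define m where "m = measure M (space M)"
  have "\<exists>a'>0. ennreal a' < a"
  proof (cases a)
    case (real r)
    then have "0 < r" using \<open>0 < a\<close> by simp
    then show ?thesis using real by (intro exI[of _ "r / 2"]) (simp add: ennreal_less_iff)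
  next
    case top
    then show ?thesis by (intro exI[of _ 1]) simp
  qed
  then obtain a' where a': "0 < a'" "ennreal a' < a" by blast
  define e where "e = a' / (2 * (m + 1))"
  have m: "0 \<le> m" by (simp add: m_def)
  have e: "0 < e" "e * m \<le> a' / 2" using a' m by (auto simp: e_def field_simps)
  have le: "(\<integral>\<^sup>+x. ennreal (norm (f k x - g x)) \<partial>M) \<le> ennreal (a' / 2) + ennreal (1 / e) * ?I k" for k
  proof -
    have "norm (f k x - g x) \<le> e + 1 / e * (norm (f k x - g x))\<^sup>2" for x
    proof -
      define t where "t = norm (f k x - g x)"
      show ?thesis
      proof (cases "t \<le> e")
        case True
        then show ?thesis using e by (simp add: t_def[symmetric] add_increasing2)
      next
        case False
        then have "t * e \<le> t * t" using e by (intro mult_left_mono) auto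
        then show ?thesis using e by (simp add: t_def[symmetric] field_simps power2_eq_square add_increasing)
      qed
    qed
    then have "(\<integral>\<^sup>+x. ennreal (norm (f k x - g x)) \<partial>M) \<le> (\<integral>\<^sup>+x. ennreal e + ennreal (1 / e) * ennreal ((norm (f k x - g x))\<^sup>2) \<partial>M)"
      using e by (intro nn_integral_mono) (simp flip: ennreal_mult ennreal_plus)
    also have "\<dots> = ennreal e * emeasure M (space M) + ennreal (1 / e) * ?I k"
      by (simp add: nn_integral_add nn_integral_cmult)
    also have "ennreal e * emeasure M (space M) = ennreal (e * m)"
      using e by (simp add: emeasure_eq_measure m_def ennreal_mult)
    also have "\<dots> + ennreal (1 / e) * ?I k \<le> ennreal (a' / 2) + ennreal (1 / e) * ?I k"
      using e by (intro add_right_mono ennreal_leI)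
    finally show ?thesis .
  qed
  have "(\<lambda>k. ennreal (a' / 2) + ennreal (1 / e) * ?I k) \<longlonglongrightarrow> ennreal (a' / 2) + ennreal (1 / e) * 0"
    using f unfolding L2_tendsto_def by (intro tendsto_add tendsto_const ennreal_tendsto_cmult) auto
  moreover have "ennreal (a' / 2) < a"
    using a' by (auto intro!: le_less_trans[OF _ a'(2)] ennreal_leI)
  ultimately have "\<forall>\<^sub>F k in sequentially. ennreal (a' / 2) + ennreal (1 / e) * ?I k < a"
    by (auto intro: order_tendstoD)
  then show "\<forall>\<^sub>F k in sequentially. (\<integral>\<^sup>+x. ennreal (norm (f k x - g x)) \<partial>M) < a"
    by eventually_elim (use le in \<open>auto intro: le_less_trans\<close>)
qed simp

section \<open>Integration by parts\<close>

lemma grad_eq_0_outside: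
  assumes "closed K" "\<And>x. x \<notin> K \<Longrightarrow> h x = 0" "x \<notin> K"
  shows "grad h x = 0"
proof (rule grad_eqI)
  have "((\<lambda>x. 0::real) has_derivative (\<lambda>v. 0 \<bullet> v)) (at x)" by simp
  then show "(h has_derivative (\<lambda>v. 0 \<bullet> v)) (at x)"
    by (rule has_derivative_transform_within_open[OF _ open_Compl[OF assms(1)]]) (use assms in auto)
qed

lemma integrable_continuous_compact_support:
  fixes f :: "'a::euclidean_space \<Rightarrow> 'b::euclidean_space"
  assumes "continuous_on UNIV f" "compact K" "\<And>x. x \<notin> K \<Longrightarrow> f x = 0"
  shows "integrable lborel f"
proof -
  have "integrable lborel (\<lambda>x. indicator K x *\<^sub>R f x)"
    using assms by (intro borel_integrable_compact) (auto intro: continuous_on_subset)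
  also have "(\<lambda>x. indicator K x *\<^sub>R f x) = f" using assms(3) by (auto simp: indicator_def)
  finally show ?thesis .
qed

lemma C1_lipschitz_bound:
  fixes h :: "'a::euclidean_space \<Rightarrow> real"
  assumes "Ck 1 h" "\<And>x. norm (grad h x) \<le> B"
  shows "\<bar>h x - h y\<bar> \<le> B * norm (x - y)"
proof -
  have "norm (h x - h y) \<le> B * norm (x - y)"
  proof (rule differentiable_bound[of UNIV h "\<lambda>x v. grad h x \<bullet> v"])
    fix x
    show "onorm (\<lambda>v. grad h x \<bullet> v) \<le> B"
    proof (rule onorm_le)
      fix v
      have "norm (grad h x \<bullet> v) \<le> norm (grad h x) * norm v" by (simp add: Cauchy_Schwarz_ineq2)
      also have "\<dots> \<le> B * norm v" using assms by (intro mult_right_mono) auto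
      finally show "norm (grad h x \<bullet> v) \<le> B * norm v" .
    qed
  qed (use Ck_1_has_derivative[OF assms(1)] in auto)
  then show ?thesis by simp
qed

text \<open>
  Lebesgue measure is translation invariant, so the integral of a difference quotient of a function
  with compact support vanishes; the quotients converge boundedly on a fixed ball.
\<close>

lemma integral_grad_eq_0:
  fixes h :: "'a::euclidean_space \<Rightarrow> real"
  assumes h: "Ck 1 h" and K: "compact K" "\<And>x. x \<notin> K \<Longrightarrow> h x = 0"
  shows "(LINT x|lborel. grad h x) = 0"
proof -
  note g0 = grad_eq_0_outside[of K h, OF compact_imp_closed[OF K(1)] K(2)]
  have intg: "integrable lborel (grad h)"
    by (rule integrable_continuous_compact_support[OF Ck_1_continuous_on_grad[OF h] K(1) g0])
  have inth: "integrable lborel h"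
    by (rule integrable_continuous_compact_support[OF Ck_1_continuous_on[OF h] K])
  obtain B0 where B0: "\<And>x. x \<in> K \<Longrightarrow> norm (grad h x) \<le> B0"
    using compact_imp_bounded[OF compact_continuous_image[OF Ck_1_continuous_on_grad[OF h] K(1)]]
    by (auto simp: bounded_iff)
  define B where "B = max 0 B0"
  have B: "norm (grad h x) \<le> B" for x
    using B0[of x] g0[of x] by (cases "x \<in> K") (auto simp: B_def)
  obtain \<rho> where \<rho>: "K \<subseteq> cball 0 \<rho>"
    using compact_imp_bounded[OF K(1)] by (auto simp: bounded_iff subset_iff)
  have "(LINT x|lborel. grad h x \<bullet> b) = 0" if b: "b \<in> Basis" for b
  proof -
    define q where "q k x = (h (inverse (real (Suc k)) *\<^sub>R b + x) - h x) / inverse (real (Suc k))" for k x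
    have [measurable]: "h \<in> borel_measurable borel" "grad h \<in> borel_measurable borel"
      by (intro borel_measurable_continuous_onI Ck_1_continuous_on Ck_1_continuous_on_grad h)+
    have shift: "integrable lborel (\<lambda>x. h (c + x))" "(LINT x|lborel. h (c + x)) = (LINT x|lborel. h x)" for c
    proof -
      have "integrable (distr lborel borel ((+) c)) h" using inth by (simp add: lborel_distr_plus)
      then show "integrable lborel (\<lambda>x. h (c + x))" by (subst (asm) integrable_distr_eq) auto
      have "(LINT x|distr lborel borel ((+) c). h x) = (LINT x|lborel. h (c + x))" by (rule integral_distr) auto
      then show "(LINT x|lborel. h (c + x)) = (LINT x|lborel. h x)" by (simp add: lborel_distr_plus)
    qed
    have q0: "(LINT x|lborel. q k x) = 0" for k
      unfolding q_def using shift inth by simp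
    have lim: "(\<lambda>k. q k x) \<longlonglongrightarrow> grad h x \<bullet> b" for x
    proof -
      have "((\<lambda>t. h (t *\<^sub>R b + x)) has_derivative (\<lambda>t. grad h (0 *\<^sub>R b + x) \<bullet> (t *\<^sub>R b))) (at 0)"
        by (rule has_derivative_compose[OF _ Ck_1_has_derivative[OF h], of "\<lambda>t. t *\<^sub>R b + x"])
          (auto intro!: derivative_eq_intros)
      then have "((\<lambda>t. h (t *\<^sub>R b + x)) has_real_derivative (grad h x \<bullet> b)) (at 0)"
        by (simp add: has_field_derivative_def mult_commute_abs)
      then have "(\<lambda>t. (h (t *\<^sub>R b + x) - h x) / t) \<midarrow>0\<rightarrow> grad h x \<bullet> b"
        by (simp add: DERIV_def)
      moreover have "filterlim (\<lambda>k. inverse (real (Suc k))) (at 0) sequentially"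
        by (rule filterlim_atI[OF LIMSEQ_inverse_real_of_nat]) (simp add: eventually_sequentially)
      ultimately show ?thesis unfolding q_def by (rule filterlim_compose)
    qed
    have "(\<lambda>k. LINT x|lborel. q k x) \<longlonglongrightarrow> (LINT x|lborel. grad h x \<bullet> b)"
    proof (rule integral_dominated_convergence[where w="\<lambda>x. B * indicator (cball 0 (\<rho> + 1)) x"])
      show "integrable lborel (\<lambda>x. B * indicator (cball 0 (\<rho> + 1)) x :: real)"
        using emeasure_lborel_cball_finite[of 0 "\<rho> + 1"] by (intro integrable_mult_right integrable_real_indicator) auto
      show "AE x in lborel. norm (q k x) \<le> B * indicator (cball 0 (\<rho> + 1)) x" for k
      proof (rule AE_I2)
        fix x
        define t where "t = inverse (real (Suc k))"
        have t: "0 < t" "t \<le> 1" by (simp_all add: t_def field_simps)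
        have "\<bar>h (t *\<^sub>R b + x) - h x\<bar> \<le> B * norm (t *\<^sub>R b + x - x)"
          by (rule C1_lipschitz_bound[OF h B])
        then have "\<bar>h (t *\<^sub>R b + x) - h x\<bar> \<le> B * t" using t b by simp
        then have 1: "norm (q k x) \<le> B"
          unfolding q_def t_def[symmetric] using t by (simp add: field_simps)
        have 2: "q k x = 0" if "x \<notin> cball 0 (\<rho> + 1)"
        proof -
          have "\<rho> < norm (t *\<^sub>R b + x)"
            using that t b norm_triangle_ineq2[of x "- (t *\<^sub>R b)"] by (simp add: add.commute)
          then have "t *\<^sub>R b + x \<notin> K" "x \<notin> K" using \<rho> that by auto
          then show ?thesis using K(2) by (simp add: q_def t_def)
        qed
        show "norm (q k x) \<le> B * indicator (cball 0 (\<rho> + 1)) x"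
          using 1 2 by (cases "x \<in> cball 0 (\<rho> + 1)") auto
      qed
      show "q k \<in> borel_measurable lborel" for k unfolding q_def by measurable
    qed (use lim in auto)
    then show ?thesis using q0 LIMSEQ_unique[OF _ tendsto_const] by simp
  qed
  then have z: "(LINT x|lborel. grad h x) \<bullet> b = 0" if "b \<in> Basis" for b
    using that intg by (subst integral_inner_left[symmetric]) auto
  show ?thesis by (rule euclidean_eqI) (simp add: z)
qed

lemma integral_lebesgue_on_eq_lborel:
  fixes F :: "'a::euclidean_space \<Rightarrow> 'b::euclidean_space"
  assumes "F \<in> borel_measurable borel" "\<Omega> \<in> sets lebesgue" "\<And>x. x \<notin> \<Omega> \<Longrightarrow> F x = 0"
  shows "(LINT x|lebesgue_on \<Omega>. F x) = (LINT x|lborel. F x)"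
proof -
  have "(LINT x|lebesgue_on \<Omega>. F x) = (LINT x|lebesgue. indicat_real \<Omega> x *\<^sub>R F x)"
    using assms(2) by (intro integral_restrict_space) simp
  also have "\<dots> = (LINT x|lebesgue. F x)"
    using assms(3) by (intro Bochner_Integration.integral_cong) (auto simp: indicator_def)
  also have "\<dots> = (LINT x|lborel. F x)"
    using assms(1) by (intro integral_completion) simp
  finally show ?thesis .
qed

lemma integration_by_parts:
  fixes f :: "'a::euclidean_space \<Rightarrow> real"
  assumes f: "Ck 1 f" and \<phi>: "test_function \<Omega> \<phi>" and \<Omega>: "\<Omega> \<in> sets lebesgue"
  shows "(LINT x|lebesgue_on \<Omega>. f x *\<^sub>R grad \<phi> x) = - (LINT x|lebesgue_on \<Omega>. \<phi> x *\<^sub>R grad f x)"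
proof -
  obtain K where K: "compact K" "K \<subseteq> \<Omega>" "\<And>x. x \<notin> K \<Longrightarrow> \<phi> x = 0" and c\<phi>: "Ck 1 \<phi>"
    using \<phi> unfolding test_function_def by blast
  note g0 = grad_eq_0_outside[of K \<phi>, OF compact_imp_closed[OF K(1)] K(3)]
  have c: "continuous_on UNIV (\<lambda>x. f x *\<^sub>R grad \<phi> x)" "continuous_on UNIV (\<lambda>x. \<phi> x *\<^sub>R grad f x)"
    by (intro continuous_intros Ck_1_continuous_on Ck_1_continuous_on_grad f c\<phi>)+
  have i: "integrable lborel (\<lambda>x. f x *\<^sub>R grad \<phi> x)" "integrable lborel (\<lambda>x. \<phi> x *\<^sub>R grad f x)"
    by (rule integrable_continuous_compact_support[OF c(1) K(1)] integrable_continuous_compact_support[OF c(2) K(1)];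
        simp add: g0 K(3))+
  have "(LINT x|lborel. grad (\<lambda>x. f x * \<phi> x) x) = 0"
    by (rule integral_grad_eq_0[OF Ck_1_mult(1)[OF f c\<phi>] K(1)]) (simp add: K(3))
  then have "(LINT x|lborel. \<phi> x *\<^sub>R grad f x) + (LINT x|lborel. f x *\<^sub>R grad \<phi> x) = 0"
    using i by (simp add: Ck_1_mult(2)[OF f c\<phi>])
  moreover have "(LINT x|lebesgue_on \<Omega>. f x *\<^sub>R grad \<phi> x) = (LINT x|lborel. f x *\<^sub>R grad \<phi> x)"
    by (rule integral_lebesgue_on_eq_lborel[OF borel_measurable_continuous_onI[OF c(1)] \<Omega>]) (use g0 K in auto)
  moreover have "(LINT x|lebesgue_on \<Omega>. \<phi> x *\<^sub>R grad f x) = (LINT x|lborel. \<phi> x *\<^sub>R grad f x)"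
    by (rule integral_lebesgue_on_eq_lborel[OF borel_measurable_continuous_onI[OF c(2)] \<Omega>]) (use K in auto)
  ultimately show ?thesis by (simp add: add_eq_0_iff)
qed

lemma square_integrable_imp_integrable:
  fixes f :: "'a \<Rightarrow> 'b::euclidean_space"
  assumes "finite_measure M" "square_integrable M f"
  shows "integrable M f"
proof (rule Bochner_Integration.integrable_bound[of _ "\<lambda>x. 1 + (norm (f x))\<^sup>2"])
  interpret finite_measure M by fact
  show "integrable M (\<lambda>x. 1 + (norm (f x))\<^sup>2)" using assms(2) by (simp add: square_integrable_def)
  have "norm y \<le> 1 + (norm y)\<^sup>2" for y :: 'b
  proof -
    have "2 * norm y \<le> 1 + (norm y)\<^sup>2" using zero_le_power2[of "norm y - 1"] unfolding power2_diff by simp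
    then show ?thesis using norm_ge_zero[of y] by linarith
  qed
  then show "AE x in M. norm (f x) \<le> norm (1 + (norm (f x))\<^sup>2)" by (auto intro: order_trans)
qed (use assms in \<open>auto simp: square_integrable_def\<close>)

lemma L2_tendsto_integral:
  fixes f :: "nat \<Rightarrow> 'a \<Rightarrow> 'b::euclidean_space"
  assumes M: "finite_measure M" and f: "\<And>k. square_integrable M (f k)" and g: "square_integrable M g"
    and lim: "L2_tendsto M f g"
  shows "(\<lambda>k. LINT x|M. f k x) \<longlonglongrightarrow> (LINT x|M. g x)"
proof -
  have [measurable]: "\<And>k. f k \<in> borel_measurable M" "g \<in> borel_measurable M"
    using f g by (auto dest: square_integrableD)
  have int: "integrable M (f k)" "integrable M g" for k
    using square_integrable_imp_integrable[OF M] f g by auto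
  have L1: "(\<lambda>k. \<integral>\<^sup>+x. ennreal (norm (f k x - g x)) \<partial>M) \<longlonglongrightarrow> 0"
    by (rule L2_tendsto_imp_L1[OF M _ _ lim]) measurable
  have b: "norm ((LINT x|M. f k x) - (LINT x|M. g x)) \<le> enn2real (\<integral>\<^sup>+x. ennreal (norm (f k x - g x)) \<partial>M)" for k
  proof -
    have "norm ((LINT x|M. f k x) - (LINT x|M. g x)) = norm (LINT x|M. f k x - g x)" using int by simp
    also have "\<dots> \<le> (LINT x|M. norm (f k x - g x))" by (rule integral_norm_bound)
    also have "\<dots> = enn2real (\<integral>\<^sup>+x. ennreal (norm (f k x - g x)) \<partial>M)"
      by (rule integral_eq_nn_integral) auto
    finally show ?thesis .
  qed
  have "(\<lambda>k. enn2real (\<integral>\<^sup>+x. ennreal (norm (f k x - g x)) \<partial>M)) \<longlonglongrightarrow> 0"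
    using tendsto_enn2real[of _ 0] L1 by simp
  then have "(\<lambda>k. (LINT x|M. f k x) - (LINT x|M. g x)) \<longlonglongrightarrow> 0"
    by (rule Lim_null_comparison[OF always_eventually[OF allI[OF b]]])
  then show ?thesis by (simp add: LIM_zero_iff)
qed

section \<open>Sobolev functions with a trace\<close>

text \<open>
  Square integrability together with the approximation by \<open>C\<^sup>1\<close> functions in \<open>has_trace\<close> already makes
  \<open>G\<close> the weak gradient of \<open>u\<close>, see \<open>H1_with_trace_imp_gradient\<close> below. Hence this is the class of
  test functions in the weak Steklov equation, and it is closed under composition with \<open>C\<^sup>1\<close>
  functions with bounded derivative and under multiplication by \<open>C\<^sup>1\<close> functions.
\<close>

definition H1_with_trace ::
  "'a::euclidean_space set \<Rightarrow> ('a \<Rightarrow> real) \<Rightarrow> ('a \<Rightarrow> 'a) \<Rightarrow> ('a \<Rightarrow> real) \<Rightarrow> bool" where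
  "H1_with_trace \<Omega> u G g \<longleftrightarrow>
    square_integrable (lebesgue_on \<Omega>) u \<and> square_integrable (lebesgue_on \<Omega>) G \<and> has_trace \<Omega> u G g"

locale lipschitz_domain =
  fixes \<Omega> :: "'a::euclidean_space set"
  assumes dim: "DIM('a) \<ge> 2" and lip: "bounded_lipschitz_domain \<Omega>"
begin

lemma open_domain: "open \<Omega>" and bounded_domain: "bounded \<Omega>" and connected_domain: "connected \<Omega>"
  using lip by (auto simp: bounded_lipschitz_domain_def)

lemma domain_borel [measurable]: "\<Omega> \<in> sets borel" "\<Omega> \<in> sets lebesgue"
  using open_domain by auto

sublocale interior: finite_measure "lebesgue_on \<Omega>"
  by (rule finite_measure_lebesgue_on) (use open_domain bounded_domain in \<open>simp add: lmeasurable_open\<close>)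

sublocale boundary: finite_measure "surface_measure \<Omega>"
  by (rule finite_surface_measure[OF dim lip])

lemma borel_measurable_interior: "f \<in> borel_measurable borel \<Longrightarrow> f \<in> borel_measurable (lebesgue_on \<Omega>)"
  by (intro measurable_restrict_space1 measurable_completion) simp

lemma borel_measurable_boundary:
  "f \<in> borel_measurable borel \<Longrightarrow> f \<in> borel_measurable (surface_measure \<Omega>)"
  unfolding measurable_cong_sets[OF sets_surface_measure refl] by (rule measurable_restrict_space1)

lemma bounded_on_domain:
  fixes f :: "'a \<Rightarrow> 'b::euclidean_space"
  assumes "continuous_on UNIV f"
  obtains B where "\<And>x. x \<in> \<Omega> \<Longrightarrow> norm (f x) \<le> B"
    "\<And>x. x \<in> frontier \<Omega> \<Longrightarrow> norm (f x) \<le> B"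
proof -
  have "compact (closure \<Omega>)" using bounded_domain by simp
  then have "bounded (f ` closure \<Omega>)"
    using assms by (intro compact_imp_bounded compact_continuous_image) (auto intro: continuous_on_subset)
  then obtain B where "\<And>x. x \<in> closure \<Omega> \<Longrightarrow> norm (f x) \<le> B" by (auto simp: bounded_iff)
  then show ?thesis using that[of B] closure_subset[of \<Omega>] by (auto simp: frontier_def)
qed

lemma continuous_imp_square_integrable:
  fixes f :: "'a \<Rightarrow> 'b::euclidean_space"
  assumes "continuous_on UNIV f"
  shows "square_integrable (lebesgue_on \<Omega>) f" "square_integrable (surface_measure \<Omega>) f"
proof -
  obtain B where B: "\<And>x. x \<in> \<Omega> \<Longrightarrow> norm (f x) \<le> B" "\<And>x. x \<in> frontier \<Omega> \<Longrightarrow> norm (f x) \<le> B"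
    using bounded_on_domain[OF assms] by metis
  have m: "f \<in> borel_measurable borel" using assms by (rule borel_measurable_continuous_onI)
  have 0: "square_integrable M (\<lambda>x. 0 :: real)" for M :: "'a measure"
    by (simp add: square_integrable_def)
  show "square_integrable (lebesgue_on \<Omega>) f"
    using B
    by (intro square_integrableI_bound[OF interior.finite_measure_axioms borel_measurable_interior[OF m] 0, of B 0]) auto
  show "square_integrable (surface_measure \<Omega>) f"
    using B
    by (intro square_integrableI_bound[OF boundary.finite_measure_axioms borel_measurable_boundary[OF m] 0, of B 0]) auto
qed

lemma Ck_1_measurable:
  assumes "Ck 1 f"
  shows "f \<in> borel_measurable (lebesgue_on \<Omega>)" "grad f \<in> borel_measurable (lebesgue_on \<Omega>)"
    "f \<in> borel_measurable (surface_measure \<Omega>)"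
  by (intro borel_measurable_interior borel_measurable_boundary borel_measurable_continuous_onI
      Ck_1_continuous_on Ck_1_continuous_on_grad assms)+

lemma H1_with_trace_imp_gradient:
  assumes "H1_with_trace \<Omega> u G g"
  shows "has_H1_gradient \<Omega> u G"
  unfolding has_H1_gradient_def
proof (intro conjI allI impI)
  show u: "square_integrable (lebesgue_on \<Omega>) u" and G: "square_integrable (lebesgue_on \<Omega>) G"
    using assms by (auto simp: H1_with_trace_def)
  obtain f where f: "\<And>k. Ck 1 (f k)" and fu: "L2_tendsto (lebesgue_on \<Omega>) f u"
    and fG: "L2_tendsto (lebesgue_on \<Omega>) (\<lambda>k. grad (f k)) G"
    using assms by (auto simp: H1_with_trace_def has_trace_def)
  have [measurable]: "u \<in> borel_measurable (lebesgue_on \<Omega>)" "G \<in> borel_measurable (lebesgue_on \<Omega>)"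
    using u G by (auto dest: square_integrableD)
  note [measurable] = Ck_1_measurable[OF f]
  fix \<phi> assume \<phi>: "test_function \<Omega> \<phi>"
  then obtain K where K: "compact K" "K \<subseteq> \<Omega>" "\<And>x. x \<notin> K \<Longrightarrow> \<phi> x = 0" and c\<phi>: "Ck 1 \<phi>"
    unfolding test_function_def by blast
  note [measurable] = Ck_1_measurable[OF c\<phi>]
  obtain B1 where B1: "\<And>x. x \<in> \<Omega> \<Longrightarrow> norm (\<phi> x) \<le> B1"
    using bounded_on_domain[OF Ck_1_continuous_on[OF c\<phi>]] by metis
  obtain B2 where B2: "\<And>x. x \<in> \<Omega> \<Longrightarrow> norm (grad \<phi> x) \<le> B2"
    using bounded_on_domain[OF Ck_1_continuous_on_grad[OF c\<phi>]] by metis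
  note B' = B1 B2
  have 1: "(\<lambda>k. LINT x|lebesgue_on \<Omega>. f k x *\<^sub>R grad \<phi> x) \<longlonglongrightarrow> (LINT x|lebesgue_on \<Omega>. u x *\<^sub>R grad \<phi> x)"
  proof (rule L2_tendsto_integral[OF interior.finite_measure_axioms])
    show "square_integrable (lebesgue_on \<Omega>) (\<lambda>x. f k x *\<^sub>R grad \<phi> x)" for k
      by (intro continuous_imp_square_integrable continuous_intros Ck_1_continuous_on Ck_1_continuous_on_grad f c\<phi>)
    show "square_integrable (lebesgue_on \<Omega>) (\<lambda>x. u x *\<^sub>R grad \<phi> x)"
      using B' by (intro square_integrableI_bound[OF interior.finite_measure_axioms _ u, of _ 0 B2])
        (auto simp: mult.commute[of _ "norm (grad \<phi> _)"] intro!: mult_right_mono)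
    show "L2_tendsto (lebesgue_on \<Omega>) (\<lambda>k x. f k x *\<^sub>R grad \<phi> x) (\<lambda>x. u x *\<^sub>R grad \<phi> x)"
      using B' by (intro L2_tendsto_bound[OF fu, of _ _ B2])
        (auto simp: mult.commute[of _ "norm (grad \<phi> _)"] simp flip: scaleR_diff_left intro!: mult_right_mono)
  qed
  have 2: "(\<lambda>k. LINT x|lebesgue_on \<Omega>. \<phi> x *\<^sub>R grad (f k) x) \<longlonglongrightarrow> (LINT x|lebesgue_on \<Omega>. \<phi> x *\<^sub>R G x)"
  proof (rule L2_tendsto_integral[OF interior.finite_measure_axioms])
    show "square_integrable (lebesgue_on \<Omega>) (\<lambda>x. \<phi> x *\<^sub>R grad (f k) x)" for k
      by (intro continuous_imp_square_integrable continuous_intros Ck_1_continuous_on Ck_1_continuous_on_grad f c\<phi>)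
    show "square_integrable (lebesgue_on \<Omega>) (\<lambda>x. \<phi> x *\<^sub>R G x)"
      using B' by (intro square_integrableI_bound[OF interior.finite_measure_axioms _ G, of _ 0 B1])
        (auto intro!: mult_right_mono)
    show "L2_tendsto (lebesgue_on \<Omega>) (\<lambda>k x. \<phi> x *\<^sub>R grad (f k) x) (\<lambda>x. \<phi> x *\<^sub>R G x)"
      using B' by (intro L2_tendsto_bound[OF fG, of _ _ B1])
        (auto simp flip: scaleR_diff_right intro!: mult_right_mono)
  qed
  show "(LINT x|lebesgue_on \<Omega>. u x *\<^sub>R grad \<phi> x) = - (LINT x|lebesgue_on \<Omega>. \<phi> x *\<^sub>R G x)"
    using 1 tendsto_minus[OF 2] unfolding integration_by_parts[OF f \<phi> domain_borel(2)]
    by (rule LIMSEQ_unique)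
qed

text \<open>
  The chain rule passes to the limit along a subsequence of the approximating functions that converges
  almost everywhere: the factor \<open>\<Lambda>' (f k)\<close> is bounded and converges pointwise, so that
  \<open>\<Lambda>' (f k) *\<^sub>R G\<close> converges by dominated convergence, while \<open>\<Lambda>' (f k) *\<^sub>R (grad (f k) - G)\<close> tends to 0.
\<close>

lemma H1_with_trace_compose:
  assumes u: "H1_with_trace \<Omega> u G g" and \<Lambda>: "\<And>t. (\<Lambda> has_real_derivative \<Lambda>' t) (at t)" "continuous_on UNIV \<Lambda>'"
    and K: "\<And>t. \<bar>\<Lambda>' t\<bar> \<le> K"
  shows "H1_with_trace \<Omega> (\<lambda>x. \<Lambda> (u x)) (\<lambda>x. \<Lambda>' (u x) *\<^sub>R G x) (\<lambda>x. \<Lambda> (g x))"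
proof -
  have K0: "0 \<le> K" using K[of 0] by linarith
  have lip\<Lambda>: "\<bar>\<Lambda> s - \<Lambda> t\<bar> \<le> K * \<bar>s - t\<bar>" for s t
    using field_differentiable_bound[of UNIV \<Lambda> \<Lambda>' K s t] \<Lambda>(1) K by simp
  have grow: "\<bar>\<Lambda> t\<bar> \<le> \<bar>\<Lambda> 0\<bar> + K * \<bar>t\<bar>" for t
    using lip\<Lambda>[of t 0] by simp
  have [measurable]: "\<Lambda> \<in> borel_measurable borel" "\<Lambda>' \<in> borel_measurable borel"
    using \<Lambda> by (auto intro!: borel_measurable_continuous_onI DERIV_continuous_on simp: has_field_derivative_at_within)
  have sq: "square_integrable (lebesgue_on \<Omega>) u" "square_integrable (lebesgue_on \<Omega>) G"
      "square_integrable (surface_measure \<Omega>) g"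
    using u by (auto simp: H1_with_trace_def has_trace_def)
  note [measurable] = sq[THEN square_integrableD(1)]
  obtain f where f: "\<And>k. Ck 1 (f k)" and fu: "L2_tendsto (lebesgue_on \<Omega>) f u"
    and fG: "L2_tendsto (lebesgue_on \<Omega>) (\<lambda>k. grad (f k)) G" and fg: "L2_tendsto (surface_measure \<Omega>) f g"
    using u by (auto simp: H1_with_trace_def has_trace_def)
  note [measurable] = Ck_1_measurable[OF f]
  have "\<exists>r. strict_mono r \<and> (AE x in lebesgue_on \<Omega>. (\<lambda>k. f (r k) x) \<longlonglongrightarrow> u x)"
    by (rule L2_tendsto_AE_subseq[OF _ _ fu]) measurable
  then obtain r where r: "strict_mono r" "AE x in lebesgue_on \<Omega>. (\<lambda>k. f (r k) x) \<longlonglongrightarrow> u x"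
    by blast
  have "L2_tendsto (lebesgue_on \<Omega>) (\<lambda>k x. \<Lambda> (f (r k) x)) (\<lambda>x. \<Lambda> (u x))"
    by (rule L2_tendsto_bound[OF L2_tendsto_subseq[OF fu r(1)]]) (use lip\<Lambda> in auto)
  moreover have "L2_tendsto (surface_measure \<Omega>) (\<lambda>k x. \<Lambda> (f (r k) x)) (\<lambda>x. \<Lambda> (g x))"
    by (rule L2_tendsto_bound[OF L2_tendsto_subseq[OF fg r(1)]]) (use lip\<Lambda> in auto)
  moreover have "L2_tendsto (lebesgue_on \<Omega>) (\<lambda>k. grad (\<lambda>x. \<Lambda> (f (r k) x))) (\<lambda>x. \<Lambda>' (u x) *\<^sub>R G x)"
  proof -
    have A: "L2_tendsto (lebesgue_on \<Omega>) (\<lambda>k x. \<Lambda>' (f (r k) x) *\<^sub>R (grad (f (r k)) x - G x)) (\<lambda>x. 0)"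
      by (rule L2_tendsto_bound[OF L2_tendsto_subseq[OF fG r(1)], of _ _ K])
        (use K in \<open>auto intro!: mult_right_mono\<close>)
    have B: "L2_tendsto (lebesgue_on \<Omega>) (\<lambda>k x. \<Lambda>' (f (r k) x) *\<^sub>R G x) (\<lambda>x. \<Lambda>' (u x) *\<^sub>R G x)"
    proof (rule L2_tendsto_dominated[where w="\<lambda>x. (2 * K) *\<^sub>R G x"])
      show "AE x in lebesgue_on \<Omega>. (\<lambda>k. \<Lambda>' (f (r k) x) *\<^sub>R G x) \<longlonglongrightarrow> \<Lambda>' (u x) *\<^sub>R G x"
        using r(2)
      proof eventually_elim
        case (elim x)
        have "isCont \<Lambda>' (u x)" using \<Lambda>(2) by (simp add: continuous_on_eq_continuous_at)
        then show ?case by (intro tendsto_intros isCont_tendsto_compose[OF _ elim])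
      qed
      show "square_integrable (lebesgue_on \<Omega>) (\<lambda>x. (2 * K) *\<^sub>R G x)"
        by (rule square_integrableI_bound[OF interior.finite_measure_axioms _ sq(2), of _ 0 "2 * K"]) (use K0 in auto)
      fix k x
      have "\<bar>\<Lambda>' (f (r k) x) - \<Lambda>' (u x)\<bar> \<le> 2 * K" using K[of "f (r k) x"] K[of "u x"] by linarith
      then show "norm (\<Lambda>' (f (r k) x) *\<^sub>R G x - \<Lambda>' (u x) *\<^sub>R G x) \<le> norm ((2 * K) *\<^sub>R G x)"
        using K0 by (simp flip: scaleR_diff_left add: mult_right_mono)
    qed measurable
    have "L2_tendsto (lebesgue_on \<Omega>) (\<lambda>k x. \<Lambda>' (f (r k) x) *\<^sub>R (grad (f (r k)) x - G x) + \<Lambda>' (f (r k) x) *\<^sub>R G x)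
        (\<lambda>x. 0 + \<Lambda>' (u x) *\<^sub>R G x)"
      by (rule L2_tendsto_add[OF A B]) measurable
    moreover have "grad (\<lambda>x. \<Lambda> (f (r k) x)) = (\<lambda>x. \<Lambda>' (f (r k) x) *\<^sub>R (grad (f (r k)) x - G x) + \<Lambda>' (f (r k) x) *\<^sub>R G x)" for k
      by (rule ext) (simp add: Ck_1_compose(2)[OF f \<Lambda>] algebra_simps)
    ultimately show ?thesis by simp
  qed
  moreover have "Ck 1 (\<lambda>x. \<Lambda> (f (r k) x))" for k by (rule Ck_1_compose(1)[OF f \<Lambda>])
  moreover have "square_integrable (lebesgue_on \<Omega>) (\<lambda>x. \<Lambda> (u x))"
    by (rule square_integrableI_bound[OF interior.finite_measure_axioms _ sq(1)]) (use grow in auto)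
  moreover have "square_integrable (surface_measure \<Omega>) (\<lambda>x. \<Lambda> (g x))"
    by (rule square_integrableI_bound[OF boundary.finite_measure_axioms _ sq(3)]) (use grow in auto)
  moreover have "square_integrable (lebesgue_on \<Omega>) (\<lambda>x. \<Lambda>' (u x) *\<^sub>R G x)"
    by (rule square_integrableI_bound[OF interior.finite_measure_axioms _ sq(2), of _ 0 K])
      (use K in \<open>auto intro!: mult_right_mono\<close>)
  ultimately show ?thesis
    unfolding H1_with_trace_def has_trace_def
    by (intro conjI exI[of _ "\<lambda>k x. \<Lambda> (f (r k) x)"] allI)
qed

lemma H1_with_trace_mult:
  assumes u: "H1_with_trace \<Omega> u G g" and \<psi>: "Ck 1 \<psi>"
  shows "H1_with_trace \<Omega> (\<lambda>x. \<psi> x * u x) (\<lambda>x. u x *\<^sub>R grad \<psi> x + \<psi> x *\<^sub>R G x) (\<lambda>x. \<psi> x * g x)"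
proof -
  have sq: "square_integrable (lebesgue_on \<Omega>) u" "square_integrable (lebesgue_on \<Omega>) G"
      "square_integrable (surface_measure \<Omega>) g"
    using u by (auto simp: H1_with_trace_def has_trace_def)
  note [measurable] = sq[THEN square_integrableD(1)]
  obtain f where f: "\<And>k. Ck 1 (f k)" and fu: "L2_tendsto (lebesgue_on \<Omega>) f u"
    and fG: "L2_tendsto (lebesgue_on \<Omega>) (\<lambda>k. grad (f k)) G" and fg: "L2_tendsto (surface_measure \<Omega>) f g"
    using u by (auto simp: H1_with_trace_def has_trace_def)
  note [measurable] = Ck_1_measurable[OF f] Ck_1_measurable[OF \<psi>]
  obtain B1 where B1: "\<And>x. x \<in> \<Omega> \<Longrightarrow> norm (\<psi> x) \<le> B1" "\<And>x. x \<in> frontier \<Omega> \<Longrightarrow> norm (\<psi> x) \<le> B1"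
    using bounded_on_domain[OF Ck_1_continuous_on[OF \<psi>]] by metis
  obtain B2 where B2: "\<And>x. x \<in> \<Omega> \<Longrightarrow> norm (grad \<psi> x) \<le> B2"
    using bounded_on_domain[OF Ck_1_continuous_on_grad[OF \<psi>]] by metis
  have Bi: "\<bar>\<psi> x\<bar> \<le> B1" "norm (grad \<psi> x) \<le> B2" if "x \<in> \<Omega>" for x
    using B1 B2 that by auto
  have Bb: "\<bar>\<psi> x\<bar> \<le> B1" if "x \<in> frontier \<Omega>" for x
    using B1 that by auto
  have 1: "L2_tendsto (lebesgue_on \<Omega>) (\<lambda>k x. \<psi> x * f k x) (\<lambda>x. \<psi> x * u x)"
    by (rule L2_tendsto_bound[OF fu, of _ _ B1])
      (use Bi in \<open>auto simp: abs_mult simp flip: right_diff_distrib intro!: mult_right_mono\<close>)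
  have 2: "L2_tendsto (surface_measure \<Omega>) (\<lambda>k x. \<psi> x * f k x) (\<lambda>x. \<psi> x * g x)"
    by (rule L2_tendsto_bound[OF fg, of _ _ B1])
      (use Bb in \<open>auto simp: abs_mult simp flip: right_diff_distrib intro!: mult_right_mono\<close>)
  have 3: "L2_tendsto (lebesgue_on \<Omega>) (\<lambda>k x. f k x *\<^sub>R grad \<psi> x) (\<lambda>x. u x *\<^sub>R grad \<psi> x)"
    by (rule L2_tendsto_bound[OF fu, of _ _ B2])
      (use Bi in \<open>auto simp: mult.commute[of _ "norm (grad \<psi> _)"] simp flip: scaleR_diff_left intro!: mult_right_mono\<close>)
  have 4: "L2_tendsto (lebesgue_on \<Omega>) (\<lambda>k x. \<psi> x *\<^sub>R grad (f k) x) (\<lambda>x. \<psi> x *\<^sub>R G x)"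
    by (rule L2_tendsto_bound[OF fG, of _ _ B1])
      (use Bi in \<open>auto simp flip: scaleR_diff_right intro!: mult_right_mono\<close>)
  have 5: "L2_tendsto (lebesgue_on \<Omega>) (\<lambda>k. grad (\<lambda>x. \<psi> x * f k x)) (\<lambda>x. u x *\<^sub>R grad \<psi> x + \<psi> x *\<^sub>R G x)"
  proof -
    have "grad (\<lambda>x. \<psi> x * f k x) = (\<lambda>x. f k x *\<^sub>R grad \<psi> x + \<psi> x *\<^sub>R grad (f k) x)" for k
      by (rule ext) (rule Ck_1_mult(2)[OF \<psi> f])
    moreover have "L2_tendsto (lebesgue_on \<Omega>) (\<lambda>k x. f k x *\<^sub>R grad \<psi> x + \<psi> x *\<^sub>R grad (f k) x)
        (\<lambda>x. u x *\<^sub>R grad \<psi> x + \<psi> x *\<^sub>R G x)"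
      by (rule L2_tendsto_add[OF 3 4]) measurable
    ultimately show ?thesis by simp
  qed
  have 6: "square_integrable (lebesgue_on \<Omega>) (\<lambda>x. \<psi> x * u x)"
    by (rule square_integrableI_bound[OF interior.finite_measure_axioms _ sq(1), of _ 0 B1])
      (use Bi in \<open>auto simp: abs_mult intro!: mult_right_mono\<close>)
  have 7: "square_integrable (surface_measure \<Omega>) (\<lambda>x. \<psi> x * g x)"
    by (rule square_integrableI_bound[OF boundary.finite_measure_axioms _ sq(3), of _ 0 B1])
      (use Bb in \<open>auto simp: abs_mult intro!: mult_right_mono\<close>)
  have 8: "square_integrable (lebesgue_on \<Omega>) (\<lambda>x. u x *\<^sub>R grad \<psi> x + \<psi> x *\<^sub>R G x)"
  proof (rule square_integrableI)
    have 9: "square_integrable (lebesgue_on \<Omega>) (\<lambda>x. u x *\<^sub>R grad \<psi> x)"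
      by (rule square_integrableI_bound[OF interior.finite_measure_axioms _ sq(1), of _ 0 B2])
        (use Bi in \<open>auto simp: mult.commute[of _ "norm (grad \<psi> _)"] intro!: mult_right_mono\<close>)
    have 10: "square_integrable (lebesgue_on \<Omega>) (\<lambda>x. \<psi> x *\<^sub>R G x)"
      by (rule square_integrableI_bound[OF interior.finite_measure_axioms _ sq(2), of _ 0 B1])
        (use Bi in \<open>auto intro!: mult_right_mono\<close>)
    have "(\<integral>\<^sup>+x. ennreal ((norm (u x *\<^sub>R grad \<psi> x + \<psi> x *\<^sub>R G x))\<^sup>2) \<partial>lebesgue_on \<Omega>)
        \<le> 2 * (\<integral>\<^sup>+x. ennreal ((norm (u x *\<^sub>R grad \<psi> x))\<^sup>2) \<partial>lebesgue_on \<Omega>)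
          + 2 * (\<integral>\<^sup>+x. ennreal ((norm (\<psi> x *\<^sub>R G x))\<^sup>2) \<partial>lebesgue_on \<Omega>)"
      by (rule nn_integral_norm_add_power2_le) measurable
    also have "\<dots> < \<infinity>"
      using square_integrableD(2)[OF 9] square_integrableD(2)[OF 10] by (simp add: ennreal_mult_less_top)
    finally show "(\<integral>\<^sup>+x. ennreal ((norm (u x *\<^sub>R grad \<psi> x + \<psi> x *\<^sub>R G x))\<^sup>2) \<partial>lebesgue_on \<Omega>) < \<infinity>" .
  qed measurable
  show ?thesis
    unfolding H1_with_trace_def has_trace_def
    by (intro conjI exI[of _ "\<lambda>k x. \<psi> x * f k x"] allI Ck_1_mult(1)[OF \<psi> f] 1 2 5 6 7 8)
qed

end

section \<open>Integrals along line segments\<close>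

text \<open>
  The Cauchy-Schwarz inequality for the increment of \<open>\<phi>\<close> along a segment of length \<open>a\<close>. It is obtained
  by integrating \<open>f\<^sup>2 \<ge> 2 m f - m\<^sup>2\<close>, where \<open>f\<close> is the derivative along the segment and \<open>m\<close> its mean
  value. The end point of the segment is left out since it will lie on the boundary of the domain.
\<close>

lemma C1_increment_square_le:
  fixes \<phi> :: "'a::euclidean_space \<Rightarrow> real"
  assumes \<phi>: "Ck 1 \<phi>" and a: "0 \<le> a" and n: "norm n \<le> 1"
  shows "ennreal ((\<phi> (x + a *\<^sub>R n) - \<phi> x)\<^sup>2)
    \<le> ennreal a * (\<integral>\<^sup>+t. indicator {0..<a} t * ennreal ((norm (grad \<phi> (x + t *\<^sub>R n)))\<^sup>2) \<partial>lborel)"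
proof (cases "a = 0")
  case False
  then have a: "0 < a" using assms by simp
  define F where "F t = \<phi> (x + t *\<^sub>R n)" for t
  define f where "f t = grad \<phi> (x + t *\<^sub>R n) \<bullet> n" for t
  define m where "m = (F a - F 0) / a"
  have F: "(F has_real_derivative f t) (at t within S)" for t S
  proof -
    have "(F has_derivative (\<lambda>h. grad \<phi> (x + t *\<^sub>R n) \<bullet> (h *\<^sub>R n))) (at t)"
      unfolding F_def
      by (rule has_derivative_compose[OF _ Ck_1_has_derivative[OF \<phi>], of "\<lambda>t. x + t *\<^sub>R n"])
        (auto intro!: derivative_eq_intros)
    then show ?thesis
      unfolding has_field_derivative_def f_def
      by (rule has_derivative_at_withinI[THEN has_derivative_eq_rhs]) auto
  qed
  have f: "continuous_on S f" for S
    unfolding f_def by (intro continuous_intros continuous_on_compose2[OF Ck_1_continuous_on_grad[OF \<phi>, of UNIV]]) auto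
  have bi: "has_bochner_integral lborel (\<lambda>t. indicat_real {0..a} t *\<^sub>R (2 * m * f t - m\<^sup>2)) ((2 * m * F a - m\<^sup>2 * a) - (2 * m * F 0 - m\<^sup>2 * 0))"
  proof (rule has_bochner_integral_FTC_Icc)
    fix t
    have "((\<lambda>t. 2 * m * F t - m\<^sup>2 * t) has_real_derivative (2 * m * f t - m\<^sup>2)) (at t within {0..a})"
      by (rule derivative_eq_intros F refl | simp)+
    then show "((\<lambda>t. 2 * m * F t - m\<^sup>2 * t) has_vector_derivative (2 * m * f t - m\<^sup>2)) (at t within {0..a})"
      by (simp add: has_real_derivative_iff_has_vector_derivative)
  qed (use a in \<open>auto intro!: continuous_intros f\<close>)
  have val: "(2 * m * F a - m\<^sup>2 * a) - (2 * m * F 0 - m\<^sup>2 * 0) = (F a - F 0)\<^sup>2 / a"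
    using a by (simp add: m_def power2_eq_square field_simps)
  have iq: "integrable lborel (\<lambda>t. indicat_real {0..a} t *\<^sub>R (f t)\<^sup>2)"
    by (intro borel_integrable_compact continuous_intros f) auto
  have "(F a - F 0)\<^sup>2 / a \<le> (LINT t|lborel. indicat_real {0..a} t *\<^sub>R (f t)\<^sup>2)"
    unfolding val[symmetric] has_bochner_integral_integral_eq[OF bi, symmetric]
  proof (rule integral_mono)
    show "integrable lborel (\<lambda>t. indicat_real {0..a} t *\<^sub>R (2 * m * f t - m\<^sup>2))"
      using bi by (rule integrable.intros)
    fix t
    have "2 * m * f t - m\<^sup>2 \<le> (f t)\<^sup>2"
      using zero_le_power2[of "f t - m"] by (simp add: power2_eq_square algebra_simps)
    then show "indicat_real {0..a} t *\<^sub>R (2 * m * f t - m\<^sup>2) \<le> indicat_real {0..a} t *\<^sub>R (f t)\<^sup>2"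
      by (simp add: indicator_def)
  qed (rule iq)
  then have "(F a - F 0)\<^sup>2 \<le> a * (LINT t|lborel. indicat_real {0..a} t *\<^sub>R (f t)\<^sup>2)"
    using a by (simp add: field_simps)
  then have "ennreal ((F a - F 0)\<^sup>2) \<le> ennreal (a * (LINT t|lborel. indicat_real {0..a} t *\<^sub>R (f t)\<^sup>2))"
    by (rule ennreal_leI)
  also have "\<dots> = ennreal a * ennreal (LINT t|lborel. indicat_real {0..a} t *\<^sub>R (f t)\<^sup>2)"
    using a by (intro ennreal_mult Bochner_Integration.integral_nonneg) auto
  also have "ennreal (LINT t|lborel. indicat_real {0..a} t *\<^sub>R (f t)\<^sup>2)
      = (\<integral>\<^sup>+t. ennreal (indicat_real {0..a} t *\<^sub>R (f t)\<^sup>2) \<partial>lborel)"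
    by (rule nn_integral_eq_integral[OF iq, symmetric]) auto
  also have "\<dots> \<le> (\<integral>\<^sup>+t. indicator {0..<a} t * ennreal ((norm (grad \<phi> (x + t *\<^sub>R n)))\<^sup>2) \<partial>lborel)"
  proof (rule nn_integral_mono_AE)
    have "(f t)\<^sup>2 \<le> (norm (grad \<phi> (x + t *\<^sub>R n)))\<^sup>2" for t
    proof -
      have "\<bar>f t\<bar> \<le> norm (grad \<phi> (x + t *\<^sub>R n)) * norm n" unfolding f_def by (rule Cauchy_Schwarz_ineq2)
      also have "\<dots> \<le> norm (grad \<phi> (x + t *\<^sub>R n)) * 1" using n by (intro mult_left_mono) auto
      finally show ?thesis by (simp add: power2_le_iff_abs_le)
    qed
    moreover have "AE t in lborel. t \<noteq> a" by (rule AE_lborel_singleton)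
    ultimately show "AE t in lborel. ennreal (indicat_real {0..a} t *\<^sub>R (f t)\<^sup>2)
        \<le> indicator {0..<a} t * ennreal ((norm (grad \<phi> (x + t *\<^sub>R n)))\<^sup>2)"
      by (auto elim!: eventually_mono simp: indicator_def intro: ennreal_leI)
  qed
  finally show ?thesis by (simp add: F_def mult_left_mono)
qed simp

lemma nn_integral_lborel_shift:
  fixes f :: "'a::euclidean_space \<Rightarrow> ennreal"
  assumes "f \<in> borel_measurable borel"
  shows "(\<integral>\<^sup>+x. f (x + c) \<partial>lborel) = (\<integral>\<^sup>+x. f x \<partial>lborel)"
proof -
  have "(\<integral>\<^sup>+x. f x \<partial>lborel) = (\<integral>\<^sup>+x. f x \<partial>distr lborel borel ((+) c))" by (simp add: lborel_distr_plus)
  also have "\<dots> = (\<integral>\<^sup>+x. f (c + x) \<partial>lborel)" using assms by (intro nn_integral_distr) auto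
  finally show ?thesis by (simp add: add.commute)
qed

text \<open>
  By Tonelli's theorem the segments may be summed up in the other order; for each fixed \<open>t\<close> the points
  \<open>x + t *\<^sub>R n\<close> fill a translate of a part of \<open>D\<close>, whose measure is unchanged.
\<close>

lemma nn_integral_C1_increment_le:
  fixes \<phi> :: "'a::euclidean_space \<Rightarrow> real"
  assumes \<phi>: "Ck 1 \<phi>" and n: "norm n \<le> 1" and [measurable]: "A \<in> sets borel" "D \<in> sets borel"
    and T: "\<And>x. x \<in> A \<Longrightarrow> 0 \<le> T x \<and> T x \<le> S"
    and D: "\<And>x t. x \<in> A \<Longrightarrow> 0 \<le> t \<Longrightarrow> t < T x \<Longrightarrow> x + t *\<^sub>R n \<in> D"
  shows "(\<integral>\<^sup>+x. indicator A x * ennreal ((\<phi> (x + T x *\<^sub>R n) - \<phi> x)\<^sup>2) \<partial>lborel)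
    \<le> ennreal (S\<^sup>2) * (\<integral>\<^sup>+x. indicator D x * ennreal ((norm (grad \<phi> x))\<^sup>2) \<partial>lborel)"
proof (cases "A = {}")
  case False
  then have S: "0 \<le> S" using T by fastforce
  have [measurable]: "grad \<phi> \<in> borel_measurable borel"
    by (intro borel_measurable_continuous_onI Ck_1_continuous_on_grad \<phi>)
  define w where "w y = indicator D y * ennreal ((norm (grad \<phi> y))\<^sup>2)" for y
  have [measurable]: "w \<in> borel_measurable borel" unfolding w_def by measurable
  have "indicator A x * ennreal ((\<phi> (x + T x *\<^sub>R n) - \<phi> x)\<^sup>2)
      \<le> ennreal S * (\<integral>\<^sup>+t. indicator {0..S} t * w (x + t *\<^sub>R n) \<partial>lborel)" for x
  proof (cases "x \<in> A")
    case True
    have "ennreal ((\<phi> (x + T x *\<^sub>R n) - \<phi> x)\<^sup>2)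
        \<le> ennreal (T x) * (\<integral>\<^sup>+t. indicator {0..<T x} t * ennreal ((norm (grad \<phi> (x + t *\<^sub>R n)))\<^sup>2) \<partial>lborel)"
      by (rule C1_increment_square_le[OF \<phi> _ n]) (use T True in auto)
    also have "\<dots> \<le> ennreal S * (\<integral>\<^sup>+t. indicator {0..S} t * w (x + t *\<^sub>R n) \<partial>lborel)"
    proof (rule mult_mono)
      show "(\<integral>\<^sup>+t. indicator {0..<T x} t * ennreal ((norm (grad \<phi> (x + t *\<^sub>R n)))\<^sup>2) \<partial>lborel)
          \<le> (\<integral>\<^sup>+t. indicator {0..S} t * w (x + t *\<^sub>R n) \<partial>lborel)"
      proof (rule nn_integral_mono)
        fix t
        show "indicator {0..<T x} t * ennreal ((norm (grad \<phi> (x + t *\<^sub>R n)))\<^sup>2) \<le> indicator {0..S} t * w (x + t *\<^sub>R n)"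
        proof (cases "t \<in> {0..<T x}")
          case True
          then have "x + t *\<^sub>R n \<in> D" "t \<in> {0..S}" using T[OF \<open>x \<in> A\<close>] D[OF \<open>x \<in> A\<close>] by auto
          then show ?thesis by (simp add: w_def indicator_def)
        qed simp
      qed
    qed (use T[OF True] in \<open>auto intro: ennreal_leI\<close>)
    finally show ?thesis using True by simp
  qed simp
  then have "(\<integral>\<^sup>+x. indicator A x * ennreal ((\<phi> (x + T x *\<^sub>R n) - \<phi> x)\<^sup>2) \<partial>lborel)
      \<le> (\<integral>\<^sup>+x. ennreal S * (\<integral>\<^sup>+t. indicator {0..S} t * w (x + t *\<^sub>R n) \<partial>lborel) \<partial>lborel)"
    by (intro nn_integral_mono)
  also have "\<dots> = ennreal S * (\<integral>\<^sup>+x. (\<integral>\<^sup>+t. indicator {0..S} t * w (x + t *\<^sub>R n) \<partial>lborel) \<partial>lborel)"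
    by (rule nn_integral_cmult) measurable
  also have "(\<integral>\<^sup>+x. (\<integral>\<^sup>+t. indicator {0..S} t * w (x + t *\<^sub>R n) \<partial>lborel) \<partial>lborel)
      = (\<integral>\<^sup>+t. (\<integral>\<^sup>+x. indicator {0..S} t * w (x + t *\<^sub>R n) \<partial>lborel) \<partial>lborel)"
    by (rule lborel_pair.Fubini'[symmetric]) measurable
  also have "\<dots> = (\<integral>\<^sup>+t. indicator {0..S} t * (\<integral>\<^sup>+x. w x \<partial>lborel) \<partial>lborel)"
    by (simp add: nn_integral_cmult nn_integral_lborel_shift)
  also have "\<dots> = (\<integral>\<^sup>+t. indicator {0..S} t \<partial>lborel) * (\<integral>\<^sup>+x. w x \<partial>lborel)"
    by (rule nn_integral_multc) simp
  also have "(\<integral>\<^sup>+t. indicator {0..S} t \<partial>lborel) = ennreal S"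
    using S by simp
  also have "ennreal S * (ennreal S * (\<integral>\<^sup>+x. w x \<partial>lborel)) = ennreal (S\<^sup>2) * (\<integral>\<^sup>+x. w x \<partial>lborel)"
    using S by (simp add: power2_eq_square ennreal_mult mult_ac)
  finally show ?thesis by (simp add: w_def)
qed simp

context lipschitz_domain
begin

lemma nn_integral_interior_indicator:
  assumes "A \<subseteq> \<Omega>"
  shows "(\<integral>\<^sup>+x. indicator A x * f x \<partial>lebesgue_on \<Omega>) = (\<integral>\<^sup>+x. indicator A x * f x \<partial>lborel)"
proof -
  have "(\<integral>\<^sup>+x. indicator A x * f x \<partial>lebesgue_on \<Omega>) = (\<integral>\<^sup>+x. indicator A x * f x * indicator \<Omega> x \<partial>lebesgue)"
    by (rule nn_integral_restrict_space) simp
  also have "\<dots> = (\<integral>\<^sup>+x. indicator A x * f x \<partial>lebesgue)"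
    using assms by (intro nn_integral_cong) (auto simp: indicator_def)
  finally show ?thesis by (simp add: nn_integral_completion)
qed

text \<open>
  The increment estimate for \<open>C\<^sup>1\<close> functions, passed to the limit. The end points
  \<open>x + T x *\<^sub>R n\<close> may lie on the boundary, where the approximating functions converge to some \<open>v\<close> in
  the sense of the assumption on \<open>f k\<close> and \<open>v\<close>. The increment is split at the approximating
  function, so that only the middle term has a nonzero limit.
\<close>

lemma H1_increment_estimate:
  assumes f: "\<And>k. Ck 1 (f k)" and fw: "L2_tendsto (lebesgue_on \<Omega>) f w"
    and fW: "L2_tendsto (lebesgue_on \<Omega>) (\<lambda>k. grad (f k)) W"
    and [measurable]: "w \<in> borel_measurable (lebesgue_on \<Omega>)" "W \<in> borel_measurable (lebesgue_on \<Omega>)"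
      "v \<in> borel_measurable borel" "T \<in> borel_measurable borel" "A \<in> sets borel" "D \<in> sets borel"
    and fv: "(\<lambda>k. \<integral>\<^sup>+x. indicator A x * ennreal ((v (x + T x *\<^sub>R n) - f k (x + T x *\<^sub>R n))\<^sup>2) \<partial>lborel) \<longlonglongrightarrow> 0"
    and n: "norm n \<le> 1" and T: "\<And>x. x \<in> A \<Longrightarrow> 0 \<le> T x \<and> T x \<le> S" and sub: "A \<subseteq> \<Omega>" "D \<subseteq> \<Omega>"
    and D: "\<And>x t. x \<in> A \<Longrightarrow> 0 \<le> t \<Longrightarrow> t < T x \<Longrightarrow> x + t *\<^sub>R n \<in> D"
  shows "(\<integral>\<^sup>+x. indicator A x * ennreal ((v (x + T x *\<^sub>R n) - w x)\<^sup>2) \<partial>lebesgue_on \<Omega>)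
    \<le> ennreal (8 * S\<^sup>2) * (\<integral>\<^sup>+x. indicator D x * ennreal ((norm (W x))\<^sup>2) \<partial>lebesgue_on \<Omega>)"
proof -
  define \<Phi> where "\<Phi> x = x + T x *\<^sub>R n" for x
  note [measurable] = Ck_1_measurable[OF f]
  have [measurable]: "f k \<in> borel_measurable borel" for k
    by (intro borel_measurable_continuous_onI Ck_1_continuous_on f)
  have [measurable]: "indicat_real A \<in> borel_measurable (lebesgue_on \<Omega>)" "indicat_real D \<in> borel_measurable (lebesgue_on \<Omega>)"
    by (rule borel_measurable_interior; measurable)+
  have [measurable]: "(\<lambda>x. v (\<Phi> x)) \<in> borel_measurable (lebesgue_on \<Omega>)" "(\<lambda>x. f k (\<Phi> x)) \<in> borel_measurable (lebesgue_on \<Omega>)" for k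
    unfolding \<Phi>_def by (rule borel_measurable_interior; measurable)+
  have sq_ind: "ennreal ((norm (indicat_real S x *\<^sub>R y))\<^sup>2) = indicator S x * ennreal ((norm y)\<^sup>2)" for S x and y :: "'c::real_normed_vector"
    by (simp add: indicator_def)
  define a where "a k x = indicat_real A x *\<^sub>R (v (\<Phi> x) - f k (\<Phi> x))" for k x
  define b where "b k x = indicat_real A x *\<^sub>R (f k (\<Phi> x) - f k x)" for k x
  define c where "c k x = indicat_real A x *\<^sub>R (f k x - w x)" for k x
  have [measurable]: "a k \<in> borel_measurable (lebesgue_on \<Omega>)" "b k \<in> borel_measurable (lebesgue_on \<Omega>)"
      "c k \<in> borel_measurable (lebesgue_on \<Omega>)" for k
    unfolding a_def b_def c_def by measurable
  let ?I = "\<lambda>h::'a \<Rightarrow> real. \<integral>\<^sup>+x. ennreal ((norm (h x))\<^sup>2) \<partial>lebesgue_on \<Omega>"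
  let ?L = "\<integral>\<^sup>+x. indicator A x * ennreal ((v (\<Phi> x) - w x)\<^sup>2) \<partial>lebesgue_on \<Omega>"
  let ?J = "\<integral>\<^sup>+x. indicator D x * ennreal ((norm (W x))\<^sup>2) \<partial>lebesgue_on \<Omega>"
  have split: "?L \<le> 2 * ?I (a k) + 2 * (2 * ?I (b k) + 2 * ?I (c k))" for k
  proof -
    have "?L = ?I (\<lambda>x. a k x + (b k x + c k x))"
      by (intro nn_integral_cong) (auto simp: a_def b_def c_def indicator_def)
    also have "\<dots> \<le> 2 * ?I (a k) + 2 * ?I (\<lambda>x. b k x + c k x)"
      by (rule nn_integral_norm_add_power2_le) measurable
    also have "\<dots> \<le> 2 * ?I (a k) + 2 * (2 * ?I (b k) + 2 * ?I (c k))"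
      by (intro add_left_mono mult_left_mono nn_integral_norm_add_power2_le) auto
    finally show ?thesis .
  qed
  have Ia: "?I (a k) = (\<integral>\<^sup>+x. indicator A x * ennreal ((v (\<Phi> x) - f k (\<Phi> x))\<^sup>2) \<partial>lborel)" for k
    unfolding a_def sq_ind by (simp add: nn_integral_interior_indicator[OF sub(1)])
  have Ib: "?I (b k) \<le> ennreal (S\<^sup>2) * (2 * (\<integral>\<^sup>+x. ennreal ((norm (grad (f k) x - W x))\<^sup>2) \<partial>lebesgue_on \<Omega>) + 2 * ?J)" for k
  proof -
    have "?I (b k) = (\<integral>\<^sup>+x. indicator A x * ennreal ((f k (x + T x *\<^sub>R n) - f k x)\<^sup>2) \<partial>lborel)"
      unfolding b_def sq_ind \<Phi>_def by (simp add: nn_integral_interior_indicator[OF sub(1)])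
    also have "\<dots> \<le> ennreal (S\<^sup>2) * (\<integral>\<^sup>+x. indicator D x * ennreal ((norm (grad (f k) x))\<^sup>2) \<partial>lborel)"
      by (rule nn_integral_C1_increment_le[OF f n _ _ T D]) auto
    also have "(\<integral>\<^sup>+x. indicator D x * ennreal ((norm (grad (f k) x))\<^sup>2) \<partial>lborel)
        = (\<integral>\<^sup>+x. ennreal ((norm (indicat_real D x *\<^sub>R (grad (f k) x - W x) + indicat_real D x *\<^sub>R W x))\<^sup>2) \<partial>lebesgue_on \<Omega>)"
      unfolding nn_integral_interior_indicator[OF sub(2), symmetric]
      by (intro nn_integral_cong) (auto simp: indicator_def)
    also have "\<dots> \<le> 2 * (\<integral>\<^sup>+x. ennreal ((norm (indicat_real D x *\<^sub>R (grad (f k) x - W x)))\<^sup>2) \<partial>lebesgue_on \<Omega>)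
        + 2 * (\<integral>\<^sup>+x. ennreal ((norm (indicat_real D x *\<^sub>R W x))\<^sup>2) \<partial>lebesgue_on \<Omega>)"
      by (rule nn_integral_norm_add_power2_le) measurable
    also have "\<dots> \<le> 2 * (\<integral>\<^sup>+x. ennreal ((norm (grad (f k) x - W x))\<^sup>2) \<partial>lebesgue_on \<Omega>) + 2 * ?J"
      unfolding sq_ind by (intro add_mono mult_left_mono nn_integral_mono) (auto simp: indicator_def)
    finally show ?thesis by (simp add: mult_left_mono)
  qed
  have Ic: "?I (c k) \<le> (\<integral>\<^sup>+x. ennreal ((norm (f k x - w x))\<^sup>2) \<partial>lebesgue_on \<Omega>)" for k
    unfolding c_def sq_ind by (intro nn_integral_mono) (auto simp: indicator_def)
  define X where "X k = 2 * ?I (a k)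
     + 2 * (2 * (ennreal (S\<^sup>2) * (2 * (\<integral>\<^sup>+x. ennreal ((norm (grad (f k) x - W x))\<^sup>2) \<partial>lebesgue_on \<Omega>) + 2 * ?J))
     + 2 * (\<integral>\<^sup>+x. ennreal ((norm (f k x - w x))\<^sup>2) \<partial>lebesgue_on \<Omega>))" for k
  have "?L \<le> X k" for k
    unfolding X_def
    by (rule order_trans[OF split[of k]]) (intro add_mono mult_left_mono order_refl Ib Ic; simp)
  moreover have "X \<longlonglongrightarrow> 2 * 0 + 2 * (2 * (ennreal (S\<^sup>2) * (2 * 0 + 2 * ?J)) + 2 * 0)"
    unfolding X_def Ia using fw fW fv unfolding L2_tendsto_def \<Phi>_def
    by (intro tendsto_add ennreal_tendsto_cmult tendsto_const) (auto simp: ennreal_mult_less_top)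
  ultimately have "?L \<le> 2 * 0 + 2 * (2 * (ennreal (S\<^sup>2) * (2 * 0 + 2 * ?J)) + 2 * 0)"
    by (intro LIMSEQ_le_const) auto
  also have "\<dots> = ennreal (8 * S\<^sup>2) * ?J"
  proof -
    have "2 * (2 * (c * (2 * J))) = 8 * c * J" for c J :: ennreal
      unfolding mult.left_commute[of c 2] by (simp flip: mult.assoc)
    then show ?thesis by (simp add: ennreal_mult)
  qed
  finally show ?thesis by (simp add: \<Phi>_def)
qed

section \<open>Boundary values along the fibres of a chart\<close>

text \<open>
  A ball at depth about \<open>s\<close> below the boundary point \<open>p\<close>. Its radius is so small compared to the
  Lipschitz constant that the depth varies only between \<open>s / 2\<close> and \<open>3 s / 2\<close>; it is therefore a
  compact subset of the domain from which the fibres reach the boundary within distance \<open>2 s\<close> of \<open>p\<close>.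
\<close>

definition lens :: "'a \<Rightarrow> 'a \<Rightarrow> real \<Rightarrow> real \<Rightarrow> 'a set" where
  "lens p n s M = cball (p - s *\<^sub>R n) (s / (2 * M))"

context
  fixes p R M n \<tau> s
  assumes chart: "boundary_chart \<Omega> p R M n \<tau>" and p: "p \<in> frontier \<Omega>" and s: "0 < s" "2 * s \<le> R"
begin

interpretation depth_function n \<tau> M
  using chart by (simp add: boundary_chart_def)

lemma lens_depth:
  assumes "x \<in> lens p n s M"
  shows "s / 2 \<le> \<tau> x" "\<tau> x \<le> 3 * s / 2"
proof -
  have "\<tau> p = 0" using chart p by (auto simp: boundary_chart_def)
  then have "\<tau> (p - s *\<^sub>R n) = s" by (simp add: depth_shift_minus)
  moreover have "M * dist (p - s *\<^sub>R n) x \<le> s / 2"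
    using assms M_ge_1 by (simp add: lens_def field_simps)
  ultimately show "s / 2 \<le> \<tau> x" "\<tau> x \<le> 3 * s / 2"
    using depth_diff_le[of "p - s *\<^sub>R n" x] by linarith+
qed

lemma lens_fibre_near:
  assumes x: "x \<in> lens p n s M" and t: "0 \<le> t" "t \<le> \<tau> x"
  shows "dist p (x + t *\<^sub>R n) < 2 * s"
proof -
  have "s / (2 * M) \<le> s / 2" using M_ge_1 s by (intro divide_left_mono) auto
  then have 1: "norm (p - s *\<^sub>R n - x) \<le> s / 2" using x by (simp add: lens_def dist_norm)
  have eq: "p - (x + t *\<^sub>R n) = (p - s *\<^sub>R n - x) + (s - t) *\<^sub>R n" by (simp add: algebra_simps)
  have "\<bar>s - t\<bar> \<le> s" using t lens_depth[OF x] s by linarith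
  then show ?thesis
    unfolding dist_norm eq using norm_triangle_ineq[of "p - s *\<^sub>R n - x" "(s - t) *\<^sub>R n"] 1 norm_n s by simp
qed

lemma lens_fibre:
  assumes x: "x \<in> lens p n s M"
  shows "\<And>t. 0 \<le> t \<Longrightarrow> t < \<tau> x \<Longrightarrow> x + t *\<^sub>R n \<in> \<Omega> \<inter> ball p (2 * s)"
    and "foot x \<in> frontier \<Omega> \<inter> ball p (2 * s)" and "x \<in> \<Omega>"
proof -
  have chart': "y \<in> frontier \<Omega> \<longleftrightarrow> \<tau> y = 0" "y \<in> \<Omega> \<longleftrightarrow> 0 < \<tau> y" if "dist p y < 2 * s" for y
    using chart that s by (auto simp: boundary_chart_def)
  show "x + t *\<^sub>R n \<in> \<Omega> \<inter> ball p (2 * s)" if "0 \<le> t" "t < \<tau> x" for t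
    using chart'(2)[OF lens_fibre_near[OF x, of t]] lens_fibre_near[OF x, of t] that by (simp add: depth_shift)
  from this[of 0] show "x \<in> \<Omega>" using lens_depth[OF x] s by simp
  have "0 \<le> \<tau> x" using lens_depth[OF x] s by linarith
  then show "foot x \<in> frontier \<Omega> \<inter> ball p (2 * s)"
    using chart'(1)[OF lens_fibre_near[OF x, of "\<tau> x"]] lens_fibre_near[OF x, of "\<tau> x"]
    by (simp add: foot_def depth_shift)
qed

lemma emeasure_lens_foot_le:
  assumes [measurable]: "E \<in> sets borel"
  shows "emeasure lborel (lens p n s M \<inter> foot -` E) \<le> ennreal (shadow_const DIM('a) * (2 * s)) * emeasure (surface_measure \<Omega>) (E \<inter> frontier \<Omega>)"
proof -
  have [measurable]: "frontier \<Omega> \<in> sets borel" by simp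
  have "lens p n s M \<inter> foot -` E \<subseteq> shadow (2 * s) (E \<inter> frontier \<Omega>)"
    using lens_fibre(2) lens_depth s by (fastforce simp: shadow_def)
  then have "emeasure lborel (lens p n s M \<inter> foot -` E) \<le> emeasure lborel (shadow (2 * s) (E \<inter> frontier \<Omega>))"
    by (intro emeasure_mono) (auto intro!: shadow_measurable)
  also have "\<dots> \<le> ennreal (shadow_const DIM('a) * (2 * s)) * hausdorff_outer_measure (DIM('a) - 1) (E \<inter> frontier \<Omega>)"
    by (rule emeasure_shadow_le_hausdorff[OF dim]) (use s in auto)
  finally show ?thesis by (subst emeasure_surface_measure[OF dim]) auto
qed

text \<open>
  The image of Lebesgue measure on the lens under the projection along the fibres is at most a
  multiple of surface measure.
\<close>

lemma nn_integral_lens_foot_le: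
  assumes [measurable]: "f \<in> borel_measurable borel"
  shows "(\<integral>\<^sup>+x. indicator (lens p n s M) x * f (foot x) \<partial>lborel) \<le> ennreal (shadow_const DIM('a) * (2 * s)) * (\<integral>\<^sup>+y. f y \<partial>surface_measure \<Omega>)"
proof -
  let ?m = "DIM('a) - 1"
  have [measurable]: "lens p n s M \<in> sets borel" by (simp add: lens_def)
  have [measurable]: "frontier \<Omega> \<in> sets borel" by simp
  define \<mu> where "\<mu> = distr (density lborel (indicator (lens p n s M))) borel foot"
  define \<nu> where "\<nu> = scale_measure (ennreal (shadow_const DIM('a) * (2 * s))) (density (hausdorff_measure ?m) (indicator (frontier \<Omega>)))"
  have sets: "sets \<mu> = sets borel" "sets \<nu> = sets borel" by (simp_all add: \<mu>_def \<nu>_def)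
  have "\<mu> \<le> \<nu>"
  proof (subst le_measure)
    show "\<forall>E\<in>sets \<mu>. emeasure \<mu> E \<le> emeasure \<nu> E"
    proof
      fix E assume "E \<in> sets \<mu>"
      then have [measurable]: "E \<in> sets borel" by (simp add: sets)
      have "emeasure \<mu> E = emeasure (density lborel (indicator (lens p n s M))) (foot -` E)"
        unfolding \<mu>_def by (subst emeasure_distr) auto
      also have "\<dots> = emeasure lborel (lens p n s M \<inter> foot -` E)"
        using measurable_sets_borel[OF borel_measurable_foot, of E]
        by (subst emeasure_density) (auto simp flip: indicator_inter_arith simp: nn_integral_indicator)
      also have "\<dots> \<le> ennreal (shadow_const DIM('a) * (2 * s)) * emeasure (surface_measure \<Omega>) (E \<inter> frontier \<Omega>)"
        by (rule emeasure_lens_foot_le) measurable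
      also have "emeasure (surface_measure \<Omega>) (E \<inter> frontier \<Omega>) = emeasure (hausdorff_measure ?m) (frontier \<Omega> \<inter> E)"
        unfolding surface_measure_def by (subst emeasure_restrict_space) (auto simp: Int_commute)
      also have "\<dots> = emeasure (density (hausdorff_measure ?m) (indicator (frontier \<Omega>))) E"
        by (subst emeasure_density) (auto simp flip: indicator_inter_arith simp: nn_integral_indicator)
      finally show "emeasure \<mu> E \<le> emeasure \<nu> E" by (simp add: \<nu>_def)
    qed
  qed (simp add: sets)
  then have "(\<integral>\<^sup>+y. f y \<partial>\<mu>) \<le> (\<integral>\<^sup>+y. f y \<partial>\<nu>)"
    by (intro nn_integral_mono_measure) (simp_all add: sets)
  moreover have "(\<integral>\<^sup>+y. f y \<partial>\<mu>) = (\<integral>\<^sup>+x. indicator (lens p n s M) x * f (foot x) \<partial>lborel)"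
    unfolding \<mu>_def by (simp add: nn_integral_distr nn_integral_density)
  moreover have "(\<integral>\<^sup>+y. f y \<partial>\<nu>) = ennreal (shadow_const DIM('a) * (2 * s)) * (\<integral>\<^sup>+y. f y \<partial>surface_measure \<Omega>)"
    unfolding \<nu>_def surface_measure_def
    by (simp add: nn_integral_scale_measure nn_integral_density nn_integral_restrict_space mult.commute)
  ultimately show ?thesis by simp
qed

text \<open>
  Since surface measure dominates the image of Lebesgue measure on the lens, the approximating
  functions converge along the fibres to the trace at their end points.
\<close>

lemma trace_fibre_estimate:
  assumes w: "H1_with_trace \<Omega> w W \<gamma>"
  shows "(\<integral>\<^sup>+x. indicator (lens p n s M) x * ennreal ((\<gamma> (foot x) - w x)\<^sup>2) \<partial>lebesgue_on \<Omega>)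
    \<le> ennreal (32 * s\<^sup>2) * (\<integral>\<^sup>+x. indicator (ball p (2 * s)) x * ennreal ((norm (W x))\<^sup>2) \<partial>lebesgue_on \<Omega>)"
proof -
  have sq: "square_integrable (lebesgue_on \<Omega>) w" "square_integrable (lebesgue_on \<Omega>) W"
      "square_integrable (surface_measure \<Omega>) \<gamma>"
    using w by (auto simp: H1_with_trace_def has_trace_def)
  obtain f where f: "\<And>k. Ck 1 (f k)" and fw: "L2_tendsto (lebesgue_on \<Omega>) f w"
    and fW: "L2_tendsto (lebesgue_on \<Omega>) (\<lambda>k. grad (f k)) W" and fg: "L2_tendsto (surface_measure \<Omega>) f \<gamma>"
    using w by (auto simp: H1_with_trace_def has_trace_def)
  have [measurable]: "f k \<in> borel_measurable borel" for k
    by (intro borel_measurable_continuous_onI Ck_1_continuous_on f)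
  \<comment> \<open>\<open>\<gamma>\<close> is measurable on the boundary only; extension by 0 makes it Borel measurable on the space\<close>
  define \<gamma>' where "\<gamma>' y = indicat_real (frontier \<Omega>) y * \<gamma> y" for y
  have m\<gamma>' [measurable]: "\<gamma>' \<in> borel_measurable borel"
  proof -
    have "\<gamma> \<in> borel_measurable (restrict_space borel (frontier \<Omega>))"
      using sq(3) by (simp add: square_integrable_def cong: measurable_cong_sets[OF sets_surface_measure refl])
    then show ?thesis
      unfolding \<gamma>'_def by (subst (asm) borel_measurable_restrict_space_iff) auto
  qed
  have conv: "(\<lambda>k. \<integral>\<^sup>+x. indicator (lens p n s M) x * ennreal ((\<gamma>' (x + \<tau> x *\<^sub>R n) - f k (x + \<tau> x *\<^sub>R n))\<^sup>2) \<partial>lborel) \<longlonglongrightarrow> 0"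
  proof (rule tendsto_sandwich[OF _ _ tendsto_const])
    let ?c = "ennreal (shadow_const DIM('a) * (2 * s))"
    show "(\<lambda>k. ?c * (\<integral>\<^sup>+y. ennreal ((norm (f k y - \<gamma> y))\<^sup>2) \<partial>surface_measure \<Omega>)) \<longlonglongrightarrow> 0"
      using ennreal_tendsto_cmult[OF _ fg[unfolded L2_tendsto_def], of ?c] by simp
    show "\<forall>\<^sub>F k in sequentially. (\<integral>\<^sup>+x. indicator (lens p n s M) x * ennreal ((\<gamma>' (x + \<tau> x *\<^sub>R n) - f k (x + \<tau> x *\<^sub>R n))\<^sup>2) \<partial>lborel)
        \<le> ?c * (\<integral>\<^sup>+y. ennreal ((norm (f k y - \<gamma> y))\<^sup>2) \<partial>surface_measure \<Omega>)"
    proof (rule always_eventually, rule allI)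
      fix k
      have "(\<integral>\<^sup>+x. indicator (lens p n s M) x * ennreal ((\<gamma>' (foot x) - f k (foot x))\<^sup>2) \<partial>lborel)
          \<le> ?c * (\<integral>\<^sup>+y. ennreal ((\<gamma>' y - f k y)\<^sup>2) \<partial>surface_measure \<Omega>)"
        by (rule nn_integral_lens_foot_le) measurable
      also have "(\<integral>\<^sup>+y. ennreal ((\<gamma>' y - f k y)\<^sup>2) \<partial>surface_measure \<Omega>) = (\<integral>\<^sup>+y. ennreal ((norm (f k y - \<gamma> y))\<^sup>2) \<partial>surface_measure \<Omega>)"
        by (intro nn_integral_cong) (simp add: \<gamma>'_def power2_commute)
      finally show "(\<integral>\<^sup>+x. indicator (lens p n s M) x * ennreal ((\<gamma>' (x + \<tau> x *\<^sub>R n) - f k (x + \<tau> x *\<^sub>R n))\<^sup>2) \<partial>lborel)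
          \<le> ?c * (\<integral>\<^sup>+y. ennreal ((norm (f k y - \<gamma> y))\<^sup>2) \<partial>surface_measure \<Omega>)"
        by (simp add: foot_def)
    qed
  qed simp
  have "(\<integral>\<^sup>+x. indicator (lens p n s M) x * ennreal ((\<gamma> (foot x) - w x)\<^sup>2) \<partial>lebesgue_on \<Omega>)
      = (\<integral>\<^sup>+x. indicator (lens p n s M) x * ennreal ((\<gamma>' (x + \<tau> x *\<^sub>R n) - w x)\<^sup>2) \<partial>lebesgue_on \<Omega>)"
  proof (rule nn_integral_cong)
    fix x
    show "indicator (lens p n s M) x * ennreal ((\<gamma> (foot x) - w x)\<^sup>2)
        = indicator (lens p n s M) x * ennreal ((\<gamma>' (x + \<tau> x *\<^sub>R n) - w x)\<^sup>2)"
      using lens_fibre(2)[of x] unfolding foot_def[symmetric]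
      by (cases "x \<in> lens p n s M") (auto simp: \<gamma>'_def)
  qed
  also have "\<dots> \<le> ennreal (8 * (2 * s)\<^sup>2) * (\<integral>\<^sup>+x. indicator (\<Omega> \<inter> ball p (2 * s)) x * ennreal ((norm (W x))\<^sup>2) \<partial>lebesgue_on \<Omega>)"
  proof (rule H1_increment_estimate[OF f fw fW sq(1,2)[THEN square_integrableD(1)] m\<gamma>' borel_measurable_depth _ _ conv])
    show "0 \<le> \<tau> x \<and> \<tau> x \<le> 2 * s" if "x \<in> lens p n s M" for x
      using lens_depth[OF that] s by auto
    show "lens p n s M \<subseteq> \<Omega>" using lens_fibre(3) by blast
  qed (use lens_fibre(1) norm_n in \<open>auto simp: lens_def\<close>)
  also have "(\<integral>\<^sup>+x. indicator (\<Omega> \<inter> ball p (2 * s)) x * ennreal ((norm (W x))\<^sup>2) \<partial>lebesgue_on \<Omega>)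
      = (\<integral>\<^sup>+x. indicator (ball p (2 * s)) x * ennreal ((norm (W x))\<^sup>2) \<partial>lebesgue_on \<Omega>)"
    by (intro nn_integral_cong) (auto simp: indicator_def)
  finally show ?thesis by (simp add: power_mult_distrib)
qed

end

text \<open>
  The increment estimate for translations by small vectors \<open>e\<close> shows that \<open>u (x + e) = u x\<close> for almost
  all \<open>x\<close> near a point, hence for all of them by continuity. So \<open>u\<close> is locally constant.
\<close>

lemma constant_if_gradient_0:
  assumes u: "H1_with_trace \<Omega> u G g" and cont: "continuous_on \<Omega> u"
    and G: "AE x in lebesgue_on \<Omega>. G x = 0"
  shows "u constant_on \<Omega>"
proof -
  have sq: "square_integrable (lebesgue_on \<Omega>) u" "square_integrable (lebesgue_on \<Omega>) G"
    using u by (auto simp: H1_with_trace_def)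
  note [measurable] = sq[THEN square_integrableD(1)]
  obtain f where f: "\<And>k. Ck 1 (f k)" and fu: "L2_tendsto (lebesgue_on \<Omega>) f u"
    and fG: "L2_tendsto (lebesgue_on \<Omega>) (\<lambda>k. grad (f k)) G"
    using u by (auto simp: H1_with_trace_def has_trace_def)
  have [measurable]: "f k \<in> borel_measurable borel" for k
    by (intro borel_measurable_continuous_onI Ck_1_continuous_on f)
  define v where "v x = indicat_real \<Omega> x *\<^sub>R u x" for x
  have [measurable]: "v \<in> borel_measurable borel"
    unfolding v_def using cont open_domain by (intro borel_measurable_continuous_on_indicator) auto
  have fv: "(\<lambda>k. \<integral>\<^sup>+x. indicator \<Omega> x * ennreal ((f k x - v x)\<^sup>2) \<partial>lborel) \<longlonglongrightarrow> 0"
  proof -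
    have "(\<integral>\<^sup>+x. indicator \<Omega> x * ennreal ((f k x - v x)\<^sup>2) \<partial>lborel) = (\<integral>\<^sup>+x. ennreal ((norm (f k x - u x))\<^sup>2) \<partial>lebesgue_on \<Omega>)" for k
      unfolding nn_integral_interior_indicator[OF order_refl, symmetric]
      by (intro nn_integral_cong) (auto simp: v_def)
    then show ?thesis using fu by (simp add: L2_tendsto_def)
  qed
  have loc: "\<exists>T. openin (top_of_set \<Omega>) T \<and> a \<in> T \<and> (\<forall>x \<in> T. u x = u a)" if a: "a \<in> \<Omega>" for a
  proof -
    obtain \<rho>0 where \<rho>0: "0 < \<rho>0" "ball a \<rho>0 \<subseteq> \<Omega>" using a open_domain openE by blast
    define \<rho> where "\<rho> = min 1 (\<rho>0 / 2)"
    have \<rho>: "0 < \<rho>" "\<rho> \<le> 1" "ball a (2 * \<rho>) \<subseteq> \<Omega>"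
      using \<rho>0 by (auto simp: \<rho>_def min_def intro: subset_trans[OF subset_ball])
    have "u (a + e) = u a" if e: "norm e < \<rho>" for e
    proof -
      define A where "A = ball a \<rho>"
      have AO: "x + t *\<^sub>R e \<in> \<Omega>" if "x \<in> A" "0 \<le> t" "t \<le> 1" for x t
      proof -
        have "norm (t *\<^sub>R e) \<le> norm e" using that by (simp add: mult_left_le_one_le)
        then have "dist a (x + t *\<^sub>R e) < 2 * \<rho>"
          using that e norm_triangle_ineq4[of "a - x" "t *\<^sub>R e"] by (simp add: A_def dist_norm algebra_simps)
        then show ?thesis using \<rho> by auto
      qed
      have [measurable]: "A \<in> sets borel" by (simp add: A_def)
      have conv: "(\<lambda>k. \<integral>\<^sup>+x. indicator A x * ennreal ((v (x + 1 *\<^sub>R e) - f k (x + 1 *\<^sub>R e))\<^sup>2) \<partial>lborel) \<longlonglongrightarrow> 0"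
      proof (rule tendsto_sandwich[OF _ _ tendsto_const fv])
        have "(\<integral>\<^sup>+x. indicator A x * ennreal ((v (x + 1 *\<^sub>R e) - f k (x + 1 *\<^sub>R e))\<^sup>2) \<partial>lborel)
            \<le> (\<integral>\<^sup>+x. indicator \<Omega> (x + e) * ennreal ((f k (x + e) - v (x + e))\<^sup>2) \<partial>lborel)" for k
          using AO[of _ 1] by (intro nn_integral_mono) (auto simp: indicator_def power2_commute)
        also have "\<dots> k = (\<integral>\<^sup>+x. indicator \<Omega> x * ennreal ((f k x - v x)\<^sup>2) \<partial>lborel)" for k
          by (rule nn_integral_lborel_shift) measurable
        finally show "\<forall>\<^sub>F k in sequentially. (\<integral>\<^sup>+x. indicator A x * ennreal ((v (x + 1 *\<^sub>R e) - f k (x + 1 *\<^sub>R e))\<^sup>2) \<partial>lborel)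
            \<le> (\<integral>\<^sup>+x. indicator \<Omega> x * ennreal ((f k x - v x)\<^sup>2) \<partial>lborel)" by simp
      qed simp
      have "A \<subseteq> \<Omega>" using AO[of _ 0] by auto
      have "(\<integral>\<^sup>+x. indicator A x * ennreal ((v (x + 1 *\<^sub>R e) - u x)\<^sup>2) \<partial>lebesgue_on \<Omega>)
          \<le> ennreal (8 * 1\<^sup>2) * (\<integral>\<^sup>+x. indicator \<Omega> x * ennreal ((norm (G x))\<^sup>2) \<partial>lebesgue_on \<Omega>)"
        by (rule H1_increment_estimate[where T = "\<lambda>_. 1", OF f fu fG _ _ _ _ _ _ conv])
          (use AO e \<rho> \<open>A \<subseteq> \<Omega>\<close> in auto)
      also have "(\<integral>\<^sup>+x. indicator \<Omega> x * ennreal ((norm (G x))\<^sup>2) \<partial>lebesgue_on \<Omega>) = (\<integral>\<^sup>+x. 0 \<partial>lebesgue_on \<Omega>)"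
        by (rule nn_integral_cong_AE) (use G in \<open>auto elim!: eventually_mono\<close>)
      also have "(\<integral>\<^sup>+x. indicator A x * ennreal ((v (x + 1 *\<^sub>R e) - u x)\<^sup>2) \<partial>lebesgue_on \<Omega>)
          = (\<integral>\<^sup>+x. indicator A x * ennreal ((v (x + e) - v x)\<^sup>2) \<partial>lborel)"
        unfolding nn_integral_interior_indicator[OF \<open>A \<subseteq> \<Omega>\<close>]
        using \<open>A \<subseteq> \<Omega>\<close> by (intro nn_integral_cong) (auto simp: v_def indicator_def)
      finally have "(\<integral>\<^sup>+x. indicator A x * ennreal ((v (x + e) - v x)\<^sup>2) \<partial>lborel) = 0" by simp
      then have "AE x in lborel. indicator A x * ennreal ((v (x + e) - v x)\<^sup>2) = 0"
        by (subst (asm) nn_integral_0_iff_AE) auto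
      then have ae: "AE x in lborel. x \<notin> {x \<in> A. u (x + e) \<noteq> u x}"
        by eventually_elim (use AO[of _ 0] AO[of _ 1] in \<open>auto simp: v_def indicator_def\<close>)
      have op: "open {x \<in> A. u (x + e) \<noteq> u x}"
      proof -
        have "continuous_on A (\<lambda>x. u (x + e) - u x)"
          using AO[of _ 0] AO[of _ 1]
          by (intro continuous_intros continuous_on_compose2[OF cont]) auto
        then have "openin (top_of_set A) (A \<inter> (\<lambda>x. u (x + e) - u x) -` (- {0}))"
          by (rule continuous_openin_preimage_gen) auto
        moreover have "A \<inter> (\<lambda>x. u (x + e) - u x) -` (- {0}) = {x \<in> A. u (x + e) \<noteq> u x}" by auto
        ultimately show ?thesis using openin_open_trans[of A] by (simp add: A_def)
      qed
      have "{x \<in> A. u (x + e) \<noteq> u x} \<in> null_sets lborel"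
        using ae op by (subst AE_iff_null_sets) auto
      then have "negligible {x \<in> A. u (x + e) \<noteq> u x}"
        by (simp add: negligible_iff_null_sets null_sets_completionI)
      then have "{x \<in> A. u (x + e) \<noteq> u x} = {}" using op open_not_negligible by blast
      moreover have "a \<in> A" using \<rho> by (simp add: A_def)
      ultimately show ?thesis by blast
    qed
    from this[of "x - a" for x] have const: "u x = u a" if "x \<in> ball a \<rho>" for x
      using that by (simp add: dist_norm norm_minus_commute)
    have "ball a \<rho> \<subseteq> \<Omega>" using \<rho> subset_ball[of \<rho> "2 * \<rho>" a] by auto
    then have "openin (top_of_set \<Omega>) (ball a \<rho>)" by (rule open_subset) simp
    then show ?thesis using const \<rho>(1) centre_in_ball[of a \<rho>] by blast
  qed
  show ?thesis
    using locally_constant_imp_constant[OF connected_domain, of u] loc by (auto simp: constant_on_def)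
qed

end

section \<open>Regularised reciprocal, regularised logarithm and cutoff\<close>

lemma has_real_derivative_pos_part_square:
  "((\<lambda>t::real. (max t 0)\<^sup>2) has_real_derivative 2 * max t 0) (at t)"
proof (rule linorder_cases[of t 0])
  assume t: "t < 0"
  have "((\<lambda>t::real. 0) has_real_derivative 2 * max t 0) (at t)" using t by simp
  then show ?thesis
    by (rule has_field_derivative_transform_within_open[of _ _ _ "{..<0}"]) (use t in auto)
next
  assume t: "t > 0"
  have "((\<lambda>t::real. t\<^sup>2) has_real_derivative 2 * max t 0) (at t)"
    using t by (auto intro!: derivative_eq_intros)
  then show ?thesis
    by (rule has_field_derivative_transform_within_open[of _ _ _ "{0<..}"]) (use t in auto)
next
  assume t: "t = 0"
  have "(\<lambda>h::real. (max h 0)\<^sup>2 / h) \<midarrow>0\<rightarrow> 0"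
  proof (rule Lim_null_comparison)
    have "norm ((max h 0)\<^sup>2 / h) \<le> \<bar>h\<bar>" for h :: real
      by (cases "h \<ge> 0") (auto simp: power2_eq_square max_def)
    then show "\<forall>\<^sub>F h in at 0. norm ((max h 0)\<^sup>2 / h) \<le> \<bar>h :: real\<bar>" by simp
    show "(\<lambda>h::real. \<bar>h\<bar>) \<midarrow>0\<rightarrow> 0" by (rule tendsto_eq_intros refl | simp)+
  qed
  then show ?thesis using t by (simp add: DERIV_def)
qed

text \<open>
  The reciprocal of \<open>e + t\<close> for \<open>t \<ge> 0\<close>, continued to all real \<open>t\<close> as a \<open>C\<^sup>1\<close> function with bounded
  derivative. The quadratic term for \<open>t < 0\<close> has a coefficient so large that the denominator stays
  above \<open>|t| / e\<close> when \<open>e \<le> 1\<close>; hence \<open>t * reg_inverse e t\<close> is at most \<open>e\<close> in absolute value for negative \<open>t\<close>, and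
  negative values of the trace do not matter in the limit \<open>e \<rightarrow> 0\<close>.
\<close>

definition reg_inverse_den :: "real \<Rightarrow> real \<Rightarrow> real" where
  "reg_inverse_den e t = e + t + (max (- t) 0)\<^sup>2 / e ^ 3"

definition reg_inverse :: "real \<Rightarrow> real \<Rightarrow> real" where
  "reg_inverse e t = 1 / reg_inverse_den e t"

definition reg_inverse_deriv :: "real \<Rightarrow> real \<Rightarrow> real" where
  "reg_inverse_deriv e t = - (1 - 2 * max (- t) 0 / e ^ 3) * (reg_inverse e t)\<^sup>2"

lemma reg_inverse_den_ge:
  assumes "0 < e" "e \<le> 1"
  shows "e / 2 \<le> reg_inverse_den e t" and "\<bar>t\<bar> \<le> reg_inverse_den e t" and "t < 0 \<Longrightarrow> \<bar>t\<bar> / e \<le> reg_inverse_den e t"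
proof -
  have *: "\<bar>t\<bar> / e \<le> reg_inverse_den e t" if "t < 0"
  proof -
    have "0 \<le> (\<bar>t\<bar> - e\<^sup>2)\<^sup>2" by simp
    then have "2 * \<bar>t\<bar> * e\<^sup>2 \<le> e ^ 4 + t\<^sup>2"
      by (simp add: power2_diff power_mult[symmetric] algebra_simps)
    then have "2 * \<bar>t\<bar> * e\<^sup>2 / e ^ 3 \<le> (e ^ 4 + t\<^sup>2) / e ^ 3"
      using assms by (intro divide_right_mono) auto
    also have "(e ^ 4 + t\<^sup>2) / e ^ 3 = e + t\<^sup>2 / e ^ 3"
      using assms by (simp add: add_divide_distrib power_eq_if)
    finally have "2 * (\<bar>t\<bar> / e) \<le> e + t\<^sup>2 / e ^ 3"
      using assms by (simp add: power_eq_if)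
    moreover have "\<bar>t\<bar> \<le> \<bar>t\<bar> / e"
      using assms by (simp add: pos_le_divide_eq mult_left_le)
    ultimately show ?thesis using that by (simp add: reg_inverse_den_def max_def)
  qed
  show "t < 0 \<Longrightarrow> \<bar>t\<bar> / e \<le> reg_inverse_den e t" by (rule *)
  have **: "\<bar>t\<bar> \<le> \<bar>t\<bar> / e"
    using assms by (simp add: pos_le_divide_eq mult_left_le)
  show abs: "\<bar>t\<bar> \<le> reg_inverse_den e t"
  proof (cases "t < 0")
    case True
    show ?thesis using *[OF True] ** by linarith
  next
    case False
    then show ?thesis using assms by (simp add: reg_inverse_den_def max_def)
  qed
  have "e + t \<le> reg_inverse_den e t" using assms by (simp add: reg_inverse_den_def)
  then show "e / 2 \<le> reg_inverse_den e t" using abs by linarith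
qed

lemma reg_inverse_den_pos: "0 < e \<Longrightarrow> e \<le> 1 \<Longrightarrow> 0 < reg_inverse_den e t"
  using reg_inverse_den_ge(1)[of e t] by linarith

lemma reg_inverse_bounds:
  assumes "0 < e" "e \<le> 1"
  shows "0 < reg_inverse e t" and "reg_inverse e t \<le> 2 / e" and "\<bar>t * reg_inverse e t\<bar> \<le> 1"
    and "t < 0 \<Longrightarrow> \<bar>t * reg_inverse e t\<bar> \<le> e" and "0 \<le> t \<Longrightarrow> reg_inverse e t = 1 / (e + t)"
proof -
  note den = reg_inverse_den_ge[OF assms, of t] reg_inverse_den_pos[OF assms, of t]
  show "0 < reg_inverse e t" "reg_inverse e t \<le> 2 / e" "\<bar>t * reg_inverse e t\<bar> \<le> 1"
    using den assms by (simp_all add: reg_inverse_def field_simps abs_mult)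
  show "\<bar>t * reg_inverse e t\<bar> \<le> e" if "t < 0"
    using den(3)[OF that] den(4) assms by (simp add: reg_inverse_def field_simps abs_mult)
  show "0 \<le> t \<Longrightarrow> reg_inverse e t = 1 / (e + t)"
    by (simp add: reg_inverse_def reg_inverse_den_def max_def)
qed

lemma reg_inverse_deriv_pos: "0 < t \<Longrightarrow> reg_inverse_deriv e t = - (reg_inverse e t)\<^sup>2"
  by (simp add: reg_inverse_deriv_def max_def)

lemma has_real_derivative_reg_inverse:
  assumes "0 < e" "e \<le> 1"
  shows "(reg_inverse e has_real_derivative reg_inverse_deriv e t) (at t)"
proof -
  have "((\<lambda>t. (max (- t) 0)\<^sup>2) has_real_derivative (2 * max (- t) 0) * (- 1)) (at t)"
    by (rule DERIV_chain2[OF has_real_derivative_pos_part_square]) (auto intro!: derivative_eq_intros)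
  then have "((\<lambda>t. e + t + (max (- t) 0)\<^sup>2 * (1 / e ^ 3)) has_real_derivative (0 + 1 + 2 * max (- t) 0 * (- 1) * (1 / e ^ 3))) (at t)"
    by (intro DERIV_add DERIV_const DERIV_ident DERIV_cmult_right)
  then have "(reg_inverse_den e has_real_derivative (1 - 2 * max (- t) 0 / e ^ 3)) (at t)"
    by (simp add: reg_inverse_den_def[abs_def])
  then have "((\<lambda>t. inverse (reg_inverse_den e t)) has_real_derivative reg_inverse_deriv e t) (at t)"
    by (rule DERIV_cong[OF DERIV_inverse_fun])
      (use reg_inverse_den_pos[OF assms, of t] in \<open>auto simp: reg_inverse_deriv_def reg_inverse_def power2_eq_square divide_simps\<close>)
  then show ?thesis by (simp add: reg_inverse_def[abs_def] inverse_eq_divide)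
qed

lemma borel_measurable_reg_inverse:
  assumes "0 < e" "e \<le> 1"
  shows "reg_inverse e \<in> borel_measurable borel"
  using has_real_derivative_reg_inverse[OF assms]
  by (intro borel_measurable_continuous_onI DERIV_continuous_on) (auto simp: has_field_derivative_at_within)

lemma continuous_on_reg_inverse_deriv:
  assumes "0 < e" "e \<le> 1"
  shows "continuous_on UNIV (reg_inverse_deriv e)"
proof -
  have "reg_inverse_den e t \<noteq> 0" for t using reg_inverse_den_pos[OF assms, of t] by simp
  then show ?thesis
    unfolding reg_inverse_deriv_def[abs_def] reg_inverse_def[abs_def]
    by (intro continuous_intros) (auto simp: reg_inverse_den_def[abs_def] intro!: continuous_intros)
qed

lemma reg_inverse_deriv_bound:
  assumes e: "0 < e" "e \<le> 1"
  shows "\<bar>reg_inverse_deriv e t\<bar> \<le> 4 / e\<^sup>2 + 2 / e ^ 3 * (2 / e)"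
proof -
  note b = reg_inverse_bounds[OF e, of t]
  have 1: "(reg_inverse e t)\<^sup>2 \<le> (2 / e)\<^sup>2" using b by (intro power_mono) auto
  have "max (- t) 0 * reg_inverse e t \<le> 1"
  proof -
    have "max (- t) 0 * reg_inverse e t \<le> \<bar>t\<bar> * reg_inverse e t" using b by (intro mult_right_mono) auto
    then show ?thesis using b by (simp add: abs_mult)
  qed
  then have "max (- t) 0 * reg_inverse e t * reg_inverse e t \<le> 1 * (2 / e)"
    using b by (intro mult_mono) auto
  then have 2: "2 / e ^ 3 * (max (- t) 0 * (reg_inverse e t)\<^sup>2) \<le> 2 / e ^ 3 * (2 / e)"
    using e by (intro mult_left_mono) (auto simp: power2_eq_square mult.assoc)
  have "reg_inverse_deriv e t = 2 / e ^ 3 * (max (- t) 0 * (reg_inverse e t)\<^sup>2) - (reg_inverse e t)\<^sup>2"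
    by (simp add: reg_inverse_deriv_def algebra_simps)
  moreover have "0 \<le> 2 / e ^ 3 * (max (- t) 0 * (reg_inverse e t)\<^sup>2)" "0 \<le> (reg_inverse e t)\<^sup>2"
    using e by auto
  moreover have "(2 / e)\<^sup>2 = 4 / e\<^sup>2" by (simp add: power_divide)
  moreover have "0 \<le> 4 / e\<^sup>2" "0 \<le> 2 / e ^ 3 * (2 / e)" using e by auto
  ultimately show ?thesis using 1 2 by linarith
qed

text \<open>
  A \<open>C\<^sup>1\<close> substitute for \<open>ln (e + max t 0)\<close>: constant for \<open>t \<le> 0\<close>, where it takes the value \<open>ln e\<close>, and
  with a derivative bounded by twice the regularised reciprocal for \<open>t > 0\<close>.
\<close>

definition reg_log :: "real \<Rightarrow> real \<Rightarrow> real" where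
  "reg_log e t = ln (e\<^sup>2 + (max t 0)\<^sup>2) / 2"

lemma has_real_derivative_reg_log:
  assumes "0 < e"
  shows "(reg_log e has_real_derivative max t 0 / (e\<^sup>2 + (max t 0)\<^sup>2)) (at t)"
proof -
  have pos: "0 < e\<^sup>2 + (max t 0)\<^sup>2" using assms by (intro add_pos_nonneg) auto
  have "((\<lambda>t. e\<^sup>2 + (max t 0)\<^sup>2) has_real_derivative (0 + 2 * max t 0)) (at t)"
    by (intro DERIV_add DERIV_const has_real_derivative_pos_part_square)
  then have "((\<lambda>t. ln (e\<^sup>2 + (max t 0)\<^sup>2)) has_real_derivative 1 / (e\<^sup>2 + (max t 0)\<^sup>2) * (0 + 2 * max t 0)) (at t)"
    by (rule DERIV_chain2[where f = ln and g = "\<lambda>t. e\<^sup>2 + (max t 0)\<^sup>2" and x = t, OF DERIV_ln_divide[OF pos]])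
  moreover have "1 / x * (0 + 2 * y) / 2 = y / x" for x y :: real by simp
  ultimately show ?thesis
    unfolding reg_log_def[abs_def] using DERIV_cdivide[of _ _ t UNIV 2] by metis
qed

lemma reg_log_deriv_bound:
  fixes e t :: real
  assumes "0 < e"
  shows "\<bar>max t 0 / (e\<^sup>2 + (max t 0)\<^sup>2)\<bar> \<le> 1 / e"
proof -
  define m where "m = max t 0"
  have m: "0 \<le> m" by (simp add: m_def)
  have pos: "0 < e\<^sup>2 + m\<^sup>2" using assms by (intro add_pos_nonneg) auto
  have "2 * (m * e) \<le> e\<^sup>2 + m\<^sup>2"
    using zero_le_power2[of "e - m"] by (simp add: power2_diff algebra_simps)
  moreover have "0 \<le> m * e" using m assms by simp
  ultimately have "m * e \<le> e\<^sup>2 + m\<^sup>2" by linarith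
  then have "m / (e\<^sup>2 + m\<^sup>2) \<le> 1 / e" using pos assms by (simp add: field_simps)
  moreover have "0 \<le> m / (e\<^sup>2 + m\<^sup>2)" using m pos by simp
  ultimately show ?thesis by (simp add: m_def)
qed

lemma reg_log_deriv_le_reg_inverse:
  fixes e t :: real
  assumes "0 < e" "0 < t" "e \<le> 1"
  shows "\<bar>max t 0 / (e\<^sup>2 + (max t 0)\<^sup>2)\<bar> \<le> 2 * reg_inverse e t"
proof -
  have pos: "0 < e\<^sup>2 + t\<^sup>2" "0 < e + t" using assms by (simp_all add: add_pos_pos)
  have "2 * (e * t) \<le> e\<^sup>2 + t\<^sup>2"
    using zero_le_power2[of "e - t"] by (simp add: power2_diff algebra_simps)
  moreover have "0 \<le> e\<^sup>2" "0 \<le> t\<^sup>2" using assms by simp_all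
  ultimately have "e * t + t\<^sup>2 \<le> 2 * (e\<^sup>2 + t\<^sup>2)" by argo
  moreover have "t * (e + t) = e * t + t\<^sup>2" by (simp add: power2_eq_square algebra_simps)
  ultimately have "t * (e + t) \<le> 2 * (e\<^sup>2 + t\<^sup>2)" by (simp only:)
  then have "t / (e\<^sup>2 + t\<^sup>2) \<le> 2 / (e + t)" using pos by (simp add: pos_divide_le_eq pos_le_divide_eq)
  moreover have "0 \<le> t / (e\<^sup>2 + t\<^sup>2)" using assms pos by simp
  ultimately show ?thesis using assms reg_inverse_bounds(5)[of e t] by (simp add: max_def)
qed

text \<open>
  The positive part is squared to make the function \<open>C\<^sup>1\<close>; the square also gives the inequality
  \<open>|\<nabla>\<psi>|\<^sup>2 \<le> a \<psi>\<close> on which the energy estimate rests.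
\<close>

definition bump :: "'a::euclidean_space \<Rightarrow> real \<Rightarrow> 'a \<Rightarrow> real" where
  "bump p r x = (max (1 - (norm (x - p))\<^sup>2 / r\<^sup>2) 0)\<^sup>2"

lemma Ck_1_bump:
  assumes "0 < r"
  shows "Ck 1 (bump p r)" and "(norm (grad (bump p r) x))\<^sup>2 \<le> 16 / r\<^sup>2 * bump p r x"
proof -
  define f where "f x = 1 + - (1 / r\<^sup>2) * ((x - p) \<bullet> (x - p))" for x
  have f: "(f has_derivative (\<lambda>h. ((- (2 / r\<^sup>2)) *\<^sub>R (x - p)) \<bullet> h)) (at x)" for x
    unfolding f_def
    by (rule has_derivative_eq_rhs, (rule derivative_intros)+) (auto simp: fun_eq_iff inner_commute)
  have Cf: "Ck 1 f" by (rule Ck_1I[OF f]) (intro continuous_intros)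
  have bf: "bump p r = (\<lambda>x. (max (f x) 0)\<^sup>2)"
    by (simp add: bump_def[abs_def] f_def power2_norm_eq_inner)
  show "Ck 1 (bump p r)"
    unfolding bf by (rule Ck_1_compose(1)[OF Cf has_real_derivative_pos_part_square]) (intro continuous_intros)
  have g: "grad (bump p r) x = (2 * max (f x) 0) *\<^sub>R ((- (2 / r\<^sup>2)) *\<^sub>R (x - p))"
    unfolding bf grad_eqI[OF f, symmetric]
    by (rule Ck_1_compose(2)[OF Cf has_real_derivative_pos_part_square]) (intro continuous_intros)
  have eq: "(norm (grad (bump p r) x))\<^sup>2 = 16 / r\<^sup>2 * ((max (f x) 0)\<^sup>2 * ((norm (x - p))\<^sup>2 / r\<^sup>2))"
    using assms unfolding g by (simp add: power_mult_distrib power_divide power2_eq_square)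
  have "(max (f x) 0)\<^sup>2 * ((norm (x - p))\<^sup>2 / r\<^sup>2) \<le> (max (f x) 0)\<^sup>2"
  proof (cases "f x \<le> 0")
    case False
    then have "(norm (x - p))\<^sup>2 / r\<^sup>2 \<le> 1" by (simp add: f_def power2_norm_eq_inner)
    then show ?thesis by (intro mult_left_le) auto
  qed (simp add: max_def)
  then show "(norm (grad (bump p r) x))\<^sup>2 \<le> 16 / r\<^sup>2 * bump p r x"
    unfolding eq unfolding bf by (intro mult_left_mono) auto
qed

lemma bump_bounds:
  assumes "0 < r"
  shows "0 \<le> bump p r x" "bump p r x \<le> 1" "x \<notin> ball p r \<Longrightarrow> bump p r x = 0"
    "x \<in> ball p (r / 2) \<Longrightarrow> 1 / 2 \<le> bump p r x"
proof -
  define q where "q = (norm (x - p))\<^sup>2 / r\<^sup>2"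
  have b: "bump p r x = (max (1 - q) 0)\<^sup>2" by (simp add: bump_def q_def)
  have q: "0 \<le> q" by (simp add: q_def)
  show "0 \<le> bump p r x" by (simp add: b)
  show "bump p r x \<le> 1" unfolding b using q by (intro power_le_one) auto
  show "bump p r x = 0" if "x \<notin> ball p r"
  proof -
    have "r\<^sup>2 \<le> (norm (x - p))\<^sup>2" using that assms by (intro power_mono) (auto simp: dist_norm norm_minus_commute)
    then have "1 \<le> q" using assms by (simp add: q_def field_simps)
    then show ?thesis by (simp add: b)
  qed
  show "1 / 2 \<le> bump p r x" if "x \<in> ball p (r / 2)"
  proof -
    have "(norm (x - p))\<^sup>2 \<le> (r / 2)\<^sup>2" using that by (intro power_mono) (auto simp: dist_norm norm_minus_commute)
    then have "q \<le> 1 / 4" using assms by (simp add: q_def power_divide field_simps)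
    then have "(3 / 4)\<^sup>2 \<le> (max (1 - q) 0)\<^sup>2" by (intro power_mono) auto
    then show ?thesis unfolding b by (simp add: power2_eq_square)
  qed
qed

context lipschitz_domain
begin

section \<open>The energy estimate\<close>

definition steklov_solution :: "real \<Rightarrow> ('a \<Rightarrow> real) \<Rightarrow> ('a \<Rightarrow> 'a) \<Rightarrow> ('a \<Rightarrow> real) \<Rightarrow> bool" where
  "steklov_solution \<sigma> u G g \<longleftrightarrow> H1_with_trace \<Omega> u G g \<and>
    (\<forall>v V h. H1_with_trace \<Omega> v V h \<longrightarrow>
      (LINT x|lebesgue_on \<Omega>. G x \<bullet> V x) = \<sigma> * (LINT x|surface_measure \<Omega>. g x * h x))"

lemma steklov_eigenfunctionD:
  assumes "steklov_eigenfunction \<Omega> \<sigma> u"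
  shows "\<exists>G g. steklov_solution \<sigma> u G g" and "\<not> (AE x in lebesgue_on \<Omega>. u x = 0)"
proof -
  obtain G g where u: "has_H1_gradient \<Omega> u G" "has_trace \<Omega> u G g"
    and eq: "\<And>v V h. has_H1_gradient \<Omega> v V \<Longrightarrow> has_trace \<Omega> v V h \<Longrightarrow>
        (LINT x|lebesgue_on \<Omega>. G x \<bullet> V x) = \<sigma> * (LINT x|surface_measure \<Omega>. g x * h x)"
    using assms unfolding steklov_eigenfunction_def by blast
  have "H1_with_trace \<Omega> u G g"
    using u by (auto simp: H1_with_trace_def has_H1_gradient_def)
  moreover have "(LINT x|lebesgue_on \<Omega>. G x \<bullet> V x) = \<sigma> * (LINT x|surface_measure \<Omega>. g x * h x)"
    if "H1_with_trace \<Omega> v V h" for v V h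
    using that by (intro eq[of v V h] H1_with_trace_imp_gradient) (auto simp: H1_with_trace_def)
  ultimately show "\<exists>G g. steklov_solution \<sigma> u G g" unfolding steklov_solution_def by blast
  show "\<not> (AE x in lebesgue_on \<Omega>. u x = 0)" using assms by (simp add: steklov_eigenfunction_def)
qed

lemma steklov_solution_uminus:
  assumes "steklov_solution \<sigma> u G g"
  shows "steklov_solution \<sigma> (\<lambda>x. - u x) (\<lambda>x. - G x) (\<lambda>x. - g x)"
proof -
  have u: "H1_with_trace \<Omega> u G g" using assms by (simp add: steklov_solution_def)
  have "H1_with_trace \<Omega> (\<lambda>x. - u x) (\<lambda>x. (- 1) *\<^sub>R G x) (\<lambda>x. - g x)"
    by (rule H1_with_trace_compose[OF u, of uminus "\<lambda>_. - 1" 1]) (auto intro!: derivative_eq_intros)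
  then show ?thesis using assms by (simp add: steklov_solution_def)
qed

lemma H1_with_traceD:
  assumes "H1_with_trace \<Omega> u G g"
  shows "u \<in> borel_measurable (lebesgue_on \<Omega>)" "G \<in> borel_measurable (lebesgue_on \<Omega>)"
    "g \<in> borel_measurable (surface_measure \<Omega>)" "integrable (lebesgue_on \<Omega>) (\<lambda>x. (norm (G x))\<^sup>2)"
    "integrable (surface_measure \<Omega>) (\<lambda>x. (g x)\<^sup>2)"
  using assms by (auto simp: H1_with_trace_def has_trace_def square_integrable_def)

lemma integrable_inner_gradients:
  assumes "H1_with_trace \<Omega> u G g" "H1_with_trace \<Omega> v V h"
  shows "integrable (lebesgue_on \<Omega>) (\<lambda>x. G x \<bullet> V x)"
proof (rule Bochner_Integration.integrable_bound)
  show "integrable (lebesgue_on \<Omega>) (\<lambda>x. (norm (G x))\<^sup>2 + (norm (V x))\<^sup>2)"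
    using H1_with_traceD(4)[OF assms(1)] H1_with_traceD(4)[OF assms(2)] by simp
  have "norm (a \<bullet> b) \<le> norm ((norm a)\<^sup>2 + (norm b)\<^sup>2)" for a b :: 'a
  proof -
    have "\<bar>a \<bullet> b\<bar> \<le> norm a * norm b" by (rule Cauchy_Schwarz_ineq2)
    also have "\<dots> \<le> (norm a)\<^sup>2 + (norm b)\<^sup>2"
    proof -
      have "2 * (norm a * norm b) \<le> (norm a)\<^sup>2 + (norm b)\<^sup>2"
        using zero_le_power2[of "norm a - norm b"] by (simp add: power2_diff algebra_simps)
      moreover have "0 \<le> norm a * norm b" by simp
      ultimately show ?thesis by linarith
    qed
    finally show ?thesis by simp
  qed
  then show "AE x in lebesgue_on \<Omega>. norm (G x \<bullet> V x) \<le> norm ((norm (G x))\<^sup>2 + (norm (V x))\<^sup>2)" by simp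
qed (rule borel_measurable_inner[OF H1_with_traceD(2)[OF assms(1)] H1_with_traceD(2)[OF assms(2)]])

text \<open>
  Young's inequality in the form that absorbs the mixed term of the energy estimate, with
  \<open>P = \<psi>\<close>, \<open>X = reg_inverse e u * |G|\<close> and \<open>Y = |\<nabla>\<psi>|\<close>. Where \<open>P\<close> vanishes, so does \<open>Y\<close>.
\<close>

lemma young_cutoff:
  fixes P X Y a :: real
  assumes "0 \<le> P" "0 \<le> X" "0 \<le> Y" "Y\<^sup>2 \<le> a * P" "0 \<le> a"
  shows "X * Y \<le> P * X\<^sup>2 / 2 + a / 2"
proof (cases "P = 0")
  case True
  then show ?thesis using assms by simp
next
  case False
  then have P: "0 < P" using assms by simp
  have "0 \<le> (P * X - Y)\<^sup>2" by simp
  then have "2 * P * (X * Y) \<le> P\<^sup>2 * X\<^sup>2 + Y\<^sup>2"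
    by (simp add: power2_diff power_mult_distrib algebra_simps)
  also have "\<dots> \<le> P\<^sup>2 * X\<^sup>2 + a * P" using assms by simp
  also have "\<dots> = 2 * P * (P * X\<^sup>2 / 2 + a / 2)" by (simp add: power2_eq_square algebra_simps)
  finally show ?thesis using P by (simp add: mult_le_cancel_left_pos)
qed

text \<open>
  The test function is \<open>\<psi> * reg_inverse e u\<close>. Where \<open>u > 0\<close>, the derivative of the regularised
  reciprocal \<open>F\<close> is \<open>- F\<^sup>2\<close>, so that the integrand on the left of the weak equation is
  \<open>F * (G \<bullet> \<nabla>\<psi>) - \<psi> * F\<^sup>2 * |G|\<^sup>2\<close>; Young's inequality bounds it by \<open>a / 2\<close> minus half of the last term.
\<close>

lemma steklov_energy_estimate:
  assumes sol: "steklov_solution \<sigma> u G g"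
    and \<psi>: "Ck 1 \<psi>" "\<And>x. 0 \<le> \<psi> x" "\<And>x. (norm (grad \<psi> x))\<^sup>2 \<le> a * \<psi> x" and a: "0 \<le> a"
    and S: "S \<in> sets borel" "\<And>x. x \<notin> S \<Longrightarrow> \<psi> x = 0" and pos: "\<And>x. x \<in> \<Omega> \<inter> S \<Longrightarrow> 0 < u x"
    and e: "0 < e" "e \<le> 1"
  shows "integrable (lebesgue_on \<Omega>) (\<lambda>x. \<psi> x * (reg_inverse e (u x) * norm (G x))\<^sup>2)"
    and "\<sigma> * (LINT y|surface_measure \<Omega>. \<psi> y * (g y * reg_inverse e (g y)))
      + (LINT x|lebesgue_on \<Omega>. \<psi> x * (reg_inverse e (u x) * norm (G x))\<^sup>2) / 2
      \<le> a / 2 * measure (lebesgue_on \<Omega>) (\<Omega> \<inter> S)"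
proof -
  let ?F = "reg_inverse e"
  have u: "H1_with_trace \<Omega> u G g" using sol by (simp add: steklov_solution_def)
  note b = reg_inverse_bounds[OF e]
  note [measurable] = H1_with_traceD(1,2,3)[OF u] Ck_1_measurable[OF \<psi>(1)]
  note [measurable] = borel_measurable_reg_inverse[OF e]
  have "H1_with_trace \<Omega> (\<lambda>x. ?F (u x)) (\<lambda>x. reg_inverse_deriv e (u x) *\<^sub>R G x) (\<lambda>y. ?F (g y))"
    by (rule H1_with_trace_compose[OF u has_real_derivative_reg_inverse[OF e] continuous_on_reg_inverse_deriv[OF e] reg_inverse_deriv_bound[OF e]])
  from H1_with_trace_mult[OF this \<psi>(1)]
  have v: "H1_with_trace \<Omega> (\<lambda>x. \<psi> x * ?F (u x)) (\<lambda>x. ?F (u x) *\<^sub>R grad \<psi> x + \<psi> x *\<^sub>R reg_inverse_deriv e (u x) *\<^sub>R G x) (\<lambda>y. \<psi> y * ?F (g y))" .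
  define V where "V x = ?F (u x) *\<^sub>R grad \<psi> x + \<psi> x *\<^sub>R reg_inverse_deriv e (u x) *\<^sub>R G x" for x
  have weak: "(LINT x|lebesgue_on \<Omega>. G x \<bullet> V x) = \<sigma> * (LINT y|surface_measure \<Omega>. \<psi> y * (g y * ?F (g y)))"
    using sol v by (auto simp: steklov_solution_def V_def mult_ac)
  have intV: "integrable (lebesgue_on \<Omega>) (\<lambda>x. G x \<bullet> V x)"
    unfolding V_def by (rule integrable_inner_gradients[OF u v])
  obtain B where B: "\<And>x. x \<in> \<Omega> \<Longrightarrow> norm (\<psi> x) \<le> B"
    using bounded_on_domain[OF Ck_1_continuous_on[OF \<psi>(1)]] by metis
  have B': "\<psi> x \<le> B" if "x \<in> \<Omega>" for x using B[OF that] by simp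
  show int: "integrable (lebesgue_on \<Omega>) (\<lambda>x. \<psi> x * (?F (u x) * norm (G x))\<^sup>2)"
  proof (rule Bochner_Integration.integrable_bound)
    show "integrable (lebesgue_on \<Omega>) (\<lambda>x. (B * (2 / e)\<^sup>2) * (norm (G x))\<^sup>2)"
      using H1_with_traceD(4)[OF u] by simp
    show "AE x in lebesgue_on \<Omega>. norm (\<psi> x * (?F (u x) * norm (G x))\<^sup>2) \<le> norm ((B * (2 / e)\<^sup>2) * (norm (G x))\<^sup>2)"
    proof (rule AE_I2)
      fix x assume "x \<in> space (lebesgue_on \<Omega>)"
      then have x: "x \<in> \<Omega>" by simp
      have "(?F (u x) * norm (G x))\<^sup>2 \<le> (2 / e)\<^sup>2 * (norm (G x))\<^sup>2"
        unfolding power_mult_distrib using b[of "u x"] by (intro mult_right_mono power_mono) auto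
      then have "\<psi> x * (?F (u x) * norm (G x))\<^sup>2 \<le> B * ((2 / e)\<^sup>2 * (norm (G x))\<^sup>2)"
        using B'[OF x] \<psi>(2)[of x] by (intro mult_mono) auto
      then show "norm (\<psi> x * (?F (u x) * norm (G x))\<^sup>2) \<le> norm ((B * (2 / e)\<^sup>2) * (norm (G x))\<^sup>2)"
        using \<psi>(2)[of x] by (simp add: mult.assoc)
    qed
  qed measurable
  have pw: "G x \<bullet> V x + \<psi> x * (?F (u x) * norm (G x))\<^sup>2 / 2 \<le> a / 2 * indicat_real S x" if x: "x \<in> \<Omega>" for x
  proof (cases "x \<in> S")
    case False
    then have "\<psi> x = 0" "grad \<psi> x = 0" using S(2)[OF False] \<psi>(3)[of x] by auto
    then show ?thesis using False by (simp add: V_def)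
  next
    case True
    then have "0 < u x" using pos x by simp
    then have V: "V x = ?F (u x) *\<^sub>R grad \<psi> x - (\<psi> x * (?F (u x))\<^sup>2) *\<^sub>R G x"
      by (simp add: V_def reg_inverse_deriv_pos)
    have "?F (u x) * (G x \<bullet> grad \<psi> x) \<le> ?F (u x) * (norm (G x) * norm (grad \<psi> x))"
      using b(1)[of "u x"] by (intro mult_left_mono norm_cauchy_schwarz) auto
    also have "\<dots> \<le> \<psi> x * (?F (u x) * norm (G x))\<^sup>2 / 2 + a / 2"
      using young_cutoff[of "\<psi> x" "?F (u x) * norm (G x)" "norm (grad \<psi> x)" a] \<psi> a b(1)[of "u x"]
      by (simp add: mult.assoc)
    finally have "?F (u x) * (G x \<bullet> grad \<psi> x) \<le> \<psi> x * (?F (u x) * norm (G x))\<^sup>2 / 2 + a / 2" .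
    moreover have "G x \<bullet> V x = ?F (u x) * (G x \<bullet> grad \<psi> x) - \<psi> x * (?F (u x) * norm (G x))\<^sup>2"
      by (simp add: V inner_diff_right dot_square_norm power_mult_distrib)
    ultimately have "G x \<bullet> V x + \<psi> x * (?F (u x) * norm (G x))\<^sup>2 / 2 \<le> a / 2" by linarith
    then show ?thesis using True by simp
  qed
  have S': "\<Omega> \<inter> S \<in> sets (lebesgue_on \<Omega>)"
    using S(1) by (auto simp: sets_restrict_space)
  have ind: "indicat_real S x = indicat_real (\<Omega> \<inter> S) x" if "x \<in> \<Omega>" for x
    using that by (simp add: indicator_def)
  have intS: "integrable (lebesgue_on \<Omega>) (\<lambda>x. a / 2 * indicat_real (\<Omega> \<inter> S) x)"
    using S' by (intro integrable_mult_right integrable_real_indicator) (auto simp: interior.emeasure_finite less_top[symmetric])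
  have "(LINT x|lebesgue_on \<Omega>. G x \<bullet> V x + \<psi> x * (?F (u x) * norm (G x))\<^sup>2 / 2)
      \<le> (LINT x|lebesgue_on \<Omega>. a / 2 * indicat_real (\<Omega> \<inter> S) x)"
    by (rule integral_mono) (use intV int intS pw ind in auto)
  also have "\<dots> = a / 2 * measure (lebesgue_on \<Omega>) (\<Omega> \<inter> S)"
  proof -
    have "\<Omega> \<inter> S \<inter> \<Omega> = \<Omega> \<inter> S" by blast
    then show ?thesis using S' by simp
  qed
  finally show "\<sigma> * (LINT y|surface_measure \<Omega>. \<psi> y * (g y * ?F (g y)))
      + (LINT x|lebesgue_on \<Omega>. \<psi> x * (?F (u x) * norm (G x))\<^sup>2) / 2
      \<le> a / 2 * measure (lebesgue_on \<Omega>) (\<Omega> \<inter> S)"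
    using intV int by (simp add: weak)
qed

text \<open>
  Let \<open>e\<close> tend to 0 in the energy estimate and drop the gradient term. The boundary integrand is
  bounded by \<open>\<psi>\<close> and converges to \<open>\<psi>\<close> times the indicator of \<open>g > 0\<close>.
\<close>

lemma steklov_boundary_estimate:
  assumes sol: "steklov_solution \<sigma> u G g" and \<sigma>: "0 \<le> \<sigma>"
    and \<psi>: "Ck 1 \<psi>" "\<And>x. 0 \<le> \<psi> x" "\<And>x. (norm (grad \<psi> x))\<^sup>2 \<le> a * \<psi> x" and a: "0 \<le> a"
    and S: "S \<in> sets borel" "\<And>x. x \<notin> S \<Longrightarrow> \<psi> x = 0" and pos: "\<And>x. x \<in> \<Omega> \<inter> S \<Longrightarrow> 0 < u x"
  shows "\<sigma> * (LINT y|surface_measure \<Omega>. \<psi> y * (if 0 < g y then 1 else 0)) \<le> a / 2 * measure (lebesgue_on \<Omega>) (\<Omega> \<inter> S)"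
proof -
  have u: "H1_with_trace \<Omega> u G g" using sol by (simp add: steklov_solution_def)
  note [measurable] = H1_with_traceD(3)[OF u] Ck_1_measurable[OF \<psi>(1)]
  define e where "e k = inverse (real (Suc k))" for k
  have e: "0 < e k" "e k \<le> 1" for k by (simp_all add: e_def field_simps)
  have e0: "e \<longlonglongrightarrow> 0" unfolding e_def[abs_def] by (rule LIMSEQ_inverse_real_of_nat)
  note [measurable] = borel_measurable_reg_inverse[OF e]
  have est: "\<sigma> * (LINT y|surface_measure \<Omega>. \<psi> y * (g y * reg_inverse (e k) (g y))) \<le> a / 2 * measure (lebesgue_on \<Omega>) (\<Omega> \<inter> S)" for k
  proof -
    have "0 \<le> (LINT x|lebesgue_on \<Omega>. \<psi> x * (reg_inverse (e k) (u x) * norm (G x))\<^sup>2)"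
      using \<psi>(2) by (intro Bochner_Integration.integral_nonneg) auto
    moreover have "\<sigma> * (LINT y|surface_measure \<Omega>. \<psi> y * (g y * reg_inverse (e k) (g y)))
      + (LINT x|lebesgue_on \<Omega>. \<psi> x * (reg_inverse (e k) (u x) * norm (G x))\<^sup>2) / 2
      \<le> a / 2 * measure (lebesgue_on \<Omega>) (\<Omega> \<inter> S)"
      by (rule steklov_energy_estimate(2)[OF sol \<psi> a S pos e])
    ultimately show ?thesis by linarith
  qed
  have lim: "(\<lambda>k. t * reg_inverse (e k) t) \<longlonglongrightarrow> (if 0 < t then 1 else 0)" for t
  proof (cases "0 < t")
    case True
    have "(\<lambda>k. t * (1 / (e k + t))) \<longlonglongrightarrow> t * (1 / (0 + t))"
      using True by (intro tendsto_intros e0) auto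
    then show ?thesis using True reg_inverse_bounds(5)[OF e, of t] by simp
  next
    case False
    have "\<bar>t * reg_inverse (e k) t\<bar> \<le> e k" for k
      using reg_inverse_bounds(4)[OF e, of t k] False e[of k] by (cases "t = 0") auto
    then have "(\<lambda>k. t * reg_inverse (e k) t) \<longlonglongrightarrow> 0"
      by (intro Lim_null_comparison[OF _ e0]) auto
    then show ?thesis using False by simp
  qed
  obtain B where B: "\<And>y. y \<in> frontier \<Omega> \<Longrightarrow> norm (\<psi> y) \<le> B"
    using bounded_on_domain[OF Ck_1_continuous_on[OF \<psi>(1)]] by metis
  have "(\<lambda>k. LINT y|surface_measure \<Omega>. \<psi> y * (g y * reg_inverse (e k) (g y))) \<longlonglongrightarrow> (LINT y|surface_measure \<Omega>. \<psi> y * (if 0 < g y then 1 else 0))"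
  proof (rule integral_dominated_convergence[where w="\<lambda>_. B"])
    show "AE y in surface_measure \<Omega>. (\<lambda>k. \<psi> y * (g y * reg_inverse (e k) (g y))) \<longlonglongrightarrow> \<psi> y * (if 0 < g y then 1 else 0)"
      by (intro AE_I2 tendsto_mult_left lim)
    show "AE y in surface_measure \<Omega>. norm (\<psi> y * (g y * reg_inverse (e k) (g y))) \<le> B" for k
    proof (rule AE_I2)
      fix y assume "y \<in> space (surface_measure \<Omega>)"
      then have "\<bar>\<psi> y\<bar> \<le> B" using B[of y] by simp
      then have "\<bar>\<psi> y\<bar> * \<bar>g y * reg_inverse (e k) (g y)\<bar> \<le> B * 1"
        using reg_inverse_bounds(3)[OF e, of "g y"] by (intro mult_mono) auto
      then show "norm (\<psi> y * (g y * reg_inverse (e k) (g y))) \<le> B" by (simp add: abs_mult)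
    qed
  qed measurable
  then have "(\<lambda>k. \<sigma> * (LINT y|surface_measure \<Omega>. \<psi> y * (g y * reg_inverse (e k) (g y)))) \<longlonglongrightarrow> \<sigma> * (LINT y|surface_measure \<Omega>. \<psi> y * (if 0 < g y then 1 else 0))"
    by (rule tendsto_mult_left)
  then show ?thesis
    by (rule LIMSEQ_le_const2) (use est in auto)
qed

end

section \<open>Sign of the solution near the boundary\<close>

lemma continuous_nonzero_const_sign:
  fixes u :: "'a::topological_space \<Rightarrow> real"
  assumes "connected S" "continuous_on S u" "\<And>x. x \<in> S \<Longrightarrow> u x \<noteq> 0"
  shows "(\<forall>x\<in>S. 0 < u x) \<or> (\<forall>x\<in>S. u x < 0)"
proof (rule ccontr)
  assume "\<not> ?thesis"
  then obtain x y where "x \<in> S" "u x \<le> 0" "y \<in> S" "0 \<le> u y" by (auto simp: not_less)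
  then have "0 \<in> u ` S"
    using connectedD_interval[OF connected_continuous_image[OF assms(2,1)], of "u x" "u y" 0] by auto
  then show False using assms(3) by auto
qed

context lipschitz_domain
begin

text \<open>
  The intersection of the domain with a ball about a boundary point need not be connected. In a chart,
  however, its points close to \<open>p\<close> can be joined inside \<open>\<Omega> \<inter> ball p r\<close> to a common ball: they are
  moved away from the boundary by \<open>2 r / 3\<close> along their fibres, on which the depth increases.
\<close>

lemma const_sign_near_boundary:
  fixes u :: "'a \<Rightarrow> real"
  assumes chart: "boundary_chart \<Omega> p R M n \<tau>" and p: "p \<in> frontier \<Omega>" and r: "0 < r" "r \<le> R"
    and cont: "continuous_on \<Omega> u" and nz: "\<And>x. x \<in> \<Omega> \<inter> ball p r \<Longrightarrow> u x \<noteq> 0"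
  shows "(\<forall>x\<in>\<Omega> \<inter> ball p (r / (3 * M)). 0 < u x) \<or> (\<forall>x\<in>\<Omega> \<inter> ball p (r / (3 * M)). u x < 0)"
proof -
  interpret depth_function n \<tau> M using chart by (simp add: boundary_chart_def)
  define \<rho> where "\<rho> = r / (3 * M)"
  define T where "T = 2 * r / 3"
  have \<rho>: "0 < \<rho>" "\<rho> \<le> r / 3" "M * \<rho> = r / 3"
    using r M_ge_1 by (auto simp: \<rho>_def field_simps)
  have mem: "y \<in> \<Omega> \<inter> ball p r" if "dist p y < r" "0 < \<tau> y" for y
    using chart that r by (auto simp: boundary_chart_def)
  have p0: "\<tau> p = 0" using chart p by (auto simp: boundary_chart_def)
  define q where "q = p - T *\<^sub>R n"
  have q: "\<tau> q = T" "dist p q = T" using p0 r norm_n by (simp_all add: q_def depth_shift_minus T_def dist_norm)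
  have ballq: "ball q \<rho> \<subseteq> \<Omega> \<inter> ball p r"
  proof
    fix y assume y: "y \<in> ball q \<rho>"
    have "M * dist q y \<le> M * \<rho>" using y M_ge_1 by (intro mult_left_mono) auto
    then have "0 < \<tau> y" using depth_diff_le[of q y] q \<rho> r by (simp add: T_def)
    moreover have "dist p y < r" using y q \<rho> dist_triangle[of p y q] by (simp add: T_def)
    ultimately show "y \<in> \<Omega> \<inter> ball p r" by (intro mem)
  qed
  have same: "(0 < u x \<and> 0 < u q) \<or> (u x < 0 \<and> u q < 0)" if x: "x \<in> \<Omega> \<inter> ball p \<rho>" for x
  proof -
    define C where "C = (\<lambda>t. x - t *\<^sub>R n) ` {0..T}"
    have "x \<in> ball p R" using x \<rho>(1,2) r by simp
    then have "0 < \<tau> x" using x chart by (simp add: boundary_chart_def)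
    have "C \<subseteq> \<Omega> \<inter> ball p r"
    proof
      fix y assume "y \<in> C"
      then obtain t where t: "0 \<le> t" "t \<le> T" "y = x - t *\<^sub>R n" by (auto simp: C_def)
      have eq: "p - y = (p - x) + t *\<^sub>R n" using t by simp
      have "dist p y \<le> dist p x + t"
        unfolding dist_norm eq using norm_triangle_ineq[of "p - x" "t *\<^sub>R n"] norm_n t by simp
      then have "dist p y < r" using x t \<rho> by (simp add: T_def)
      moreover have "0 < \<tau> y" using \<open>0 < \<tau> x\<close> t by (simp add: depth_shift_minus)
      ultimately show "y \<in> \<Omega> \<inter> ball p r" by (intro mem)
    qed
    then have sub: "ball q \<rho> \<union> C \<subseteq> \<Omega> \<inter> ball p r" using ballq by blast
    have "connected C"
      unfolding C_def by (intro connected_continuous_image continuous_intros) auto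
    moreover have "x - T *\<^sub>R n \<in> ball q \<rho> \<inter> C"
      using x r by (auto simp: C_def q_def dist_norm T_def)
    ultimately have "connected (ball q \<rho> \<union> C)"
      by (intro connected_Un) auto
    moreover have "continuous_on (ball q \<rho> \<union> C) u"
      using sub by (intro continuous_on_subset[OF cont]) auto
    ultimately have "(\<forall>y\<in>ball q \<rho> \<union> C. 0 < u y) \<or> (\<forall>y\<in>ball q \<rho> \<union> C. u y < 0)"
      by (rule continuous_nonzero_const_sign) (use sub nz in blast)
    moreover have "x \<in> C" using r by (auto simp: C_def T_def intro!: image_eqI[of _ _ 0])
    moreover have "q \<in> ball q \<rho>" using \<rho> by simp
    ultimately show ?thesis by blast
  qed
  show ?thesis
  proof (cases "0 < u q")
    case True
    then have "\<forall>x\<in>\<Omega> \<inter> ball p \<rho>. 0 < u x" using same by force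
    then show ?thesis by (simp add: \<rho>_def)
  next
    case False
    then have "\<forall>x\<in>\<Omega> \<inter> ball p \<rho>. u x < 0" using same by force
    then show ?thesis by (simp add: \<rho>_def)
  qed
qed

section \<open>Positivity of the trace\<close>

lemma level_set_boundary_borel:
  assumes "g \<in> borel_measurable (surface_measure \<Omega>)" "A \<in> sets borel"
  shows "{y \<in> frontier \<Omega>. g y \<in> A} \<in> sets borel"
proof -
  have "g -` A \<inter> space (surface_measure \<Omega>) \<in> sets (surface_measure \<Omega>)"
    using assms by (rule measurable_sets)
  then have "g -` A \<inter> frontier \<Omega> \<in> sets (restrict_space borel (frontier \<Omega>))"
    by (simp add: sets_surface_measure)
  then have "g -` A \<inter> frontier \<Omega> \<in> sets borel"
    by (subst (asm) sets_restrict_space_iff) auto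
  moreover have "{y \<in> frontier \<Omega>. g y \<in> A} = g -` A \<inter> frontier \<Omega>" by auto
  ultimately show ?thesis by simp
qed

lemma lens_borel [measurable]: "lens p n s M \<in> sets borel"
  by (simp add: lens_def)

lemma emeasure_lens:
  assumes "0 < s" "1 \<le> M"
  shows "emeasure lborel (lens p n s M) = ennreal (unit_ball_vol DIM('a) * (s / (2 * M)) ^ DIM('a))"
  using assms unfolding lens_def by (intro emeasure_cball) auto

context
  fixes p R M n \<tau> s
  assumes chart: "boundary_chart \<Omega> p R M n \<tau>" and p: "p \<in> frontier \<Omega>" and s: "0 < s" "4 * s \<le> R"
begin

interpretation depth_function n \<tau> M
  using chart by (simp add: boundary_chart_def)

lemma two_s_le: "2 * s \<le> R" using s by linarith

lemmas in_lens = lens_depth[OF chart p s(1) two_s_le] lens_fibre[OF chart p s(1) two_s_le]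

text \<open>
  The energy estimate with a bump. What matters is that the bound is independent of \<open>e\<close>: the boundary
  term is at most \<open>|\<sigma>|\<close> times the total surface measure, whatever the sign of the trace.
\<close>

lemma energy_bound_near_boundary:
  assumes sol: "steklov_solution \<sigma> u G g" and pos: "\<And>x. x \<in> \<Omega> \<inter> ball p (4 * s) \<Longrightarrow> 0 < u x"
  shows "\<exists>C. \<forall>e. 0 < e \<longrightarrow> e \<le> 1 \<longrightarrow>
    (\<integral>\<^sup>+x. indicator (ball p (2 * s)) x * ennreal ((norm (reg_inverse e (u x) *\<^sub>R G x))\<^sup>2) \<partial>lebesgue_on \<Omega>) \<le> ennreal C"
proof (intro exI allI impI)
  fix e :: real assume e: "0 < e" "e \<le> 1"
  define \<psi> where "\<psi> = bump p (4 * s)"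
  define a where "a = 16 / (4 * s)\<^sup>2"
  define m where "m = measure (surface_measure \<Omega>) (space (surface_measure \<Omega>))"
  have r: "0 < 4 * s" using s by simp
  have u: "H1_with_trace \<Omega> u G g" using sol by (simp add: steklov_solution_def)
  have C\<psi>: "Ck 1 \<psi>" unfolding \<psi>_def by (rule Ck_1_bump(1)[OF r])
  note b = bump_bounds[OF r, where p = p, folded \<psi>_def]
  note [measurable] = H1_with_traceD(1,2,3)[OF u] Ck_1_measurable[OF C\<psi>]
  note [measurable] = borel_measurable_reg_inverse[OF e]
  have gb: "(norm (grad \<psi> x))\<^sup>2 \<le> a * \<psi> x" for x
    unfolding \<psi>_def a_def by (rule Ck_1_bump(2)[OF r])
  have a: "0 \<le> a" by (simp add: a_def)
  note est = steklov_energy_estimate[where S = "ball p (4 * s)", OF sol C\<psi> b(1) gb a borel_open[OF open_ball] b(3) pos e]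
  let ?I = "LINT x|lebesgue_on \<Omega>. \<psi> x * (reg_inverse e (u x) * norm (G x))\<^sup>2"
  let ?J = "LINT y|surface_measure \<Omega>. \<psi> y * (g y * reg_inverse e (g y))"
  have "\<bar>?J\<bar> \<le> m"
  proof -
    have le1: "\<bar>\<psi> y * (g y * reg_inverse e (g y))\<bar> \<le> 1" for y
      unfolding abs_mult[of "\<psi> y"] using b(1,2)[of y] reg_inverse_bounds(3)[OF e, of "g y"]
      by (intro mult_le_one) auto
    have int: "integrable (surface_measure \<Omega>) (\<lambda>y. \<psi> y * (g y * reg_inverse e (g y)))"
      by (rule boundary.integrable_const_bound[of _ 1]) (use le1 in auto)
    have "\<bar>?J\<bar> \<le> (LINT y|surface_measure \<Omega>. \<bar>\<psi> y * (g y * reg_inverse e (g y))\<bar>)" by (rule integral_abs_bound)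
    also have "\<dots> \<le> (LINT y|surface_measure \<Omega>. 1)"
      by (intro integral_mono integrable_abs int) (use le1 in auto)
    finally show ?thesis by (simp add: m_def)
  qed
  then have "\<bar>\<sigma> * ?J\<bar> \<le> \<bar>\<sigma>\<bar> * m" by (simp add: abs_mult mult_left_mono)
  moreover have "\<sigma> * ?J + ?I / 2 \<le> a / 2 * measure (lebesgue_on \<Omega>) (\<Omega> \<inter> ball p (4 * s))"
    by (rule est(2))
  ultimately have I: "?I \<le> a * measure (lebesgue_on \<Omega>) (\<Omega> \<inter> ball p (4 * s)) + 2 * (\<bar>\<sigma>\<bar> * m)"
    by linarith
  have int: "integrable (lebesgue_on \<Omega>) (\<lambda>x. \<psi> x * (reg_inverse e (u x) * norm (G x))\<^sup>2)"
    by (rule est(1))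
  have "(\<integral>\<^sup>+x. indicator (ball p (2 * s)) x * ennreal ((norm (reg_inverse e (u x) *\<^sub>R G x))\<^sup>2) \<partial>lebesgue_on \<Omega>)
      \<le> (\<integral>\<^sup>+x. ennreal (2 * (\<psi> x * (reg_inverse e (u x) * norm (G x))\<^sup>2)) \<partial>lebesgue_on \<Omega>)"
  proof (rule nn_integral_mono)
    fix x
    show "indicator (ball p (2 * s)) x * ennreal ((norm (reg_inverse e (u x) *\<^sub>R G x))\<^sup>2)
        \<le> ennreal (2 * (\<psi> x * (reg_inverse e (u x) * norm (G x))\<^sup>2))"
    proof (cases "x \<in> ball p (2 * s)")
      case True
      then have "1 \<le> 2 * \<psi> x" using b(4)[of x] by simp
      then have "1 * (reg_inverse e (u x) * norm (G x))\<^sup>2 \<le> (2 * \<psi> x) * (reg_inverse e (u x) * norm (G x))\<^sup>2"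
        by (rule mult_right_mono) simp
      then show ?thesis using True by (auto intro!: ennreal_leI simp: power_mult_distrib mult.assoc)
    qed simp
  qed
  also have "\<dots> = ennreal (LINT x|lebesgue_on \<Omega>. 2 * (\<psi> x * (reg_inverse e (u x) * norm (G x))\<^sup>2))"
    using int b(1) by (intro nn_integral_eq_integral) auto
  also have "\<dots> \<le> ennreal (2 * (a * measure (lebesgue_on \<Omega>) (\<Omega> \<inter> ball p (4 * s)) + 2 * (\<bar>\<sigma>\<bar> * m)))"
    using I by (intro ennreal_leI) simp
  finally show "(\<integral>\<^sup>+x. indicator (ball p (2 * s)) x * ennreal ((norm (reg_inverse e (u x) *\<^sub>R G x))\<^sup>2) \<partial>lebesgue_on \<Omega>)
      \<le> ennreal (2 * (16 / (4 * s)\<^sup>2 * measure (lebesgue_on \<Omega>) (\<Omega> \<inter> ball p (4 * s))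
        + 2 * (\<bar>\<sigma>\<bar> * measure (surface_measure \<Omega>) (space (surface_measure \<Omega>)))))"
    by (simp add: a_def m_def)
qed

text \<open>
  Apply the fibre estimate to \<open>reg_log e u\<close>, whose gradient is bounded in \<open>L\<^sup>2\<close> uniformly in \<open>e\<close>. On the
  lens \<open>u\<close> is at least some \<open>c > 0\<close>, whereas the trace of \<open>reg_log e u\<close> is \<open>ln e\<close> at the boundary points
  with \<open>g \<le> 0\<close>. If the fibres ending there had positive measure \<open>m\<close>, then \<open>(ln c - ln e)\<^sup>2 * m\<close> would be
  bounded as \<open>e \<rightarrow> 0\<close>.
\<close>

lemma trace_positive_on_lens:
  assumes sol: "steklov_solution \<sigma> u G g" and cont: "continuous_on \<Omega> u"
    and pos: "\<And>x. x \<in> \<Omega> \<inter> ball p (4 * s) \<Longrightarrow> 0 < u x"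
  shows "emeasure lborel (lens p n s M \<inter> foot -` {y \<in> frontier \<Omega>. g y \<in> {..0}}) = 0"
proof (rule ccontr)
  have u: "H1_with_trace \<Omega> u G g" using sol by (simp add: steklov_solution_def)
  define E where "E = {y \<in> frontier \<Omega>. g y \<in> {..0}}"
  define N where "N = lens p n s M \<inter> foot -` E"
  assume "emeasure lborel (lens p n s M \<inter> foot -` {y \<in> frontier \<Omega>. g y \<in> {..0}}) \<noteq> 0"
  then have N0: "emeasure lborel N \<noteq> 0" by (simp add: N_def E_def)
  have [measurable]: "E \<in> sets borel"
    unfolding E_def by (rule level_set_boundary_borel[OF H1_with_traceD(3)[OF u]]) simp
  have [measurable]: "N \<in> sets borel"
    unfolding N_def using measurable_sets_borel[OF borel_measurable_foot, of E] by auto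
  have "emeasure lborel N \<le> emeasure lborel (lens p n s M)" by (intro emeasure_mono) (auto simp: N_def)
  also have "\<dots> < \<infinity>" using emeasure_lens[OF s(1) M_ge_1] by simp
  finally have Nfin: "emeasure lborel N < \<infinity>" .
  define m where "m = measure lborel N"
  have em: "emeasure lborel N = ennreal m" using Nfin by (simp add: m_def emeasure_eq_ennreal_measure)
  have m: "0 < m" using N0 by (auto simp: em ennreal_eq_0_iff not_le)
  have lO: "lens p n s M \<subseteq> \<Omega>" using in_lens(5) by blast
  have lB: "x \<in> ball p (4 * s)" if "x \<in> lens p n s M" for x
    using in_lens(3)[OF that, of 0] in_lens(1)[OF that] s by auto
  have "\<exists>x\<in>lens p n s M. \<forall>y\<in>lens p n s M. u x \<le> u y"
  proof (rule continuous_attains_inf)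
    show "compact (lens p n s M)" by (simp add: lens_def)
    have "0 \<le> s / (2 * M)" using s M_ge_1 by (intro divide_nonneg_nonneg) auto
    then have "p - s *\<^sub>R n \<in> lens p n s M" by (simp add: lens_def)
    then show "lens p n s M \<noteq> {}" by blast
    show "continuous_on (lens p n s M) u" by (rule continuous_on_subset[OF cont lO])
  qed
  then obtain x0 where x0: "x0 \<in> lens p n s M" "\<And>y. y \<in> lens p n s M \<Longrightarrow> u x0 \<le> u y" by blast
  define c where "c = u x0"
  have c: "0 < c" using pos[of x0] x0(1) lO lB by (auto simp: c_def)
  obtain C where C: "\<And>e. 0 < e \<Longrightarrow> e \<le> 1 \<Longrightarrow>
    (\<integral>\<^sup>+x. indicator (ball p (2 * s)) x * ennreal ((norm (reg_inverse e (u x) *\<^sub>R G x))\<^sup>2) \<partial>lebesgue_on \<Omega>) \<le> ennreal C"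
    using energy_bound_near_boundary[OF sol pos] by blast
  define K where "K = 32 * s\<^sup>2 * (4 * max C 0)"
  have bound: "(ln c - ln e)\<^sup>2 * m \<le> K" if e: "0 < e" "e \<le> 1" "e \<le> c" for e
  proof -
    define \<Lambda>' where "\<Lambda>' t = max t 0 / (e\<^sup>2 + (max t 0)\<^sup>2)" for t
    have den: "e\<^sup>2 + (max t 0)\<^sup>2 \<noteq> 0" for t using e by (simp add: add_pos_nonneg less_imp_neq[symmetric])
    have c\<Lambda>': "continuous_on UNIV \<Lambda>'"
      unfolding \<Lambda>'_def by (intro continuous_intros) (use den in auto)
    have w: "H1_with_trace \<Omega> (\<lambda>x. reg_log e (u x)) (\<lambda>x. \<Lambda>' (u x) *\<^sub>R G x) (\<lambda>y. reg_log e (g y))"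
      by (rule H1_with_trace_compose[OF u _ c\<Lambda>', of _ "1 / e"])
        (use e has_real_derivative_reg_log reg_log_deriv_bound in \<open>auto simp: \<Lambda>'_def\<close>)
    have "ennreal ((ln c - ln e)\<^sup>2 * m) = (\<integral>\<^sup>+x. indicator N x * ennreal ((ln c - ln e)\<^sup>2) \<partial>lborel)"
      using m by (simp add: nn_integral_multc em ennreal_mult mult.commute)
    also have "\<dots> = (\<integral>\<^sup>+x. indicator N x * ennreal ((ln c - ln e)\<^sup>2) \<partial>lebesgue_on \<Omega>)"
      by (rule nn_integral_interior_indicator[symmetric]) (use lO in \<open>auto simp: N_def\<close>)
    also have "\<dots> \<le> (\<integral>\<^sup>+x. indicator (lens p n s M) x * ennreal ((reg_log e (g (foot x)) - reg_log e (u x))\<^sup>2) \<partial>lebesgue_on \<Omega>)"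
    proof (rule nn_integral_mono)
      fix x
      show "indicator N x * ennreal ((ln c - ln e)\<^sup>2)
          \<le> indicator (lens p n s M) x * ennreal ((reg_log e (g (foot x)) - reg_log e (u x))\<^sup>2)"
      proof (cases "x \<in> N")
        case True
        then have x: "x \<in> lens p n s M" "g (foot x) \<le> 0" by (auto simp: N_def E_def)
        have 1: "reg_log e (g (foot x)) = ln e" using x(2) e by (simp add: reg_log_def max_def ln_realpow)
        have "c \<le> u x" using x0(2)[OF x(1)] by (simp add: c_def)
        then have "c\<^sup>2 \<le> e\<^sup>2 + (max (u x) 0)\<^sup>2"
          using c power_mono[of c "u x" 2] by (simp add: add_increasing)
        then have "ln (c\<^sup>2) \<le> ln (e\<^sup>2 + (max (u x) 0)\<^sup>2)"
          using c by (intro ln_mono) (auto intro: add_pos_nonneg simp: e)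
        then have "ln c \<le> reg_log e (u x)" using c by (simp add: reg_log_def ln_realpow)
        moreover have "ln e \<le> ln c" using e c by simp
        ultimately have "(ln c - ln e)\<^sup>2 \<le> (reg_log e (u x) - reg_log e (g (foot x)))\<^sup>2"
          unfolding 1 by (intro power_mono) auto
        then show ?thesis using x True by (simp add: power2_commute ennreal_leI)
      qed simp
    qed
    also have "\<dots> \<le> ennreal (32 * s\<^sup>2) * (\<integral>\<^sup>+x. indicator (ball p (2 * s)) x * ennreal ((norm (\<Lambda>' (u x) *\<^sub>R G x))\<^sup>2) \<partial>lebesgue_on \<Omega>)"
      by (rule trace_fibre_estimate[OF chart p s(1) two_s_le w])
    also have "\<dots> \<le> ennreal (32 * s\<^sup>2) * (ennreal 4 * ennreal (max C 0))"
    proof (rule mult_left_mono)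
      have [measurable]: "u \<in> borel_measurable (lebesgue_on \<Omega>)" "G \<in> borel_measurable (lebesgue_on \<Omega>)"
        using H1_with_traceD[OF u] by auto
      have "(\<integral>\<^sup>+x. indicator (ball p (2 * s)) x * ennreal ((norm (\<Lambda>' (u x) *\<^sub>R G x))\<^sup>2) \<partial>lebesgue_on \<Omega>)
          \<le> (\<integral>\<^sup>+x. ennreal 4 * (indicator (ball p (2 * s)) x * ennreal ((norm (reg_inverse e (u x) *\<^sub>R G x))\<^sup>2)) \<partial>lebesgue_on \<Omega>)"
      proof (rule nn_integral_mono)
        fix x assume "x \<in> space (lebesgue_on \<Omega>)"
        then have xO: "x \<in> \<Omega>" by simp
        show "indicator (ball p (2 * s)) x * ennreal ((norm (\<Lambda>' (u x) *\<^sub>R G x))\<^sup>2)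
            \<le> ennreal 4 * (indicator (ball p (2 * s)) x * ennreal ((norm (reg_inverse e (u x) *\<^sub>R G x))\<^sup>2))"
        proof (cases "x \<in> ball p (2 * s)")
          case True
          then have "0 < u x" using pos[of x] xO s by auto
          then have "\<bar>\<Lambda>' (u x)\<bar> \<le> 2 * reg_inverse e (u x)"
            unfolding \<Lambda>'_def by (intro reg_log_deriv_le_reg_inverse e)
          then have "\<bar>\<Lambda>' (u x)\<bar> * norm (G x) \<le> 2 * (reg_inverse e (u x) * norm (G x))"
            unfolding mult.assoc[symmetric] by (rule mult_right_mono) simp
          then have "(\<bar>\<Lambda>' (u x)\<bar> * norm (G x))\<^sup>2 \<le> (2 * (reg_inverse e (u x) * norm (G x)))\<^sup>2"
            by (rule power_mono) simp
          then have "(norm (\<Lambda>' (u x) *\<^sub>R G x))\<^sup>2 \<le> 4 * (norm (reg_inverse e (u x) *\<^sub>R G x))\<^sup>2"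
            by (simp add: power_mult_distrib)
          then show ?thesis using True by (simp add: ennreal_leI flip: ennreal_mult del: ennreal_numeral)
        qed simp
      qed
      also have "\<dots> = ennreal 4 * (\<integral>\<^sup>+x. indicator (ball p (2 * s)) x * ennreal ((norm (reg_inverse e (u x) *\<^sub>R G x))\<^sup>2) \<partial>lebesgue_on \<Omega>)"
      proof (rule nn_integral_cmult)
        note [measurable] = borel_measurable_reg_inverse[OF e(1,2)]
        have [measurable]: "(indicator (ball p (2 * s)) :: 'a \<Rightarrow> ennreal) \<in> borel_measurable (lebesgue_on \<Omega>)"
          by (rule borel_measurable_interior) (rule borel_measurable_indicator, simp)
        show "(\<lambda>x. indicator (ball p (2 * s)) x * ennreal ((norm (reg_inverse e (u x) *\<^sub>R G x))\<^sup>2)) \<in> borel_measurable (lebesgue_on \<Omega>)"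
          by measurable
      qed
      also have "\<dots> \<le> ennreal 4 * ennreal (max C 0)"
        by (intro mult_left_mono order_trans[OF C[OF e(1,2)]] ennreal_leI) auto
      finally show "(\<integral>\<^sup>+x. indicator (ball p (2 * s)) x * ennreal ((norm (\<Lambda>' (u x) *\<^sub>R G x))\<^sup>2) \<partial>lebesgue_on \<Omega>)
          \<le> ennreal 4 * ennreal (max C 0)" .
    qed simp
    also have "ennreal 4 * ennreal (max C 0) = ennreal (4 * max C 0)"
      by (rule ennreal_mult[symmetric]) auto
    also have "ennreal (32 * s\<^sup>2) * \<dots> = ennreal K"
      unfolding K_def by (rule ennreal_mult[symmetric]) auto
    finally show ?thesis by (simp add: K_def)
  qed
  \<comment> \<open>\<open>e\<close> is chosen such that \<open>ln c - ln e \<ge> y\<close>, and \<open>y\<^sup>2 * m \<ge> y * m > K\<close>\<close>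
  define y where "y = K / m + 1"
  define e where "e = min 1 c * exp (- y)"
  have K: "0 \<le> K" by (simp add: K_def)
  have y: "1 \<le> y" using K m by (simp add: y_def)
  have e: "0 < e" "e \<le> 1" "e \<le> c"
    using c y mult_mono[of "min 1 c" 1 "exp (- y)" 1] mult_mono[of "min 1 c" c "exp (- y)" 1] by (auto simp: e_def)
  have "ln e = ln (min 1 c) - y" using c by (simp add: e_def ln_mult)
  moreover have "ln (min 1 c) \<le> ln c" using c by simp
  ultimately have "y \<le> ln c - ln e" by linarith
  then have "y\<^sup>2 \<le> (ln c - ln e)\<^sup>2" using y by (intro power_mono) auto
  then have "y\<^sup>2 * m \<le> (ln c - ln e)\<^sup>2 * m" using m by (intro mult_right_mono) auto
  also have "\<dots> \<le> K" by (rule bound[OF e])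
  also have "K < y * m" using m by (simp add: y_def field_simps)
  also have "y * m \<le> y\<^sup>2 * m" using y m by (intro mult_right_mono) (auto simp: power2_eq_square)
  finally show False by simp
qed

text \<open>
  Almost every fibre from the lens ends at a point with positive trace, so the lens is, up to a null
  set, contained in the shadow of these points.
\<close>

lemma measure_positive_trace_ge:
  assumes sol: "steklov_solution \<sigma> u G g" and cont: "continuous_on \<Omega> u"
    and pos: "\<And>x. x \<in> \<Omega> \<inter> ball p (4 * s) \<Longrightarrow> 0 < u x"
  shows "unit_ball_vol DIM('a) * (s / (2 * M)) ^ DIM('a)
    \<le> shadow_const DIM('a) * (2 * s) * measure (surface_measure \<Omega>) {y \<in> frontier \<Omega> \<inter> ball p (2 * s). 0 < g y}"
proof -
  have u: "H1_with_trace \<Omega> u G g" using sol by (simp add: steklov_solution_def)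
  note lev = level_set_boundary_borel[OF H1_with_traceD(3)[OF u]]
  define E where "E = {y \<in> frontier \<Omega>. g y \<in> {..0}}"
  define P where "P = {y \<in> frontier \<Omega>. g y \<in> {0<..}} \<inter> ball p (2 * s)"
  have [measurable]: "E \<in> sets borel" "P \<in> sets borel"
    unfolding E_def P_def using lev[of "{..0}"] lev[of "{0<..}"] by auto
  have [measurable]: "foot -` E \<in> sets borel" "foot -` P \<in> sets borel"
    using measurable_sets_borel[OF borel_measurable_foot, of E] measurable_sets_borel[OF borel_measurable_foot, of P] by auto
  have "lens p n s M \<subseteq> (lens p n s M \<inter> foot -` E) \<union> (lens p n s M \<inter> foot -` P)"
    using in_lens(4) by (auto simp: E_def P_def not_le)
  then have "emeasure lborel (lens p n s M) \<le> emeasure lborel ((lens p n s M \<inter> foot -` E) \<union> (lens p n s M \<inter> foot -` P))"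
    by (intro emeasure_mono) auto
  also have "\<dots> \<le> emeasure lborel (lens p n s M \<inter> foot -` E) + emeasure lborel (lens p n s M \<inter> foot -` P)"
    by (intro emeasure_subadditive) auto
  also have "emeasure lborel (lens p n s M \<inter> foot -` E) = 0"
    unfolding E_def by (rule trace_positive_on_lens[OF sol cont pos])
  also have "0 + emeasure lborel (lens p n s M \<inter> foot -` P)
      \<le> ennreal (shadow_const DIM('a) * (2 * s)) * emeasure (surface_measure \<Omega>) (P \<inter> frontier \<Omega>)"
    using emeasure_lens_foot_le[OF chart p s(1) two_s_le, of P] by simp
  also have "P \<inter> frontier \<Omega> = {y \<in> frontier \<Omega> \<inter> ball p (2 * s). 0 < g y}" by (auto simp: P_def)
  also have "ennreal (shadow_const DIM('a) * (2 * s)) * emeasure (surface_measure \<Omega>) \<dots>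
      = ennreal (shadow_const DIM('a) * (2 * s) * measure (surface_measure \<Omega>) {y \<in> frontier \<Omega> \<inter> ball p (2 * s). 0 < g y})"
    using s shadow_const_pos[of "DIM('a)"]
    by (subst ennreal_mult) (auto simp: boundary.emeasure_eq_measure)
  finally show ?thesis
    unfolding emeasure_lens[OF s(1) M_ge_1]
    using s shadow_const_pos[of "DIM('a)"] by (subst (asm) ennreal_le_iff) auto
qed

lemma measure_positive_trace_pos:
  assumes sol: "steklov_solution \<sigma> u G g" and cont: "continuous_on \<Omega> u"
    and pos: "\<And>x. x \<in> \<Omega> \<inter> ball p (4 * s) \<Longrightarrow> 0 < u x"
  shows "0 < measure (surface_measure \<Omega>) {y \<in> frontier \<Omega> \<inter> ball p (2 * s). 0 < g y}"
proof -
  have "0 < unit_ball_vol DIM('a) * (s / (2 * M)) ^ DIM('a)" using s M_ge_1 by simp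
  with measure_positive_trace_ge[OF assms] show ?thesis
    by (metis measure_nonneg mult_zero_right not_le order_antisym_conv less_le)
qed

end

section \<open>Density of nodal sets near the boundary\<close>

text \<open>
  The boundary estimate with a bump of radius \<open>4 s\<close>: its right-hand side is of order \<open>s ^ (d - 2)\<close>, and
  the part of the boundary with positive trace has measure at least of order \<open>s ^ (d - 1)\<close>.
\<close>

lemma eigenvalue_le_of_positive_near_boundary:
  assumes chart: "boundary_chart \<Omega> p R M n \<tau>" and p: "p \<in> frontier \<Omega>" and s: "0 < s" "4 * s \<le> R"
    and sol: "steklov_solution \<sigma> u G g" and \<sigma>: "0 < \<sigma>" and cont: "continuous_on \<Omega> u"
    and pos: "\<And>x. x \<in> \<Omega> \<inter> ball p (4 * s) \<Longrightarrow> 0 < u x"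
  shows "\<sigma> \<le> 2 * shadow_const DIM('a) * (8 * M) ^ DIM('a) / s"
proof -
  have u: "H1_with_trace \<Omega> u G g" using sol by (simp add: steklov_solution_def)
  have M: "1 \<le> M" using chart by (simp add: boundary_chart_def depth_function_def)
  define \<psi> where "\<psi> = bump p (4 * s)"
  define E where "E = {y \<in> frontier \<Omega> \<inter> ball p (2 * s). 0 < g y}"
  define d where "d = DIM('a)"
  define \<omega> where "\<omega> = unit_ball_vol (real d)"
  define \<kappa> where "\<kappa> = shadow_const d"
  have r: "0 < 4 * s" using s by simp
  have C\<psi>: "Ck 1 \<psi>" unfolding \<psi>_def by (rule Ck_1_bump(1)[OF r])
  note b = bump_bounds[OF r, where p = p, folded \<psi>_def]
  have gb: "(norm (grad \<psi> x))\<^sup>2 \<le> 16 / (4 * s)\<^sup>2 * \<psi> x" for x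
    unfolding \<psi>_def by (rule Ck_1_bump(2)[OF r])
  have \<omega>: "0 < \<omega>" by (simp add: \<omega>_def)
  have \<kappa>: "0 < \<kappa>" unfolding \<kappa>_def by (rule shadow_const_pos)
  note [measurable] = H1_with_traceD(3)[OF u] Ck_1_measurable[OF C\<psi>]
  have E: "E \<in> sets (surface_measure \<Omega>)"
  proof -
    have "E = {y \<in> frontier \<Omega>. g y \<in> {0<..}} \<inter> ball p (2 * s)" by (auto simp: E_def)
    also have "\<dots> \<in> sets borel" using level_set_boundary_borel[OF H1_with_traceD(3)[OF u], of "{0<..}"] by auto
    finally have "E \<in> sets borel" .
    moreover have "E \<subseteq> frontier \<Omega>" by (auto simp: E_def)
    ultimately show ?thesis by (auto simp: sets_surface_measure sets_restrict_space_iff)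
  qed
  have "1 / 2 * measure (surface_measure \<Omega>) E \<le> (LINT y|surface_measure \<Omega>. \<psi> y * (if 0 < g y then 1 else 0))"
  proof -
    have "1 / 2 * measure (surface_measure \<Omega>) E = (LINT y|surface_measure \<Omega>. 1 / 2 * indicat_real E y)"
      using E sets.sets_into_space[OF E] by (simp add: Int_absorb2)
    also have "\<dots> \<le> (LINT y|surface_measure \<Omega>. \<psi> y * (if 0 < g y then 1 else 0))"
    proof (rule integral_mono)
      show "integrable (surface_measure \<Omega>) (\<lambda>y. 1 / 2 * indicat_real E y)"
        using E by (intro integrable_mult_right integrable_real_indicator) (auto simp: boundary.emeasure_finite less_top[symmetric])
      show "integrable (surface_measure \<Omega>) (\<lambda>y. \<psi> y * (if 0 < g y then 1 else 0))"
        by (rule boundary.integrable_const_bound[of _ 1]) (use b in auto)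
      fix y
      show "1 / 2 * indicat_real E y \<le> \<psi> y * (if 0 < g y then 1 else 0)"
        using b(4)[of y] b(1)[of y] by (auto simp: E_def indicator_def)
    qed
    finally show ?thesis .
  qed
  moreover have "\<sigma> * (LINT y|surface_measure \<Omega>. \<psi> y * (if 0 < g y then 1 else 0))
      \<le> 16 / (4 * s)\<^sup>2 / 2 * measure (lebesgue_on \<Omega>) (\<Omega> \<inter> ball p (4 * s))"
    by (rule steklov_boundary_estimate[where S = "ball p (4 * s)", OF sol less_imp_le[OF \<sigma>] C\<psi> b(1) gb _ borel_open[OF open_ball] b(3) pos]) simp
  moreover have "measure (lebesgue_on \<Omega>) (\<Omega> \<inter> ball p (4 * s)) \<le> \<omega> * (4 * s) ^ d"
  proof -
    have "measure (lebesgue_on \<Omega>) (\<Omega> \<inter> ball p (4 * s)) = measure lebesgue (\<Omega> \<inter> ball p (4 * s))"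
      by (rule measure_restrict_space) auto
    also have "\<dots> \<le> measure lebesgue (ball p (4 * s))"
      by (intro measure_mono_fmeasurable) auto
    also have "\<dots> = \<omega> * (4 * s) ^ d"
      using content_ball[of "4 * s" p] s by (simp add: \<omega>_def d_def)
    finally show ?thesis .
  qed
  ultimately have upper: "\<sigma> * (1 / 2 * measure (surface_measure \<Omega>) E) \<le> 16 / (4 * s)\<^sup>2 / 2 * (\<omega> * (4 * s) ^ d)"
    using \<sigma> by (smt (verit) mult_left_mono zero_le_divide_iff zero_le_power2)
  have lower: "\<omega> * (s / (2 * M)) ^ d \<le> \<kappa> * (2 * s) * measure (surface_measure \<Omega>) E"
    unfolding \<omega>_def d_def \<kappa>_def E_def by (rule measure_positive_trace_ge[OF chart p s sol cont pos])
  have "\<sigma> * (\<omega> * (s / (2 * M)) ^ d) \<le> \<sigma> * (\<kappa> * (2 * s) * measure (surface_measure \<Omega>) E)"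
    using \<sigma> by (intro mult_left_mono lower) auto
  also have "\<dots> = \<kappa> * (4 * s) * (\<sigma> * (1 / 2 * measure (surface_measure \<Omega>) E))" by simp
  also have "\<dots> \<le> \<kappa> * (4 * s) * (16 / (4 * s)\<^sup>2 / 2 * (\<omega> * (4 * s) ^ d))"
    using \<kappa> s by (intro mult_left_mono upper) auto
  also have "\<dots> = \<omega> * (2 * \<kappa> * (4 * s) ^ d / s)"
    using s by (simp add: power2_eq_square field_simps)
  finally have "\<omega> * (\<sigma> * (s / (2 * M)) ^ d) \<le> \<omega> * (2 * \<kappa> * (4 * s) ^ d / s)"
    by (simp only: mult.left_commute)
  then have "\<sigma> * (s / (2 * M)) ^ d \<le> 2 * \<kappa> * (4 * s) ^ d / s"
    using \<omega> by (simp only: mult_le_cancel_left_pos)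
  moreover have "4 * s = 8 * M * (s / (2 * M))" using M by simp
  then have "(4 * s) ^ d = (8 * M) ^ d * (s / (2 * M)) ^ d" by (metis power_mult_distrib)
  ultimately have "\<sigma> * (s / (2 * M)) ^ d \<le> 2 * \<kappa> * (8 * M) ^ d / s * (s / (2 * M)) ^ d" by simp
  moreover have "0 < (s / (2 * M)) ^ d" using s M by simp
  ultimately show ?thesis
    unfolding d_def[symmetric] \<kappa>_def[symmetric] by (simp only: mult_le_cancel_right_pos)
qed

text \<open>
  With the cutoff 1 the right-hand side of the boundary estimate is 0, although the trace is positive
  on a set of positive measure.
\<close>

lemma positive_steklov_solution_False:
  assumes chart: "boundary_chart \<Omega> p R M n \<tau>" and p: "p \<in> frontier \<Omega>"
    and sol: "steklov_solution \<sigma> u G g" and \<sigma>: "0 < \<sigma>" and cont: "continuous_on \<Omega> u"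
    and pos: "\<And>x. x \<in> \<Omega> \<Longrightarrow> 0 < u x"
  shows False
proof -
  have u: "H1_with_trace \<Omega> u G g" using sol by (simp add: steklov_solution_def)
  note [measurable] = H1_with_traceD(3)[OF u]
  define s where "s = R / 4"
  have s: "0 < s" "4 * s \<le> R" using chart by (auto simp: s_def boundary_chart_def)
  define E where "E = {y \<in> frontier \<Omega> \<inter> ball p (2 * s). 0 < g y}"
  define P where "P = {y \<in> space (surface_measure \<Omega>). 0 < g y}"
  have P: "P \<in> sets (surface_measure \<Omega>)" unfolding P_def by measurable
  have "0 < measure (surface_measure \<Omega>) E"
    unfolding E_def by (rule measure_positive_trace_pos[OF chart p s sol cont]) (use pos in auto)
  also have "\<dots> \<le> measure (surface_measure \<Omega>) P"
    by (rule boundary.finite_measure_mono[OF _ P]) (auto simp: E_def P_def)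
  also have "measure (surface_measure \<Omega>) P = (LINT y|surface_measure \<Omega>. indicat_real P y)"
    using P sets.sets_into_space[OF P] by (simp add: Int_absorb2)
  also have "\<dots> = (LINT y|surface_measure \<Omega>. 1 * (if 0 < g y then 1 else 0))"
    by (intro Bochner_Integration.integral_cong) (auto simp: P_def)
  finally have "0 < \<sigma> * (LINT y|surface_measure \<Omega>. 1 * (if 0 < g y then 1 else 0))"
    using \<sigma> by simp
  also have "\<dots> \<le> 0 / 2 * measure (lebesgue_on \<Omega>) (\<Omega> \<inter> UNIV)"
    by (rule steklov_boundary_estimate[OF sol less_imp_le[OF \<sigma>] Ck_1_const]) (use pos in \<open>auto simp: grad_const\<close>)
  finally show False by simp
qed

text \<open>
  Testing with \<open>u\<close> itself gives \<open>\<integral> |G|\<^sup>2 = \<sigma> \<integral> g\<^sup>2\<close>, so that \<open>G\<close> and \<open>g\<close> vanish almost everywhere. Thus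
  \<open>u\<close> is constant, and the fibre estimate compares this constant with the trace 0.
\<close>

lemma steklov_solution_negative_eigenvalue:
  assumes chart: "boundary_chart \<Omega> p R M n \<tau>" and p: "p \<in> frontier \<Omega>"
    and sol: "steklov_solution \<sigma> u G g" and \<sigma>: "\<sigma> < 0" and cont: "continuous_on \<Omega> u" and x: "x \<in> \<Omega>"
  shows "u x = 0"
proof -
  interpret depth_function n \<tau> M using chart by (simp add: boundary_chart_def)
  have u: "H1_with_trace \<Omega> u G g" using sol by (simp add: steklov_solution_def)
  note [measurable] = H1_with_traceD(1,2,3)[OF u]
  have "(LINT x|lebesgue_on \<Omega>. G x \<bullet> G x) = \<sigma> * (LINT y|surface_measure \<Omega>. g y * g y)"
    using sol u by (simp add: steklov_solution_def)
  then have eq: "(LINT x|lebesgue_on \<Omega>. (norm (G x))\<^sup>2) = \<sigma> * (LINT y|surface_measure \<Omega>. (g y)\<^sup>2)"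
    by (simp add: dot_square_norm power2_eq_square[of "g _"])
  have nn: "0 \<le> (LINT x|lebesgue_on \<Omega>. (norm (G x))\<^sup>2)" "0 \<le> (LINT y|surface_measure \<Omega>. (g y)\<^sup>2)"
    by (intro Bochner_Integration.integral_nonneg; simp)+
  then have g0: "(LINT y|surface_measure \<Omega>. (g y)\<^sup>2) = 0"
    using eq \<sigma> by (metis mult_less_0_iff not_le order_antisym_conv)
  then have G0: "(LINT x|lebesgue_on \<Omega>. (norm (G x))\<^sup>2) = 0" using eq by simp
  have "AE x in lebesgue_on \<Omega>. (norm (G x))\<^sup>2 = 0"
    using integral_nonneg_eq_0_iff_AE[OF H1_with_traceD(4)[OF u]] G0 by simp
  then have AEG: "AE x in lebesgue_on \<Omega>. G x = 0" by (auto elim!: eventually_mono)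
  obtain c where c: "\<And>x. x \<in> \<Omega> \<Longrightarrow> u x = c"
    using constant_if_gradient_0[OF u cont AEG] by (auto simp: constant_on_def)
  have AEg: "AE y in surface_measure \<Omega>. (g y)\<^sup>2 = 0"
    using integral_nonneg_eq_0_iff_AE[OF H1_with_traceD(5)[OF u]] g0 by simp
  define s where "s = R / 2"
  have s: "0 < s" "2 * s \<le> R" using chart by (auto simp: s_def boundary_chart_def)
  define E where "E = {y \<in> frontier \<Omega>. g y \<in> - {0}}"
  have [measurable]: "E \<in> sets borel"
    unfolding E_def by (rule level_set_boundary_borel[OF H1_with_traceD(3)[OF u]]) simp
  have [measurable]: "foot -` E \<in> sets borel"
    using measurable_sets_borel[OF borel_measurable_foot, of E] by simp
  let ?L = "lens p n s M"
  have "emeasure (surface_measure \<Omega>) (E \<inter> frontier \<Omega>) = 0"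
  proof -
    have "E \<inter> frontier \<Omega> = {y \<in> space (surface_measure \<Omega>). \<not> (g y)\<^sup>2 = 0}" by (auto simp: E_def)
    moreover have "{y \<in> space (surface_measure \<Omega>). \<not> (g y)\<^sup>2 = 0} \<in> sets (surface_measure \<Omega>)" by measurable
    ultimately show ?thesis using AEg by (simp add: AE_iff_measurable[OF _ refl])
  qed
  then have null: "emeasure lborel (?L \<inter> foot -` E) = 0"
    using emeasure_lens_foot_le[OF chart p s, of E] by simp
  have "ennreal (c\<^sup>2) * emeasure lborel (?L - foot -` E) = (\<integral>\<^sup>+x. indicator (?L - foot -` E) x * ennreal (c\<^sup>2) \<partial>lborel)"
    by (subst nn_integral_multc) (auto simp: mult.commute)
  also have "\<dots> = (\<integral>\<^sup>+x. indicator (?L - foot -` E) x * ennreal (c\<^sup>2) \<partial>lebesgue_on \<Omega>)"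
    by (rule nn_integral_interior_indicator[symmetric]) (use lens_fibre(3)[OF chart p s] in auto)
  also have "\<dots> \<le> (\<integral>\<^sup>+x. indicator ?L x * ennreal ((g (foot x) - u x)\<^sup>2) \<partial>lebesgue_on \<Omega>)"
  proof (rule nn_integral_mono)
    fix x
    show "indicator (?L - foot -` E) x * ennreal (c\<^sup>2) \<le> indicator ?L x * ennreal ((g (foot x) - u x)\<^sup>2)"
    proof (cases "x \<in> ?L - foot -` E")
      case True
      then have "g (foot x) = 0" "u x = c"
        using lens_fibre(2,3)[OF chart p s, of x] c by (auto simp: E_def)
      then show ?thesis using True by simp
    qed simp
  qed
  also have "\<dots> \<le> ennreal (32 * s\<^sup>2) * (\<integral>\<^sup>+x. indicator (ball p (2 * s)) x * ennreal ((norm (G x))\<^sup>2) \<partial>lebesgue_on \<Omega>)"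
    by (rule trace_fibre_estimate[OF chart p s u])
  also have "(\<integral>\<^sup>+x. indicator (ball p (2 * s)) x * ennreal ((norm (G x))\<^sup>2) \<partial>lebesgue_on \<Omega>) = (\<integral>\<^sup>+x. 0 \<partial>lebesgue_on \<Omega>)"
    by (rule nn_integral_cong_AE) (use AEG in \<open>auto elim!: eventually_mono\<close>)
  finally have "c\<^sup>2 = 0 \<or> emeasure lborel (?L - foot -` E) = 0" by (auto simp: ennreal_eq_0_iff)
  moreover have "emeasure lborel (?L - foot -` E) \<noteq> 0"
  proof
    assume "emeasure lborel (?L - foot -` E) = 0"
    moreover have "emeasure lborel ((?L \<inter> foot -` E) \<union> (?L - foot -` E))
        \<le> emeasure lborel (?L \<inter> foot -` E) + emeasure lborel (?L - foot -` E)"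
      by (intro emeasure_subadditive) auto
    ultimately have "emeasure lborel ?L = 0" using null by (simp add: Int_Diff_Un)
    moreover have "0 < unit_ball_vol DIM('a) * (s / (2 * M)) ^ DIM('a)" using s M_ge_1 by simp
    ultimately show False using emeasure_lens[OF s(1) M_ge_1, of p n] by (simp add: ennreal_eq_0_iff)
  qed
  ultimately show ?thesis using c[OF x] by simp
qed

theorem nodal_set_dense_near_boundary:
  "\<exists>C>0. \<forall>\<sigma> u p. \<sigma> \<noteq> 0 \<and> steklov_eigenfunction \<Omega> \<sigma> u \<and> continuous_on \<Omega> u \<and> p \<in> frontier \<Omega> \<longrightarrow>
    nodal_set \<Omega> u \<inter> ball p (C / \<sigma>) \<noteq> {}"
proof -
  obtain R M where R: "0 < R" and M: "1 \<le> M"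
    and charts: "\<And>p. p \<in> frontier \<Omega> \<Longrightarrow> \<exists>n \<tau>. boundary_chart \<Omega> p R M n \<tau>"
    using bounded_lipschitz_domain_charts[OF lip] by metis
  define K where "K = 12 * M * (2 * shadow_const DIM('a) * (8 * M) ^ DIM('a))"
  have K: "0 < K" using M shadow_const_pos[of "DIM('a)"] by (simp add: K_def)
  define D where "D = diameter (closure \<Omega>)"
  have D: "0 \<le> D" unfolding D_def using bounded_domain by (intro diameter_ge_0) (simp add: bounded_closure)
  \<comment> \<open>the first summand makes balls of radius \<open>C / \<sigma> > R\<close> contain the domain, see the last case below\<close>
  define C where "C = K * (D + 1) / R + K + 1"
  have C: "0 < C" "K < C" "K * (D + 1) / R \<le> C"
    using K D R by (auto simp: C_def add_pos_nonneg add_nonneg_pos)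
  have "nodal_set \<Omega> u \<inter> ball p (C / \<sigma>) \<noteq> {}"
    if \<sigma>: "\<sigma> \<noteq> 0" and eig: "steklov_eigenfunction \<Omega> \<sigma> u" and cont: "continuous_on \<Omega> u" and p: "p \<in> frontier \<Omega>" for \<sigma> u p
  proof
    assume "nodal_set \<Omega> u \<inter> ball p (C / \<sigma>) = {}"
    then have nz: "u x \<noteq> 0" if "x \<in> \<Omega> \<inter> ball p (C / \<sigma>)" for x using that by (auto simp: nodal_set_def)
    obtain G g where sol: "steklov_solution \<sigma> u G g" using steklov_eigenfunctionD(1)[OF eig] by blast
    obtain n \<tau> where chart: "boundary_chart \<Omega> p R M n \<tau>" using charts[OF p] by blast
    have \<sigma>pos: "0 < \<sigma>"
    proof (rule ccontr)
      assume "\<not> 0 < \<sigma>"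
      then have "\<sigma> < 0" using \<sigma> by simp
      then have "AE x in lebesgue_on \<Omega>. u x = 0"
        using steklov_solution_negative_eigenvalue[OF chart p sol _ cont] by (intro AE_I2) simp
      then show False using steklov_eigenfunctionD(2)[OF eig] by blast
    qed
    note sol' = steklov_solution_uminus[OF sol]
    have cont': "continuous_on \<Omega> (\<lambda>x. - u x)" using cont by (intro continuous_intros)
    \<comment> \<open>radius within the chart; the sign is constant at distance \<open>\<rho> / (3 M) = 4 s\<close> from \<open>p\<close>\<close>
    define \<rho> where "\<rho> = min (C / \<sigma>) R"
    have \<rho>: "0 < \<rho>" "\<rho> \<le> R" "\<rho> \<le> C / \<sigma>" using C R \<sigma>pos by (auto simp: \<rho>_def)
    define s where "s = \<rho> / (12 * M)"
    have s: "0 < s" "4 * s = \<rho> / (3 * M)" using \<rho> M by (auto simp: s_def)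
    have "\<rho> / (3 * M) \<le> \<rho>" using \<rho> M by (simp add: field_simps mult_le_cancel_left1)
    then have s4: "4 * s \<le> R" using s \<rho> by linarith
    have le: "\<sigma> \<le> 2 * shadow_const DIM('a) * (8 * M) ^ DIM('a) / s"
      using const_sign_near_boundary[OF chart p \<rho>(1,2) cont]
    proof
      show "u x \<noteq> 0" if "x \<in> \<Omega> \<inter> ball p \<rho>" for x using that \<rho>(3) by (intro nz) auto
    next
      assume "\<forall>x\<in>\<Omega> \<inter> ball p (\<rho> / (3 * M)). 0 < u x"
      then show ?thesis
        by (intro eigenvalue_le_of_positive_near_boundary[OF chart p s(1) s4 sol \<sigma>pos cont]) (simp add: s(2))
    next
      assume "\<forall>x\<in>\<Omega> \<inter> ball p (\<rho> / (3 * M)). u x < 0"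
      then show ?thesis
        by (intro eigenvalue_le_of_positive_near_boundary[OF chart p s(1) s4 sol' \<sigma>pos cont']) (simp add: s(2))
    qed
    have "2 * shadow_const DIM('a) * (8 * M) ^ DIM('a) / s = K / \<rho>"
      using \<rho> M by (simp add: K_def s_def)
    with le have "\<sigma> \<le> K / \<rho>" by simp
    then have \<sigma>\<rho>: "\<sigma> * \<rho> \<le> K" using \<rho> by (simp add: pos_le_divide_eq)
    show False
    proof (cases "C / \<sigma> \<le> R")
      case True
      then have "\<sigma> * \<rho> = C" using \<sigma>pos by (simp add: \<rho>_def)
      then show False using \<sigma>\<rho> C by simp
    next
      case False
      then have "\<sigma> * R \<le> K" using \<sigma>\<rho> by (simp add: \<rho>_def)
      have "D + 1 \<le> C / \<sigma>"
      proof -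
        have "(D + 1) * (\<sigma> * R) \<le> (D + 1) * K" using D \<open>\<sigma> * R \<le> K\<close> by (intro mult_left_mono) auto
        also have "\<dots> \<le> C * R" using C(3) R by (simp add: pos_divide_le_eq mult.commute)
        finally have "((D + 1) * \<sigma>) * R \<le> C * R" by (simp add: mult.assoc)
        then have "(D + 1) * \<sigma> \<le> C" using R by (simp only: mult_le_cancel_right_pos)
        then show ?thesis using \<sigma>pos by (simp add: pos_le_divide_eq)
      qed
      have nz': "u x \<noteq> 0" if x: "x \<in> \<Omega>" for x
      proof (rule nz)
        have "dist p x \<le> D"
          unfolding D_def using x p closure_subset[of \<Omega>] bounded_domain
          by (intro diameter_bounded_bound) (auto simp: frontier_def bounded_closure)
        then show "x \<in> \<Omega> \<inter> ball p (C / \<sigma>)" using x \<open>D + 1 \<le> C / \<sigma>\<close> by simp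
      qed
      from continuous_nonzero_const_sign[OF connected_domain cont nz'] show False
      proof
        assume "\<forall>x\<in>\<Omega>. 0 < u x"
        then show False using positive_steklov_solution_False[OF chart p sol \<sigma>pos cont] by blast
      next
        assume "\<forall>x\<in>\<Omega>. u x < 0"
        then show False using positive_steklov_solution_False[OF chart p sol' \<sigma>pos cont'] by simp
      qed
    qed
  qed
  then show ?thesis using C(1) by blast
qed

end

theorem theorem1:
  fixes \<Omega> :: "'a::euclidean_space set"
  assumes "DIM('a) \<ge> 2" and "bounded_lipschitz_domain \<Omega>"
  shows "\<exists>C::real. C > 0 \<and>
    (\<forall>\<sigma> u p. steklov_eigenvalue \<Omega> \<sigma> \<and> \<sigma> \<noteq> 0 \<and>
       steklov_eigenfunction \<Omega> \<sigma> u \<and> continuous_on \<Omega> u \<and> p \<in> frontier \<Omega> \<longrightarrow>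
       nodal_set \<Omega> u \<inter> ball p (C / \<sigma>) \<noteq> {})"
proof -
  interpret lipschitz_domain \<Omega> using assms by unfold_locales
  show ?thesis using nodal_set_dense_near_boundary by blast
qed

end
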